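(* Let $\varphi$ be a minimal counterexample to Vaught's conjecture and let $\lambda\in S^\circ=\mathfrak F\cap C_{5.3}\cap(\mathrm{qr}(\varphi),\omega_1)$. If $M,M'$ are fiber models at $\lambda$ with $\mathrm{trace}(M)=\mathrm{trace}(M')$, and $\bar c\in M^{<\omega}$, $\bar d\in M'^{<\omega}$ are tuples whose complete $L_{T_\lambda}$-types (in $M$ and $M'$ respectively) are equal, then $(M,\bar c)\cong(M',\bar d)$.
   Context: Structures are countable structures in a countable vocabulary; classes of models are counted up to isomorphism. $\Sigma^{\mathrm{in}}_0=\Pi^{\mathrm{in}}_0$ is the set of finitary quantifier-free formulas; for $\alpha>0$, $\Sigma^{\mathrm{in}}_\alpha$ consists of countable disjunctions of formulas $\exists\bar x\,\psi$ with $\psi\in\Pi^{\mathrm{in}}_\beta$, $\beta<\alpha$, and $\Pi^{\mathrm{in}}_\alpha$ is dual. $M\equiv_\alpha N$: $M,N$ satisfy the same $\Pi^{\mathrm{in}}_\alpha$ (equivalently $\Sigma^{\mathrm{in}}_\alpha$) sentences. A Scott sentence of $M$ is an $L_{\omega_1\omega}$ sentence whose countable models are exactly the copies of $M$. $\mathrm{cSR}(M)$: the least $\alpha$ such that $M$ has a $\Pi^{\mathrm{in}}_{\alpha+1}$ Scott sentence. $\omega_1^A=\min\{\omega_1^X: X\in 2^\omega\text{ computes a copy of }A\}$. $\mathrm{qr}(S)$: the least $\beta$ with $S\in\Pi^{\mathrm{in}}_\beta\cup\Sigma^{\mathrm{in}}_\beta$. Standing hypotheses: Vaught's conjecture fails,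 and $\varphi$ is a minimal counterexample: an $L_{\omega_1\omega}$ sentence with exactly $\aleph_1$ countable models up to isomorphism, scattered (for each $\alpha<\omega_1$ at most countably many $\equiv_\alpha$-classes among its models), and such that for every $L_{\omega_1\omega}$ sentence $\psi$ one of $\varphi\wedge\psi$, $\varphi\wedge\neg\psi$ has only countably many models. Moreover for each $\alpha<\omega_1$ only countably many $\Sigma^{\mathrm{in}}_\alpha$-types are realized in models of $\varphi$. For each $\beta<\omega_1$ exactly one $\equiv_\beta$-class of models of $\varphi$ is uncountable, denoted $\mathcal C_\beta$. $f(\alpha)=\min\{\beta:(\forall M\models\varphi)(M\notin\mathcal C_\alpha\Rightarrow\mathrm{cSR}(M)<\beta)\}$, $\mathfrak F=\{\alpha<\omega_1:f(\alpha)\le\alpha\}$. Sacks rank. A fragment is a countable set of $L_{\omega_1\omega}$ formulas closed under subformulas, substitution and the finitary connectives and quantifiers. For a structure $A$: $L^A_0$ is the finitary language; $T^A_\delta=\mathrm{Th}_{L^A_\delta}(A)$; $L^A_{\delta+1}$ is the least fragment containing $L^A_\delta$ and $\bigwedge p$ for every non-principal complete $L^A_\delta$-type $p$ realized in $A$; unions at limits. $\mathrm{sr}_{\mathrm{Sacks}}(A)$ is the least $\delta$ such that $A$ is the atomic model of $T^A_\delta$. Tree of nodes. $L_0$ is the fragment generated by $\varphi$, and $T$ is $\{\varphi\}$ together with the tautologies of $L_0$. A theory $T'$ in a fragment $L'$ is $\omega$-complete if for each sentence $F\in L'$, $F\in T'$ or $\neg F\in T'$, and whenever $\bigvee_iF_i\in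 T'$, some $F_i\in T'$; it is finitarily consistent if no contradiction is derivable from it by finite-length deductions. Nodes on level $0$: finitarily consistent $\omega$-complete extensions of $T$ in $L_0$. An $n$-type of a node $S$ (in fragment $L_S$) is a maximal set of $L_S(\bar x)$-formulas finitarily consistent with $S$; it is principal if generated over $S$ by one of its formulas. Nodes on level $\delta+1$: finitarily consistent $\omega$-complete extensions of a level-$\delta$ node $S$ in $L'_S$, the least fragment containing $L_S$ and $\bigwedge p$ for each non-principal $n$-type $p$ of $S$. Nodes on limit levels: unions along chains. Every model of a node is a model of $\varphi$. Fixed data, supplied by a theorem of Sacks (Bounds on weak scattering, Prop. 5.2 and Thm. 5.3): an increasing branch $(T_\delta)_{\delta<\omega_1}$ of nodes, $T_\delta$ on level $\delta$ with fragment $L_{T_\delta}$, unions at limits, $\Delta_1$ over $L(\omega_1,T)$, such that every $T_\delta$ has an atomic model of $\mathrm{sr}_{\mathrm{Sacks}}$ exactly $\delta$; and a club $C_{5.3}\subseteq\omega_1$ (the ordinals $\omega_1^{L(\beta_\delta,T)}$ for the transitive collapses $L(\beta_\delta,T)$ of the $\Sigma_1$-hulls in Sacks' proof) such that for each $\lambda\in C_{5.3}$: $\lambda>\omega$ and $L(\lambda,T)$ is $\Sigma_1$-admissible; and the set of non-principal $n$-types of $T_\lambda$ is non-empty and countable. For $\lambda\in S^\circ$: $N$ is the set of non-principal $n$-types (all $n\ge1$) of $T_\lambda$. The fiber at $\lambda$ is the class of countable $M$ with $M\models T_\lambda$ and $\omega_1^M=\lambda$; its members are fiber models. For a fiber model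 $M$, $\mathrm{trace}(M)=\{p\in N:M\text{ realizes }p\}$. *)

theory Defs
  imports Main "HOL-Library.Countable_Set_Type" "HOL-Library.Nat_Bijection"
begin

section \<open>Hereditarily countable sets and the ordinals below \<open>\<omega>\<^sub>1\<close>\<close>

text \<open>The initial algebra of the countable powerset functor is the universe HC of hereditarily
  countable sets: extensional, well-founded, and closed under countable subsets.\<close>

datatype hc = HSet "hc cset"

primrec elts :: "hc \<Rightarrow> hc set" where
  "elts (HSet X) = rcset X"

text \<open>Only meaningful for countable arguments.\<close>

definition hset :: "hc set \<Rightarrow> hc" where
  "hset A = HSet (acset A)"

lemma countable_elts [simp]: "countable (elts x)"
  by (cases x) simp

lemma elts_hset [simp]: "countable A \<Longrightarrow> elts (hset A) = A"
  by (simp add: hset_def)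

lemma hc_ext: "elts x = elts y \<Longrightarrow> x = y"
  by (cases x; cases y) (simp add: rcset_inject)

lemma hc_induct: "(\<And>x. (\<And>y. y \<in> elts x \<Longrightarrow> P y) \<Longrightarrow> P x) \<Longrightarrow> P x"
  by (induction x) (metis elts.simps)

text \<open>Von Neumann ordinals.\<close>

definition is_ordinal :: "hc \<Rightarrow> bool" where
  "is_ordinal x \<longleftrightarrow> (\<forall>y\<in>elts x. elts y \<subseteq> elts x) \<and> (\<forall>y\<in>elts x. \<forall>z\<in>elts y. elts z \<subseteq> elts y)"

lemma is_ordinal_mem: "is_ordinal x \<Longrightarrow> y \<in> elts x \<Longrightarrow> is_ordinal y"
  unfolding is_ordinal_def by blast

lemma is_ordinal_trans: "is_ordinal z \<Longrightarrow> y \<in> elts z \<Longrightarrow> x \<in> elts y \<Longrightarrow> x \<in> elts z"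
  unfolding is_ordinal_def by blast

lemma hc_not_mem_self: "x \<notin> elts x"
proof (induction x rule: hc_induct)
  case (1 x)
  then show ?case by blast
qed

lemma is_ordinal_linear:
  "is_ordinal x \<Longrightarrow> is_ordinal y \<Longrightarrow> x \<in> elts y \<or> x = y \<or> y \<in> elts x"
proof (induction x arbitrary: y rule: hc_induct)
  case (1 x)
  note outer = 1
  from \<open>is_ordinal y\<close> show ?case
  proof (induction y rule: hc_induct)
    case (1 y)
    show ?case
    proof (rule ccontr)
      assume neg: "\<not> (x \<in> elts y \<or> x = y \<or> y \<in> elts x)"
      have "elts x \<subseteq> elts y"
      proof
        fix a assume a: "a \<in> elts x"
        have "a \<in> elts y \<or> a = y \<or> y \<in> elts a"
          using outer(1)[OF a] is_ordinal_mem[OF outer(2) a] 1(2) by blast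
        then show "a \<in> elts y" using neg a is_ordinal_trans[OF outer(2) a] by blast
      qed
      moreover have "elts y \<subseteq> elts x"
      proof
        fix b assume b: "b \<in> elts y"
        have "x \<in> elts b \<or> x = b \<or> b \<in> elts x"
          using 1(1)[OF b] is_ordinal_mem[OF 1(2) b] by blast
        then show "b \<in> elts x" using neg b is_ordinal_trans[OF 1(2) b] by blast
      qed
      ultimately show False using neg hc_ext by blast
    qed
  qed
qed

typedef omega1 = "{x. is_ordinal x}"
  by (rule exI[of _ "hset {}"]) (simp add: is_ordinal_def)

instantiation omega1 :: wellorder
begin

definition less_omega1 :: "omega1 \<Rightarrow> omega1 \<Rightarrow> bool" where
  "\<alpha> < \<beta> \<longleftrightarrow> Rep_omega1 \<alpha> \<in> elts (Rep_omega1 \<beta>)"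

definition less_eq_omega1 :: "omega1 \<Rightarrow> omega1 \<Rightarrow> bool" where
  "\<alpha> \<le> \<beta> \<longleftrightarrow> \<alpha> < \<beta> \<or> \<alpha> = (\<beta> :: omega1)"

instance
proof
  have ord: "is_ordinal (Rep_omega1 a)" for a using Rep_omega1 by blast
  have tr: "a < c" if "a < b" "b < c" for a b c :: omega1
    using that is_ordinal_trans[OF ord] unfolding less_omega1_def by blast
  have irr: "\<not> a < a" for a :: omega1
    unfolding less_omega1_def by (rule hc_not_mem_self)
  fix x y z :: omega1
  show "(x < y) = (x \<le> y \<and> \<not> y \<le> x)"
    unfolding less_eq_omega1_def using tr[of x y x] irr[of x] by auto
  show "x \<le> x" unfolding less_eq_omega1_def by simp
  show "x \<le> y \<Longrightarrow> y \<le> z \<Longrightarrow> x \<le> z" unfolding less_eq_omega1_def using tr by blast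
  show "x \<le> y \<Longrightarrow> y \<le> x \<Longrightarrow> x = y" unfolding less_eq_omega1_def using tr[of x y x] irr[of x] by auto
  show "x \<le> y \<or> y \<le> x"
    using is_ordinal_linear[OF ord ord] Rep_omega1_inject
    unfolding less_eq_omega1_def less_omega1_def by blast
next
  fix P :: "omega1 \<Rightarrow> bool" and a :: omega1
  assume step: "\<And>x. (\<And>y. y < x \<Longrightarrow> P y) \<Longrightarrow> P x"
  have "is_ordinal x \<longrightarrow> P (Abs_omega1 x)" for x
  proof (induction x rule: hc_induct)
    case (1 x)
    show ?case
    proof
      assume x: "is_ordinal x"
      show "P (Abs_omega1 x)"
      proof (rule step)
        fix y assume "y < Abs_omega1 x"
        then have "Rep_omega1 y \<in> elts x"
          using x by (simp add: less_omega1_def Abs_omega1_inverse)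
        then have "P (Abs_omega1 (Rep_omega1 y))" using 1 Rep_omega1 by blast
        then show "P y" by (simp add: Rep_omega1_inverse)
      qed
    qed
  qed
  then have "P (Abs_omega1 (Rep_omega1 a))" using Rep_omega1 by blast
  then show "P a" by (simp add: Rep_omega1_inverse)
qed

end

lemma countable_below_omega1: "countable {\<beta>. \<beta> < (\<alpha> :: omega1)}"
proof (rule countable_subset)
  show "{\<beta>. \<beta> < \<alpha>} \<subseteq> Abs_omega1 ` elts (Rep_omega1 \<alpha>)"
  proof
    fix \<beta> assume "\<beta> \<in> {\<beta>. \<beta> < \<alpha>}"
    then have "Rep_omega1 \<beta> \<in> elts (Rep_omega1 \<alpha>)" by (simp add: less_omega1_def)
    then show "\<beta> \<in> Abs_omega1 ` elts (Rep_omega1 \<alpha>)" by (metis Rep_omega1_inverse imageI)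
  qed
qed simp

lemma countable_omega1_bounded:
  assumes "countable (A :: omega1 set)"
  shows "\<exists>\<alpha>. \<forall>\<beta>\<in>A. \<beta> < \<alpha>"
proof -
  define B where "B = (\<Union>\<beta>\<in>A. insert \<beta> {\<gamma>. \<gamma> < \<beta>})"
  have cB: "countable B" unfolding B_def using assms countable_below_omega1 by auto
  have down: "x \<in> Rep_omega1 ` B" if "x \<in> elts (Rep_omega1 \<beta>)" "\<beta> \<in> B" for x \<beta>
  proof -
    have "is_ordinal x" using that is_ordinal_mem Rep_omega1 by blast
    then have x: "x = Rep_omega1 (Abs_omega1 x)" by (simp add: Abs_omega1_inverse)
    then have "Abs_omega1 x < \<beta>" using that by (simp add: less_omega1_def)
    then have "Abs_omega1 x \<in> B" using that(2) unfolding B_def by (auto intro: less_trans)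
    then show ?thesis using x by blast
  qed
  have el: "elts (hset (Rep_omega1 ` B)) = Rep_omega1 ` B" using cB by simp
  have o: "is_ordinal (hset (Rep_omega1 ` B))"
    unfolding is_ordinal_def el using down Rep_omega1 unfolding is_ordinal_def by blast
  have "\<forall>\<beta>\<in>A. \<beta> < Abs_omega1 (hset (Rep_omega1 ` B))"
    unfolding less_omega1_def using o el by (auto simp: Abs_omega1_inverse B_def)
  then show ?thesis by blast
qed

lemma uncountable_omega1: "\<not> countable (UNIV :: omega1 set)"
  using countable_omega1_bounded by blast

instantiation omega1 :: zero
begin
definition zero_omega1 :: omega1 where "0 = (LEAST \<alpha> :: omega1. True)"
instance ..
end

definition osuc :: "omega1 \<Rightarrow> omega1" where
  "osuc \<alpha> = (LEAST \<beta>. \<alpha> < \<beta>)"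

definition is_limit :: "omega1 \<Rightarrow> bool" where
  "is_limit \<alpha> \<longleftrightarrow> 0 < \<alpha> \<and> (\<forall>\<beta><\<alpha>. osuc \<beta> < \<alpha>)"

definition omega :: omega1 where
  "omega = (LEAST \<alpha>. is_limit \<alpha>)"

definition opred :: "omega1 \<Rightarrow> omega1" where
  "opred \<alpha> = (THE \<beta>. \<beta> < \<alpha> \<and> \<alpha> = osuc \<beta>)"

lemma zero_le_omega1: "(0 :: omega1) \<le> \<alpha>"
  unfolding zero_omega1_def by (simp add: Least_le)

lemma less_osuc: "\<alpha> < osuc \<alpha>"
  unfolding osuc_def using countable_omega1_bounded[of "{\<alpha>}"] by (auto intro: LeastI)

lemma osuc_le: "\<alpha> < \<beta> \<Longrightarrow> osuc \<alpha> \<le> \<beta>"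
  unfolding osuc_def by (rule Least_le)

lemma opred:
  assumes "\<alpha> \<noteq> 0" "\<not> is_limit \<alpha>"
  shows "opred \<alpha> < \<alpha>" "\<alpha> = osuc (opred \<alpha>)"
proof -
  from assms zero_le_omega1[of \<alpha>] obtain \<beta> where b: "\<beta> < \<alpha>" "\<not> osuc \<beta> < \<alpha>"
    unfolding is_limit_def by (auto simp: order.order_iff_strict)
  have eq: "\<alpha> = osuc \<beta>" using osuc_le[OF b(1)] b(2) by simp
  have "\<exists>!\<beta>. \<beta> < \<alpha> \<and> \<alpha> = osuc \<beta>"
  proof (rule ex1I[of _ \<beta>])
    fix \<gamma> assume g: "\<gamma> < \<alpha> \<and> \<alpha> = osuc \<gamma>"
    show "\<gamma> = \<beta>"
      using osuc_le[of \<gamma> \<beta>] osuc_le[of \<beta> \<gamma>] g b eq by (metis leD neqE)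
  qed (use b eq in blast)
  from theI'[OF this] show "opred \<alpha> < \<alpha>" "\<alpha> = osuc (opred \<alpha>)"
    unfolding opred_def by blast+
qed

text \<open>Transfinite recursion with separate zero, successor and limit clauses.\<close>

function otrec :: "'b \<Rightarrow> ('b \<Rightarrow> 'b) \<Rightarrow> ('b set \<Rightarrow> 'b) \<Rightarrow> omega1 \<Rightarrow> 'b" where
  "otrec z s l \<alpha> =
    (if \<alpha> = 0 then z
     else if is_limit \<alpha> then l ((\<lambda>\<beta>. otrec z s l \<beta>) ` {\<beta>. \<beta> < \<alpha>})
     else s (otrec z s l (opred \<alpha>)))"
  by auto
termination
  by (relation "{(x, y). snd (snd (snd x)) < snd (snd (snd y))}")
     (auto simp: opred(1) intro: wf_subset[OF wf_inv_image[OF wf, of "\<lambda>x. snd (snd (snd x))"]]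
       simp: inv_image_def)

declare otrec.simps [simp del]

definition club :: "omega1 set \<Rightarrow> bool" where
  "club C \<longleftrightarrow> (\<forall>\<alpha>. \<exists>\<beta>\<in>C. \<alpha> < \<beta>) \<and>
     (\<forall>\<alpha>. is_limit \<alpha> \<and> (\<forall>\<beta><\<alpha>. \<exists>\<gamma>\<in>C. \<beta> < \<gamma> \<and> \<gamma> < \<alpha>) \<longrightarrow> \<alpha> \<in> C)"

section \<open>Infinitary logic\<close>

text \<open>A countable vocabulary: relation and function symbols are natural numbers, with their
  arities; constants are function symbols of arity 0.\<close>

record vocabulary =
  rel_ar :: "nat \<rightharpoonup> nat"
  fun_ar :: "nat \<rightharpoonup> nat"

datatype tm = Var nat | Fn nat "tm list"

text \<open>De Bruijn indices: \<open>ExF\<close> binds variable 0. Negation, countable disjunction and existential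
  quantification are primitive, so that \<open>\<not>\<Or>\<not>\<close> and \<open>\<not>\<exists>\<not>\<close> give the dual operations.\<close>

datatype fm = Eq tm tm | Rel nat "tm list" | Neg fm | Disj "fm cset" | ExF fm

definition Conj :: "fm cset \<Rightarrow> fm" where
  "Conj \<Phi> = Neg (Disj (cimage Neg \<Phi>))"

definition AllF :: "fm \<Rightarrow> fm" where
  "AllF f = Neg (ExF (Neg f))"

definition AndF :: "fm \<Rightarrow> fm \<Rightarrow> fm" where
  "AndF f g = Conj (acset {f, g})"

primrec wf_tm :: "vocabulary \<Rightarrow> nat \<Rightarrow> tm \<Rightarrow> bool" where
  "wf_tm \<tau> n (Var i) \<longleftrightarrow> i < n"
| "wf_tm \<tau> n (Fn k ts) \<longleftrightarrow> fun_ar \<tau> k = Some (length ts) \<and> list_all (wf_tm \<tau> n) ts"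

text \<open>\<open>wf_fm \<tau> f n\<close>: \<open>f\<close> is a formula of the vocabulary with free variables among the first \<open>n\<close>.
  Formulas of \<open>L\<^bsub>\<omega>\<^sub>1\<omega>\<^esub>\<close> have finitely many free variables, so they are those with
  \<open>\<exists>n. wf_fm \<tau> f n\<close>.\<close>

primrec wf_fm :: "vocabulary \<Rightarrow> fm \<Rightarrow> nat \<Rightarrow> bool" where
  "wf_fm \<tau> (Eq s t) = (\<lambda>n. wf_tm \<tau> n s \<and> wf_tm \<tau> n t)"
| "wf_fm \<tau> (Rel k ts) = (\<lambda>n. rel_ar \<tau> k = Some (length ts) \<and> list_all (wf_tm \<tau> n) ts)"
| "wf_fm \<tau> (Neg f) = (\<lambda>n. wf_fm \<tau> f n)"
| "wf_fm \<tau> (Disj \<Phi>) = (\<lambda>n. \<forall>w \<in> rcset (cimage (wf_fm \<tau>) \<Phi>). w n)"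
| "wf_fm \<tau> (ExF f) = (\<lambda>n. wf_fm \<tau> f (Suc n))"

abbreviation sentence :: "vocabulary \<Rightarrow> fm \<Rightarrow> bool" where
  "sentence \<tau> f \<equiv> wf_fm \<tau> f 0"

primrec subst_tm :: "(nat \<Rightarrow> tm) \<Rightarrow> tm \<Rightarrow> tm" where
  "subst_tm \<sigma> (Var i) = \<sigma> i"
| "subst_tm \<sigma> (Fn k ts) = Fn k (map (subst_tm \<sigma>) ts)"

definition up :: "(nat \<Rightarrow> tm) \<Rightarrow> nat \<Rightarrow> tm" where
  "up \<sigma> = case_nat (Var 0) (\<lambda>i. subst_tm (Var \<circ> Suc) (\<sigma> i))"

primrec subst :: "fm \<Rightarrow> (nat \<Rightarrow> tm) \<Rightarrow> fm" where
  "subst (Eq s t) = (\<lambda>\<sigma>. Eq (subst_tm \<sigma> s) (subst_tm \<sigma> t))"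
| "subst (Rel k ts) = (\<lambda>\<sigma>. Rel k (map (subst_tm \<sigma>) ts))"
| "subst (Neg f) = (\<lambda>\<sigma>. Neg (subst f \<sigma>))"
| "subst (Disj \<Phi>) = (\<lambda>\<sigma>. Disj (cimage (\<lambda>f. subst f \<sigma>) \<Phi>))"
| "subst (ExF f) = (\<lambda>\<sigma>. ExF (subst f (up \<sigma>)))"

definition lift :: "fm \<Rightarrow> fm" where
  "lift f = subst f (Var \<circ> Suc)"

definition inst :: "fm \<Rightarrow> tm \<Rightarrow> fm" where
  "inst f t = subst f (case_nat t Var)"

subsection \<open>Structures\<close>

record 'a struct =
  carrier :: "'a set"
  relI :: "nat \<Rightarrow> 'a list \<Rightarrow> bool"
  funI :: "nat \<Rightarrow> 'a list \<Rightarrow> 'a"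

definition tuples :: "'a struct \<Rightarrow> nat \<Rightarrow> 'a list set" where
  "tuples M n = {xs. length xs = n \<and> set xs \<subseteq> carrier M}"

definition is_struct :: "vocabulary \<Rightarrow> 'a struct \<Rightarrow> bool" where
  "is_struct \<tau> M \<longleftrightarrow> carrier M \<noteq> {} \<and> countable (carrier M) \<and>
     (\<forall>k n. fun_ar \<tau> k = Some n \<longrightarrow> (\<forall>xs\<in>tuples M n. funI M k xs \<in> carrier M))"

primrec eval_tm :: "'a struct \<Rightarrow> (nat \<Rightarrow> 'a) \<Rightarrow> tm \<Rightarrow> 'a" where
  "eval_tm M e (Var i) = e i"
| "eval_tm M e (Fn k ts) = funI M k (map (eval_tm M e) ts)"

primrec sat :: "'a struct \<Rightarrow> fm \<Rightarrow> (nat \<Rightarrow> 'a) \<Rightarrow> bool" where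
  "sat M (Eq s t) = (\<lambda>e. eval_tm M e s = eval_tm M e t)"
| "sat M (Rel k ts) = (\<lambda>e. relI M k (map (eval_tm M e) ts))"
| "sat M (Neg f) = (\<lambda>e. \<not> sat M f e)"
| "sat M (Disj \<Phi>) = (\<lambda>e. \<exists>w \<in> rcset (cimage (sat M) \<Phi>). w e)"
| "sat M (ExF f) = (\<lambda>e. \<exists>a \<in> carrier M. sat M f (case_nat a e))"

lemma rcset_cimage [simp]: "rcset (cimage f A) = f ` rcset A"
  by (simp add: cimage.rep_eq)

text \<open>\<open>M \<Turnstile> f(xs)\<close>; variables beyond the length of \<open>xs\<close> do not occur in the formulas considered.\<close>

definition holds :: "'a struct \<Rightarrow> fm \<Rightarrow> 'a list \<Rightarrow> bool" where
  "holds M f xs \<longleftrightarrow> sat M f (\<lambda>i. xs ! i)"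

definition models :: "vocabulary \<Rightarrow> 'a struct \<Rightarrow> fm set \<Rightarrow> bool" where
  "models \<tau> M S \<longleftrightarrow> is_struct \<tau> M \<and> (\<forall>f\<in>S. holds M f [])"

definition iso_map :: "vocabulary \<Rightarrow> 'a struct \<Rightarrow> 'b struct \<Rightarrow> ('a \<Rightarrow> 'b) \<Rightarrow> bool" where
  "iso_map \<tau> M N h \<longleftrightarrow> bij_betw h (carrier M) (carrier N) \<and>
     (\<forall>k n. rel_ar \<tau> k = Some n \<longrightarrow> (\<forall>xs\<in>tuples M n. relI M k xs \<longleftrightarrow> relI N k (map h xs))) \<and>
     (\<forall>k n. fun_ar \<tau> k = Some n \<longrightarrow> (\<forall>xs\<in>tuples M n. h (funI M k xs) = funI N k (map h xs)))"

definition isomorphic :: "vocabulary \<Rightarrow> 'a struct \<Rightarrow> 'b struct \<Rightarrow> bool" where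
  "isomorphic \<tau> M N \<longleftrightarrow> (\<exists>h. iso_map \<tau> M N h)"

definition isomorphic_tuples ::
    "vocabulary \<Rightarrow> 'a struct \<Rightarrow> 'a list \<Rightarrow> 'b struct \<Rightarrow> 'b list \<Rightarrow> bool" where
  "isomorphic_tuples \<tau> M c N d \<longleftrightarrow> (\<exists>h. iso_map \<tau> M N h \<and> map h c = d)"

text \<open>Classes of countable models are represented by structures with universe a subset of
  \<open>\<nat>\<close>, and counted up to isomorphism.\<close>

definition Mod :: "vocabulary \<Rightarrow> fm \<Rightarrow> nat struct set" where
  "Mod \<tau> f = {M. models \<tau> M {f}}"

definition iso_classes :: "vocabulary \<Rightarrow> nat struct set \<Rightarrow> nat struct set set" where
  "iso_classes \<tau> K = (\<lambda>M. {N. is_struct \<tau> N \<and> isomorphic \<tau> M N}) ` K"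

subsection \<open>The hierarchy \<open>\<Sigma>\<^sup>i\<^sup>n\<^sub>\<alpha>\<close>, \<open>\<Pi>\<^sup>i\<^sup>n\<^sub>\<alpha>\<close>\<close>

inductive qf :: "fm \<Rightarrow> bool" where
  "qf (Eq s t)"
| "qf (Rel k ts)"
| "qf f \<Longrightarrow> qf (Neg f)"
| "finite (rcset \<Phi>) \<Longrightarrow> (\<And>f. f \<in> rcset \<Phi> \<Longrightarrow> qf f) \<Longrightarrow> qf (Disj \<Phi>)"

inductive Sigma_in :: "omega1 \<Rightarrow> fm \<Rightarrow> bool" and Pi_in :: "omega1 \<Rightarrow> fm \<Rightarrow> bool" where
  "qf f \<Longrightarrow> Sigma_in 0 f"
| "qf f \<Longrightarrow> Pi_in 0 f"
| "0 < \<alpha> \<Longrightarrow> (\<And>f. f \<in> rcset \<Phi> \<Longrightarrow> \<exists>k \<psi> \<beta>. f = (ExF ^^ k) \<psi> \<and> \<beta> < \<alpha> \<and> Pi_in \<beta> \<psi>)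
    \<Longrightarrow> Sigma_in \<alpha> (Disj \<Phi>)"
| "0 < \<alpha> \<Longrightarrow> (\<And>f. f \<in> rcset \<Phi> \<Longrightarrow> \<exists>k \<psi> \<beta>. f = (AllF ^^ k) \<psi> \<and> \<beta> < \<alpha> \<and> Sigma_in \<beta> \<psi>)
    \<Longrightarrow> Pi_in \<alpha> (Conj \<Phi>)"

definition equiv_in :: "vocabulary \<Rightarrow> omega1 \<Rightarrow> 'a struct \<Rightarrow> 'b struct \<Rightarrow> bool" where
  "equiv_in \<tau> \<alpha> M N \<longleftrightarrow> (\<forall>f. Pi_in \<alpha> f \<and> sentence \<tau> f \<longrightarrow> (holds M f [] \<longleftrightarrow> holds N f []))"

definition Sigma_type :: "vocabulary \<Rightarrow> omega1 \<Rightarrow> 'a struct \<Rightarrow> 'a list \<Rightarrow> fm set" where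
  "Sigma_type \<tau> \<alpha> M xs = {f. Sigma_in \<alpha> f \<and> wf_fm \<tau> f (length xs) \<and> holds M f xs}"

definition scott_sentence :: "vocabulary \<Rightarrow> 'a struct \<Rightarrow> fm \<Rightarrow> bool" where
  "scott_sentence \<tau> M f \<longleftrightarrow> sentence \<tau> f \<and>
     (\<forall>N :: nat struct. is_struct \<tau> N \<longrightarrow> (holds N f [] \<longleftrightarrow> isomorphic \<tau> M N))"

definition cSR :: "vocabulary \<Rightarrow> 'a struct \<Rightarrow> omega1" where
  "cSR \<tau> M = (LEAST \<alpha>. \<exists>f. Pi_in (osuc \<alpha>) f \<and> scott_sentence \<tau> M f)"

text \<open>Formulas are identified up to logical equivalence here: an arbitrary sentence need not
  literally have one of the normal forms \<open>\<Sigma>\<^sup>i\<^sup>n\<^sub>\<beta>\<close>, \<open>\<Pi>\<^sup>i\<^sup>n\<^sub>\<beta>\<close>.\<close>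

definition qr :: "vocabulary \<Rightarrow> fm \<Rightarrow> omega1" where
  "qr \<tau> S = (LEAST \<beta>. \<exists>f. (Pi_in \<beta> f \<or> Sigma_in \<beta> f) \<and> sentence \<tau> f \<and> Mod \<tau> f = Mod \<tau> S)"

subsection \<open>Minimal counterexamples\<close>

definition equiv_class :: "vocabulary \<Rightarrow> fm \<Rightarrow> omega1 \<Rightarrow> nat struct \<Rightarrow> nat struct set" where
  "equiv_class \<tau> \<phi> \<beta> M = {N \<in> Mod \<tau> \<phi>. equiv_in \<tau> \<beta> M N}"

definition scattered :: "vocabulary \<Rightarrow> fm \<Rightarrow> bool" where
  "scattered \<tau> \<phi> \<longleftrightarrow> (\<forall>\<alpha>. countable (equiv_class \<tau> \<phi> \<alpha> ` Mod \<tau> \<phi>))"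

definition big_class :: "vocabulary \<Rightarrow> fm \<Rightarrow> omega1 \<Rightarrow> nat struct set" where
  "big_class \<tau> \<phi> \<beta> =
     (THE K. K \<in> equiv_class \<tau> \<phi> \<beta> ` Mod \<tau> \<phi> \<and> \<not> countable (iso_classes \<tau> K))"

definition minimal_counterexample :: "vocabulary \<Rightarrow> fm \<Rightarrow> bool" where
  "minimal_counterexample \<tau> \<phi> \<longleftrightarrow>
     sentence \<tau> \<phi> \<and>
     (card_of (iso_classes \<tau> (Mod \<tau> \<phi>)), cardSuc natLeq) \<in> ordIso \<and>
     scattered \<tau> \<phi> \<and>
     (\<forall>\<psi>. sentence \<tau> \<psi> \<longrightarrow>
        countable (iso_classes \<tau> (Mod \<tau> (AndF \<phi> \<psi>))) \<or>
        countable (iso_classes \<tau> (Mod \<tau> (AndF \<phi> (Neg \<psi>))))) \<and>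
     (\<forall>\<alpha>. countable {Sigma_type \<tau> \<alpha> M xs | M xs. M \<in> Mod \<tau> \<phi> \<and> set xs \<subseteq> carrier M}) \<and>
     (\<forall>\<beta>. \<exists>!K. K \<in> equiv_class \<tau> \<phi> \<beta> ` Mod \<tau> \<phi> \<and> \<not> countable (iso_classes \<tau> K))"

definition f_rank :: "vocabulary \<Rightarrow> fm \<Rightarrow> omega1 \<Rightarrow> omega1" where
  "f_rank \<tau> \<phi> \<alpha> = (LEAST \<beta>. \<forall>M\<in>Mod \<tau> \<phi>. M \<notin> big_class \<tau> \<phi> \<alpha> \<longrightarrow> cSR \<tau> M < \<beta>)"

definition frakF :: "vocabulary \<Rightarrow> fm \<Rightarrow> omega1 set" where
  "frakF \<tau> \<phi> = {\<alpha>. f_rank \<tau> \<phi> \<alpha> \<le> \<alpha>}"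

section \<open>Relative computability and \<open>\<omega>\<^sub>1\<^sup>A\<close>\<close>

text \<open>Partial recursive functions with an oracle \<open>X \<subseteq> \<nat>\<close>. In \<open>PrimRec f g\<close> the recursion
  argument comes first, and \<open>g\<close> receives the recursion counter, the previous value and the
  parameters.\<close>

datatype precf = Zero | Succ | Proj nat | Oracle | Comp precf "precf list" | PrimRec precf precf
  | Mu precf

inductive peval :: "nat set \<Rightarrow> precf \<Rightarrow> nat list \<Rightarrow> nat \<Rightarrow> bool" for X where
  "peval X Zero xs 0"
| "peval X Succ (x # xs) (Suc x)"
| "i < length xs \<Longrightarrow> peval X (Proj i) xs (xs ! i)"
| "peval X Oracle (x # xs) (if x \<in> X then 1 else 0)"
| "length ys = length gs \<Longrightarrow> (\<And>i. i < length gs \<Longrightarrow> peval X (gs ! i) xs (ys ! i)) \<Longrightarrow>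
    peval X f ys v \<Longrightarrow> peval X (Comp f gs) xs v"
| "peval X f xs v \<Longrightarrow> peval X (PrimRec f g) (0 # xs) v"
| "peval X (PrimRec f g) (n # xs) u \<Longrightarrow> peval X g (n # u # xs) v \<Longrightarrow>
    peval X (PrimRec f g) (Suc n # xs) v"
| "peval X f (n # xs) 0 \<Longrightarrow> (\<And>m. m < n \<Longrightarrow> \<exists>v. peval X f (m # xs) (Suc v)) \<Longrightarrow>
    peval X (Mu f) xs n"

definition computable_in :: "nat set \<Rightarrow> nat set \<Rightarrow> bool" where
  "computable_in X A \<longleftrightarrow> (\<exists>f. \<forall>n. peval X f [n] (if n \<in> A then 1 else 0))"

definition ord_segment :: "omega1 \<Rightarrow> omega1 rel" where
  "ord_segment \<alpha> = {(\<beta>, \<gamma>). \<beta> \<le> \<gamma> \<and> \<gamma> < \<alpha>}"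

text \<open>The least ordinal that is not the order type of an \<open>X\<close>-computable well-ordering of a
  set of natural numbers.\<close>

definition omega1_CK :: "nat set \<Rightarrow> omega1" where
  "omega1_CK X = (LEAST \<alpha>. \<not> (\<exists>R :: nat rel. Well_order R \<and>
      computable_in X (prod_encode ` R) \<and> (R, ord_segment \<alpha>) \<in> ordIso))"

definition diagram :: "vocabulary \<Rightarrow> nat struct \<Rightarrow> nat set" where
  "diagram \<tau> B =
     {prod_encode (0, a) | a. a \<in> carrier B} \<union>
     {prod_encode (1, prod_encode (k, list_encode xs)) | k n xs.
        rel_ar \<tau> k = Some n \<and> xs \<in> tuples B n \<and> relI B k xs} \<union>
     {prod_encode (2, prod_encode (k, list_encode (funI B k xs # xs))) | k n xs.
        fun_ar \<tau> k = Some n \<and> xs \<in> tuples B n}"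

definition computes_copy :: "vocabulary \<Rightarrow> nat set \<Rightarrow> 'a struct \<Rightarrow> bool" where
  "computes_copy \<tau> X A \<longleftrightarrow>
     (\<exists>B. is_struct \<tau> B \<and> isomorphic \<tau> A B \<and> computable_in X (diagram \<tau> B))"

definition omega1_of :: "vocabulary \<Rightarrow> 'a struct \<Rightarrow> omega1" where
  "omega1_of \<tau> A = (LEAST \<alpha>. \<exists>X. computes_copy \<tau> X A \<and> \<alpha> = omega1_CK X)"

section \<open>Fragments, types and Sacks rank\<close>

text \<open>As usual, a fragment contains all atomic formulas of the vocabulary. Conjunctions and
  universal quantifiers are covered by \<open>Neg\<close>, \<open>Disj\<close>, \<open>ExF\<close>; quantifying another variable than
  the first is covered by substitution.\<close>

definition fragment :: "vocabulary \<Rightarrow> fm set \<Rightarrow> bool" where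
  "fragment \<tau> L \<longleftrightarrow> countable L \<and> (\<forall>f\<in>L. \<exists>n. wf_fm \<tau> f n) \<and>
     (\<forall>s t n. wf_fm \<tau> (Eq s t) n \<longrightarrow> Eq s t \<in> L) \<and>
     (\<forall>k ts n. wf_fm \<tau> (Rel k ts) n \<longrightarrow> Rel k ts \<in> L) \<and>
     (\<forall>f. Neg f \<in> L \<longrightarrow> f \<in> L) \<and>
     (\<forall>\<Phi>. Disj \<Phi> \<in> L \<longrightarrow> rcset \<Phi> \<subseteq> L) \<and>
     (\<forall>f. ExF f \<in> L \<longrightarrow> f \<in> L) \<and>
     (\<forall>f\<in>L. \<forall>\<sigma>. (\<forall>i. \<exists>n. wf_tm \<tau> n (\<sigma> i)) \<longrightarrow> subst f \<sigma> \<in> L) \<and>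
     (\<forall>f\<in>L. Neg f \<in> L) \<and>
     (\<forall>\<Phi>. finite (rcset \<Phi>) \<and> rcset \<Phi> \<subseteq> L \<longrightarrow> Disj \<Phi> \<in> L) \<and>
     (\<forall>f\<in>L. ExF f \<in> L)"

definition least_fragment :: "vocabulary \<Rightarrow> fm set \<Rightarrow> fm set" where
  "least_fragment \<tau> F = \<Inter>{L. fragment \<tau> L \<and> F \<subseteq> L}"

text \<open>Deductions of finite length: natural deduction in which every rule has finitely many
  premises. Elimination of a disjunction is available only for finite disjunctions. Free
  variables of the hypotheses act as parameters.\<close>

inductive derives :: "fm set \<Rightarrow> fm \<Rightarrow> bool" where
  Hyp: "f \<in> \<Gamma> \<Longrightarrow> derives \<Gamma> f"
| NegI: "derives (insert f \<Gamma>) g \<Longrightarrow> derives (insert f \<Gamma>) (Neg g) \<Longrightarrow> derives \<Gamma> (Neg f)"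
| NegE: "derives (insert (Neg f) \<Gamma>) g \<Longrightarrow> derives (insert (Neg f) \<Gamma>) (Neg g) \<Longrightarrow> derives \<Gamma> f"
| DisjI: "f \<in> rcset \<Phi> \<Longrightarrow> derives \<Gamma> f \<Longrightarrow> derives \<Gamma> (Disj \<Phi>)"
| DisjE: "finite (rcset \<Phi>) \<Longrightarrow> derives \<Gamma> (Disj \<Phi>) \<Longrightarrow>
    (\<And>f. f \<in> rcset \<Phi> \<Longrightarrow> derives (insert f \<Gamma>) g) \<Longrightarrow> derives \<Gamma> g"
| ExI: "derives \<Gamma> (inst f t) \<Longrightarrow> derives \<Gamma> (ExF f)"
| ExE: "derives \<Gamma> (ExF f) \<Longrightarrow> derives (insert f (lift ` \<Gamma>)) (lift g) \<Longrightarrow> derives \<Gamma> g"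
| EqI: "derives \<Gamma> (Eq t t)"
| EqE: "derives \<Gamma> (Eq s t) \<Longrightarrow> derives \<Gamma> (inst f s) \<Longrightarrow> derives \<Gamma> (inst f t)"

definition fin_consistent :: "fm set \<Rightarrow> bool" where
  "fin_consistent S \<longleftrightarrow> \<not> (\<exists>f. derives S f \<and> derives S (Neg f))"

definition omega_complete :: "vocabulary \<Rightarrow> fm set \<Rightarrow> fm set \<Rightarrow> bool" where
  "omega_complete \<tau> L S \<longleftrightarrow> S \<subseteq> {f \<in> L. sentence \<tau> f} \<and>
     (\<forall>f\<in>L. sentence \<tau> f \<longrightarrow> f \<in> S \<or> Neg f \<in> S) \<and>
     (\<forall>\<Phi>. Disj \<Phi> \<in> S \<longrightarrow> (\<exists>f\<in>rcset \<Phi>. f \<in> S))"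

definition is_type :: "vocabulary \<Rightarrow> fm set \<Rightarrow> fm set \<Rightarrow> nat \<Rightarrow> fm set \<Rightarrow> bool" where
  "is_type \<tau> L S n p \<longleftrightarrow> p \<subseteq> {f \<in> L. wf_fm \<tau> f n} \<and> fin_consistent (S \<union> p) \<and>
     (\<forall>q. p \<subseteq> q \<and> q \<subseteq> {f \<in> L. wf_fm \<tau> f n} \<and> fin_consistent (S \<union> q) \<longrightarrow> q = p)"

definition principal :: "fm set \<Rightarrow> fm set \<Rightarrow> bool" where
  "principal S p \<longleftrightarrow> (\<exists>g\<in>p. \<forall>f\<in>p. derives (insert g S) f)"

text \<open>The complete \<open>L\<close>-type of a tuple in \<open>A\<close>; for the empty tuple this is \<open>Th\<^sub>L(A)\<close>.\<close>

definition tp :: "vocabulary \<Rightarrow> fm set \<Rightarrow> 'a struct \<Rightarrow> 'a list \<Rightarrow> fm set" where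
  "tp \<tau> L A xs = {f \<in> L. wf_fm \<tau> f (length xs) \<and> holds A f xs}"

definition sacks_language :: "vocabulary \<Rightarrow> 'a struct \<Rightarrow> omega1 \<Rightarrow> fm set" where
  "sacks_language \<tau> A = otrec (least_fragment \<tau> {})
     (\<lambda>L. least_fragment \<tau> (L \<union> {Conj (acset (tp \<tau> L A xs)) | xs.
            set xs \<subseteq> carrier A \<and> \<not> principal (tp \<tau> L A []) (tp \<tau> L A xs)}))
     Union"

definition atomic_model :: "vocabulary \<Rightarrow> fm set \<Rightarrow> fm set \<Rightarrow> 'a struct \<Rightarrow> bool" where
  "atomic_model \<tau> L S A \<longleftrightarrow> models \<tau> A S \<and> (\<forall>xs. set xs \<subseteq> carrier A \<longrightarrow> principal S (tp \<tau> L A xs))"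

definition sr_Sacks :: "vocabulary \<Rightarrow> 'a struct \<Rightarrow> omega1" where
  "sr_Sacks \<tau> A = (LEAST \<delta>. atomic_model \<tau> (sacks_language \<tau> A \<delta>)
                               (tp \<tau> (sacks_language \<tau> A \<delta>) A []) A)"

section \<open>The tree of nodes\<close>

text \<open>A node is a pair of a fragment and a theory in it.\<close>

type_synonym node = "fm set \<times> fm set"

text \<open>Validity in countable structures is validity, by the downward Loewenheim-Skolem theorem.\<close>

definition base_theory :: "vocabulary \<Rightarrow> fm \<Rightarrow> fm set" where
  "base_theory \<tau> \<phi> = insert \<phi> {f \<in> least_fragment \<tau> {\<phi>}. sentence \<tau> f \<and>
     (\<forall>M :: nat struct. is_struct \<tau> M \<longrightarrow> holds M f [])}"

definition completion :: "vocabulary \<Rightarrow> fm set \<Rightarrow> node \<Rightarrow> bool" where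
  "completion \<tau> S P \<longleftrightarrow> fragment \<tau> (fst P) \<and> S \<subseteq> snd P \<and>
     omega_complete \<tau> (fst P) (snd P) \<and> fin_consistent (snd P)"

definition next_language :: "vocabulary \<Rightarrow> node \<Rightarrow> fm set" where
  "next_language \<tau> P = least_fragment \<tau> (fst P \<union>
     {Conj (acset p) | n p. is_type \<tau> (fst P) (snd P) n p \<and> \<not> principal (snd P) p})"

definition child :: "vocabulary \<Rightarrow> node \<Rightarrow> node \<Rightarrow> bool" where
  "child \<tau> P Q \<longleftrightarrow> fst Q = next_language \<tau> P \<and> completion \<tau> (snd P) Q"

inductive node_on_level :: "vocabulary \<Rightarrow> fm \<Rightarrow> omega1 \<Rightarrow> node \<Rightarrow> bool" for \<tau> \<phi> where
  level_zero: "fst P = least_fragment \<tau> {\<phi>} \<Longrightarrow> completion \<tau> (base_theory \<tau> \<phi>) P \<Longrightarrow>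
    node_on_level \<tau> \<phi> 0 P"
| level_suc: "node_on_level \<tau> \<phi> \<delta> P \<Longrightarrow> child \<tau> P Q \<Longrightarrow> node_on_level \<tau> \<phi> (osuc \<delta>) Q"
| level_limit: "is_limit \<delta> \<Longrightarrow> (\<And>\<gamma>. \<gamma> < \<delta> \<Longrightarrow> node_on_level \<tau> \<phi> \<gamma> (P \<gamma>)) \<Longrightarrow>
    (\<And>\<beta> \<gamma>. \<beta> < \<gamma> \<Longrightarrow> \<gamma> < \<delta> \<Longrightarrow> fst (P \<beta>) \<subseteq> fst (P \<gamma>) \<and> snd (P \<beta>) \<subseteq> snd (P \<gamma>)) \<Longrightarrow>
    node_on_level \<tau> \<phi> \<delta> (\<Union>\<gamma>\<in>{\<gamma>. \<gamma> < \<delta>}. fst (P \<gamma>), \<Union>\<gamma>\<in>{\<gamma>. \<gamma> < \<delta>}. snd (P \<gamma>))"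

definition nonprincipal_types :: "vocabulary \<Rightarrow> node \<Rightarrow> (nat \<times> fm set) set" where
  "nonprincipal_types \<tau> P =
     {(n, p). n \<ge> 1 \<and> is_type \<tau> (fst P) (snd P) n p \<and> \<not> principal (snd P) p}"

section \<open>The constructible hierarchy over a theory\<close>

definition hpair :: "hc \<Rightarrow> hc \<Rightarrow> hc" where
  "hpair x y = hset {hset {x}, hset {x, y}}"

primrec hnat :: "nat \<Rightarrow> hc" where
  "hnat 0 = hset {}"
| "hnat (Suc n) = hset (insert (hnat n) (elts (hnat n)))"

primrec hlist :: "hc list \<Rightarrow> hc" where
  "hlist [] = hset {}"
| "hlist (x # xs) = hpair x (hlist xs)"

primrec enc_tm :: "tm \<Rightarrow> hc" where
  "enc_tm (Var i) = hpair (hnat 0) (hnat i)"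
| "enc_tm (Fn k ts) = hpair (hnat 1) (hpair (hnat k) (hlist (map enc_tm ts)))"

primrec enc_fm :: "fm \<Rightarrow> hc" where
  "enc_fm (Eq s t) = hpair (hnat 0) (hpair (enc_tm s) (enc_tm t))"
| "enc_fm (Rel k ts) = hpair (hnat 1) (hpair (hnat k) (hlist (map enc_tm ts)))"
| "enc_fm (Neg f) = hpair (hnat 2) (enc_fm f)"
| "enc_fm (Disj \<Phi>) = hpair (hnat 3) (HSet (cimage enc_fm \<Phi>))"
| "enc_fm (ExF f) = hpair (hnat 4) (enc_fm f)"

definition enc_theory :: "fm set \<Rightarrow> hc" where
  "enc_theory S = hset (enc_fm ` S)"

text \<open>Formulas of set theory, with named variables; \<open>SBEx x y f\<close> is the bounded quantification
  \<open>\<exists>x\<in>y. f\<close>.\<close>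

datatype sfm = SMem nat nat | SEq nat nat | SNeg sfm | SAnd sfm sfm | SBEx nat nat sfm | SEx nat sfm

primrec ssat :: "hc set \<Rightarrow> sfm \<Rightarrow> (nat \<Rightarrow> hc) \<Rightarrow> bool" where
  "ssat A (SMem x y) e \<longleftrightarrow> e x \<in> elts (e y)"
| "ssat A (SEq x y) e \<longleftrightarrow> e x = e y"
| "ssat A (SNeg f) e \<longleftrightarrow> \<not> ssat A f e"
| "ssat A (SAnd f g) e \<longleftrightarrow> ssat A f e \<and> ssat A g e"
| "ssat A (SBEx x y f) e \<longleftrightarrow> (\<exists>a\<in>A. a \<in> elts (e y) \<and> ssat A f (e(x := a)))"
| "ssat A (SEx x f) e \<longleftrightarrow> (\<exists>a\<in>A. ssat A f (e(x := a)))"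

primrec Delta0 :: "sfm \<Rightarrow> bool" where
  "Delta0 (SMem x y) \<longleftrightarrow> True"
| "Delta0 (SEq x y) \<longleftrightarrow> True"
| "Delta0 (SNeg f) \<longleftrightarrow> Delta0 f"
| "Delta0 (SAnd f g) \<longleftrightarrow> Delta0 f \<and> Delta0 g"
| "Delta0 (SBEx x y f) \<longleftrightarrow> Delta0 f"
| "Delta0 (SEx x f) \<longleftrightarrow> False"

inductive_set trans_closure :: "hc \<Rightarrow> hc set" for t where
  "t \<in> trans_closure t"
| "x \<in> trans_closure t \<Longrightarrow> y \<in> elts x \<Longrightarrow> y \<in> trans_closure t"

definition definable_subsets :: "hc set \<Rightarrow> hc set" where
  "definable_subsets A =
     {x. \<exists>f e. (\<forall>i. e i \<in> A) \<and> elts x = {a \<in> A. ssat A f (e(0 := a))}}"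

definition Lhier :: "hc \<Rightarrow> omega1 \<Rightarrow> hc set" where
  "Lhier t = otrec (trans_closure t) definable_subsets Union"

definition Lomega1 :: "hc \<Rightarrow> hc set" where
  "Lomega1 t = (\<Union>\<alpha>. Lhier t \<alpha>)"

text \<open>\<open>\<Sigma>\<^sub>1\<close>-admissibility of a transitive set: Kripke-Platek set theory.\<close>

definition admissible :: "hc set \<Rightarrow> bool" where
  "admissible A \<longleftrightarrow> A \<noteq> {} \<and> (\<forall>x\<in>A. elts x \<subseteq> A) \<and>
     (\<forall>x\<in>A. \<forall>y\<in>A. \<exists>z\<in>A. x \<in> elts z \<and> y \<in> elts z) \<and>
     (\<forall>x\<in>A. \<exists>z\<in>A. \<forall>y\<in>elts x. elts y \<subseteq> elts z) \<and>
     (\<forall>f e x. Delta0 f \<and> (\<forall>i. e i \<in> A) \<and> x \<in> A \<longrightarrow>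
        hset {a \<in> elts x. ssat A f (e(0 := a))} \<in> A) \<and>
     (\<forall>f e x. Delta0 f \<and> (\<forall>i. e i \<in> A) \<and> x \<in> A \<and>
        (\<forall>a\<in>elts x. \<exists>b\<in>A. ssat A f (e(0 := a, 1 := b))) \<longrightarrow>
        (\<exists>w\<in>A. \<forall>a\<in>elts x. \<exists>b\<in>elts w. ssat A f (e(0 := a, 1 := b))))"

definition Sigma1_over :: "hc set \<Rightarrow> (hc \<Rightarrow> hc \<Rightarrow> bool) \<Rightarrow> bool" where
  "Sigma1_over A R \<longleftrightarrow> (\<exists>f e. Delta0 f \<and> (\<forall>i. e i \<in> A) \<and>
     (\<forall>x\<in>A. \<forall>y\<in>A. R x y \<longleftrightarrow> (\<exists>z\<in>A. ssat A f (e(0 := x, 1 := y, 2 := z)))))"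

definition Delta1_over :: "hc set \<Rightarrow> (hc \<Rightarrow> hc \<Rightarrow> bool) \<Rightarrow> bool" where
  "Delta1_over A R \<longleftrightarrow> Sigma1_over A R \<and> Sigma1_over A (\<lambda>x y. \<not> R x y)"

section \<open>The data supplied by Sacks' theorem\<close>

text \<open>The branch and the club enter only through the properties below. In \<open>Delta1_over\<close>
  parameters are allowed, and a theory is represented by the set of codes of its sentences.\<close>

definition sacks_branch :: "vocabulary \<Rightarrow> fm \<Rightarrow> (omega1 \<Rightarrow> node) \<Rightarrow> bool" where
  "sacks_branch \<tau> \<phi> T \<longleftrightarrow>
     (\<forall>\<delta>. node_on_level \<tau> \<phi> \<delta> (T \<delta>)) \<and>
     (\<forall>\<gamma> \<delta>. \<gamma> < \<delta> \<longrightarrow> fst (T \<gamma>) \<subseteq> fst (T \<delta>) \<and> snd (T \<gamma>) \<subseteq> snd (T \<delta>)) \<and>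
     (\<forall>\<delta>. child \<tau> (T \<delta>) (T (osuc \<delta>))) \<and>
     (\<forall>\<delta>. is_limit \<delta> \<longrightarrow>
        T \<delta> = (\<Union>\<gamma>\<in>{\<gamma>. \<gamma> < \<delta>}. fst (T \<gamma>), \<Union>\<gamma>\<in>{\<gamma>. \<gamma> < \<delta>}. snd (T \<gamma>))) \<and>
     (\<forall>\<delta>. enc_theory (snd (T \<delta>)) \<in> Lomega1 (enc_theory (base_theory \<tau> \<phi>))) \<and>
     Delta1_over (Lomega1 (enc_theory (base_theory \<tau> \<phi>)))
       (\<lambda>x y. \<exists>\<delta>. x = Rep_omega1 \<delta> \<and> y = enc_theory (snd (T \<delta>))) \<and>
     (\<forall>\<delta>. \<exists>A :: nat struct. atomic_model \<tau> (fst (T \<delta>)) (snd (T \<delta>)) A \<and> sr_Sacks \<tau> A = \<delta>)"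

definition sacks_club :: "vocabulary \<Rightarrow> fm \<Rightarrow> (omega1 \<Rightarrow> node) \<Rightarrow> omega1 set \<Rightarrow> bool" where
  "sacks_club \<tau> \<phi> T C \<longleftrightarrow> club C \<and>
     (\<forall>\<mu>\<in>C. omega < \<mu> \<and> admissible (Lhier (enc_theory (base_theory \<tau> \<phi>)) \<mu>) \<and>
        nonprincipal_types \<tau> (T \<mu>) \<noteq> {} \<and> countable (nonprincipal_types \<tau> (T \<mu>)))"

definition S_circ :: "vocabulary \<Rightarrow> fm \<Rightarrow> omega1 set \<Rightarrow> omega1 set" where
  "S_circ \<tau> \<phi> C = frakF \<tau> \<phi> \<inter> C \<inter> {\<alpha>. qr \<tau> \<phi> < \<alpha>}"

definition fiber_model :: "vocabulary \<Rightarrow> (omega1 \<Rightarrow> node) \<Rightarrow> omega1 \<Rightarrow> 'a struct \<Rightarrow> bool" where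
  "fiber_model \<tau> T \<delta> M \<longleftrightarrow> models \<tau> M (snd (T \<delta>)) \<and> omega1_of \<tau> M = \<delta>"

definition trace :: "vocabulary \<Rightarrow> node \<Rightarrow> 'a struct \<Rightarrow> (nat \<times> fm set) set" where
  "trace \<tau> P M = {(n, p) \<in> nonprincipal_types \<tau> P. \<exists>xs\<in>tuples M n. \<forall>f\<in>p. holds M f xs}"

end

(* Equality of the types of two tuples of a model N in the fragment of T_(beta+1) lets one answer any
   extension of one tuple by an extension of the other with equal types in the fragment of T_beta.
   Hence tuples with equal types in the fragment of T_delta are equivalent in the back-and-forth game
   of every length below delta, where delta = omega_1^X for some X computing a copy of N.

   Such tuples are automorphic, by Sigma^1_1-bounding in the following self-referential form. Consider
   the tree S of attempts at a winning strategy for the duplicator in the infinite game, against a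
   spoiler who along with each move descends in the Kleene-Brouwer order of S itself. S is computable
   in X. If S had no infinite path, its Kleene-Brouwer order would be an X-computable well-order, so
   of type below delta, and equivalence at that length would give a strategy, that is, a path. So S
   has a path; its initial segments descend forever in the Kleene-Brouwer order, and replying along
   the path keeps the duplicator alive for any number of rounds.

   Thus fiber models are homogeneous for their types over T_delta. Principal types are realized in
   both models and non-principal ones in the same cases, so back-and-forth gives the isomorphism. *)

theory Submission
  imports Defs "HOL-Library.Extended_Nat"
begin

section \<open>Oracle computable functions\<close>

text \<open>Equality of types over \<open>T \<delta>\<close> does not pass to longer tuples by the
  fragments alone. Given a move, every \<beta> < \<delta> has a reply that keeps the types over
  \<open>T \<beta>\<close> equal, but the reply may change with \<beta>, and with infinitely many
  candidates no counting singles one out. What must be found is a single reply that serves all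
  lengths at once. This exchange of quantifiers is possible because the game is played on a copy
  computable in X, and the lengths at hand include the types of all X-computable well-orderings. A
  customary argument overspills to an ill-founded X-computable linear order and takes that order
  from the completeness of the set of indices of well-orderings. Here the order is supplied by the
  tree of strategies itself: either it is well-founded and short enough to be used as a clock, or
  its infinite path is the wanted strategy. To make such a tree computable, replies are indexed by
  codes of histories, and a node of length n is asked only about histories with codes below
  n.\<close>

definition cfn :: "nat set \<Rightarrow> nat \<Rightarrow> (nat list \<Rightarrow> nat) \<Rightarrow> bool" where
  "cfn X k F \<longleftrightarrow> (\<exists>f. \<forall>xs. length xs = k \<longrightarrow> peval X f xs (F xs))"

lemma cfn_nth: "i < k \<Longrightarrow> cfn X k (\<lambda>xs. xs ! i)"
  unfolding cfn_def by (metis peval.intros(3))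

lemma cfn_comp1:
  assumes "cfn X 1 (\<lambda>xs. f (xs ! 0))" "cfn X k g"
  shows "cfn X k (\<lambda>xs. f (g xs))"
proof -
  obtain F G where F: "\<And>xs. length xs = 1 \<Longrightarrow> peval X F xs (f (xs ! 0))"
    and G: "\<And>xs. length xs = k \<Longrightarrow> peval X G xs (g xs)"
    using assms unfolding cfn_def by blast
  have "peval X (Comp F [G]) xs (f (g xs))" if "length xs = k" for xs
    by (rule peval.intros(5)[where ys = "[g xs]"]) (use G[OF that] F[of "[g xs]"] in auto)
  then show ?thesis unfolding cfn_def by blast
qed

lemma cfn_comp2:
  assumes "cfn X 2 (\<lambda>xs. f (xs ! 0) (xs ! 1))" "cfn X k g" "cfn X k h"
  shows "cfn X k (\<lambda>xs. f (g xs) (h xs))"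
proof -
  obtain F G H where F: "\<And>xs. length xs = 2 \<Longrightarrow> peval X F xs (f (xs ! 0) (xs ! 1))"
    and G: "\<And>xs. length xs = k \<Longrightarrow> peval X G xs (g xs)"
    and H: "\<And>xs. length xs = k \<Longrightarrow> peval X H xs (h xs)"
    using assms unfolding cfn_def by blast
  have "peval X (Comp F [G, H]) xs (f (g xs) (h xs))" if "length xs = k" for xs
    by (rule peval.intros(5)[where ys = "[g xs, h xs]"])
      (use G[OF that] H[OF that] F[of "[g xs, h xs]"] in \<open>auto simp: less_Suc_eq\<close>)
  then show ?thesis unfolding cfn_def by blast
qed

lemma cfn_Suc: "cfn X k g \<Longrightarrow> cfn X k (\<lambda>xs. Suc (g xs))"
proof (rule cfn_comp1[of X Suc])
  have "peval X Succ xs (Suc (xs ! 0))" if "length xs = 1" for xs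
    using that by (cases xs) (auto intro: peval.intros)
  then show "cfn X 1 (\<lambda>xs. Suc (xs ! 0))" unfolding cfn_def by blast
qed

lemma cfn_const: "cfn X k (\<lambda>xs. c)"
proof (induction c)
  case 0
  show ?case unfolding cfn_def by (metis peval.intros(1))
qed (rule cfn_Suc)

lemma peval_PrimRec:
  assumes "peval X F xs z" "\<And>i r. peval X G (i # r # xs) (s i r)"
  shows "peval X (PrimRec F G) (n # xs) (rec_nat z s n)"
  by (induction n) (auto intro: peval.intros assms)

lemma cfn_rec1:
  assumes "cfn X 2 (\<lambda>xs. s (xs ! 0) (xs ! 1))"
  shows "cfn X 1 (\<lambda>xs. rec_nat c s (xs ! 0))"
proof -
  obtain Z G where "\<And>xs. length xs = 0 \<Longrightarrow> peval X Z xs c"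
    and G: "\<And>xs. length xs = 2 \<Longrightarrow> peval X G xs (s (xs ! 0) (xs ! 1))"
    using assms cfn_const[of X 0 c] unfolding cfn_def by blast
  then have "peval X (PrimRec Z G) xs (rec_nat c s (xs ! 0))" if "length xs = 1" for xs
    using that peval_PrimRec[of X Z "[]" c G s] G[of "[_, _]"] by (cases xs) auto
  then show ?thesis unfolding cfn_def by blast
qed

text \<open>A single parameter is enough, since \<open>comp_rec\<close> passes several of them
  packed into one number.\<close>

lemma cfn_rec2:
  assumes "cfn X 1 (\<lambda>xs. z (xs ! 0))" "cfn X 3 (\<lambda>xs. s (xs ! 0) (xs ! 1) (xs ! 2))"
  shows "cfn X 2 (\<lambda>xs. rec_nat (z (xs ! 1)) (\<lambda>i r. s i r (xs ! 1)) (xs ! 0))"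
proof -
  obtain Z G where Z: "\<And>xs. length xs = 1 \<Longrightarrow> peval X Z xs (z (xs ! 0))"
    and G: "\<And>xs. length xs = 3 \<Longrightarrow> peval X G xs (s (xs ! 0) (xs ! 1) (xs ! 2))"
    using assms unfolding cfn_def by blast
  have "peval X (PrimRec Z G) xs (rec_nat (z (xs ! 1)) (\<lambda>i r. s i r (xs ! 1)) (xs ! 0))"
    if "length xs = 2" for xs
  proof -
    from that obtain a b where xs: "xs = [a, b]"
      by (metis One_nat_def Suc_1 length_0_conv length_Suc_conv)
    show ?thesis
      using peval_PrimRec[of X Z "[b]" "z b" G "\<lambda>i r. s i r b" a] Z[of "[b]"] G[of "[_, _, b]"]
      by (simp add: xs)
  qed
  then show ?thesis unfolding cfn_def by blast
qed

lemma cfn_pred: "cfn X k g \<Longrightarrow> cfn X k (\<lambda>xs. g xs - 1)"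
proof (rule cfn_comp1[of X "\<lambda>n. n - 1"])
  have "cfn X 1 (\<lambda>xs. rec_nat 0 (\<lambda>i r. i) (xs ! 0))"
    by (rule cfn_rec1) (simp add: cfn_nth)
  moreover have "rec_nat 0 (\<lambda>i r. i) n = n - 1" for n by (cases n) auto
  ultimately show "cfn X 1 (\<lambda>xs. xs ! 0 - 1)" by simp
qed

lemma cfn_add: "cfn X k g \<Longrightarrow> cfn X k h \<Longrightarrow> cfn X k (\<lambda>xs. g xs + h xs)"
proof (rule cfn_comp2[of X "(+)"])
  have "cfn X 2 (\<lambda>xs. rec_nat (xs ! 1) (\<lambda>i r. Suc r) (xs ! 0))"
    by (rule cfn_rec2) (simp_all add: cfn_nth cfn_Suc)
  moreover have "rec_nat b (\<lambda>i r. Suc r) a = a + b" for a b :: nat by (induction a) auto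
  ultimately show "cfn X 2 (\<lambda>xs. xs ! 0 + xs ! 1)" by simp
qed

lemma cfn_diff: "cfn X k g \<Longrightarrow> cfn X k h \<Longrightarrow> cfn X k (\<lambda>xs. g xs - h xs)"
\<comment> \<open>The recursion argument comes first and counts how often 1 is subtracted, hence the
  exchanged arguments.\<close>
proof (rule cfn_comp2[where f = "\<lambda>a b. b - a"])
  have "cfn X 2 (\<lambda>xs. rec_nat (xs ! 1) (\<lambda>i r. r - 1) (xs ! 0))"
    by (rule cfn_rec2[of X "\<lambda>b. b" "\<lambda>i r b. r - 1"]; intro cfn_pred cfn_nth; simp)
  moreover have "rec_nat b (\<lambda>i r. r - 1) a = b - a" for a b :: nat by (induction a) auto
  ultimately show "cfn X 2 (\<lambda>xs. xs ! 1 - xs ! 0)" by simp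
qed

lemma cfn_triangle: "cfn X k g \<Longrightarrow> cfn X k (\<lambda>xs. triangle (g xs))"
proof (rule cfn_comp1[of X triangle])
  have "cfn X 1 (\<lambda>xs. rec_nat 0 (\<lambda>i r. r + Suc i) (xs ! 0))"
    by (intro cfn_rec1 cfn_add cfn_Suc cfn_nth) auto
  moreover have "rec_nat 0 (\<lambda>i r. r + Suc i) n = triangle n" for n by (induction n) auto
  ultimately show "cfn X 1 (\<lambda>xs. triangle (xs ! 0))" by simp
qed

lemma cfn_prod_encode: "cfn X k g \<Longrightarrow> cfn X k h \<Longrightarrow> cfn X k (\<lambda>xs. prod_encode (g xs, h xs))"
  by (simp add: prod_encode_def cfn_add cfn_triangle)

text \<open>The number of the antidiagonal through the \<open>n\<close>-th pair.\<close>

definition diagonal :: "nat \<Rightarrow> nat" where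
  "diagonal n = fst (prod_decode n) + snd (prod_decode n)"

lemma triangle_mono: "i \<le> j \<Longrightarrow> triangle i \<le> triangle j"
  by (induction j) (auto simp: le_Suc_eq)

text \<open>A pair with sum s is coded by \<open>triangle s + a\<close> with a at most s, hence
  below \<open>triangle (Suc s)\<close>. So \<open>diagonal n\<close> is the greatest j with
  \<open>triangle j\<close> at most n.\<close>

lemma diagonal_less: "triangle j \<le> n \<longleftrightarrow> j \<le> diagonal n"
proof -
  obtain a b where n: "n = prod_encode (a, b)" by (metis surj_pair prod_decode_inverse)
  have "triangle j \<le> triangle (a + b) + a \<longleftrightarrow> j \<le> a + b"
    using triangle_mono[of j "a + b"] triangle_mono[of "Suc (a + b)" j] by fastforce
  then show ?thesis by (simp add: n diagonal_def) (simp add: prod_encode_def)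
qed

lemma cfn_diagonal: "cfn X k g \<Longrightarrow> cfn X k (\<lambda>xs. diagonal (g xs))"
proof (rule cfn_comp1[of X diagonal])
  \<comment> \<open>The inverse of \<open>triangle\<close> is found by counting: of the tests
    \<open>triangle (Suc i) \<le> n\<close> with i < m, exactly \<open>min m (diagonal n)\<close>
    succeed, and m = n is a sufficient range.\<close>
  have "cfn X 2 (\<lambda>xs. rec_nat 0 (\<lambda>i r. r + (1 - (triangle (Suc i) - xs ! 1))) (xs ! 0))"
    by (rule cfn_rec2[of X "\<lambda>_. 0" "\<lambda>i r n. r + (1 - (triangle (Suc i) - n))"];
      intro cfn_add cfn_diff cfn_triangle cfn_Suc cfn_nth cfn_const; simp)
  then have "cfn X 1 (\<lambda>xs. rec_nat 0 (\<lambda>i r. r + (1 - (triangle (Suc i) - xs ! 0))) (xs ! 0))"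
    by (rule cfn_comp2[of X "\<lambda>m n. rec_nat 0 (\<lambda>i r. r + (1 - (triangle (Suc i) - n))) m",
          OF _ cfn_nth cfn_nth]) simp_all
  moreover have "rec_nat 0 (\<lambda>i r. r + (1 - (triangle (Suc i) - n))) m = min m (diagonal n)" for m n
  proof (induction m)
    case (Suc m)
    then show ?case using diagonal_less[of "Suc m" n]
      by (cases "Suc m \<le> diagonal n") (simp_all add: not_le del: triangle_Suc)
  qed simp
  moreover have "diagonal n \<le> n" for n
  proof -
    have "j \<le> triangle j" for j by (induction j) auto
    then show ?thesis using diagonal_less[of "diagonal n" n] by (meson order.refl order.trans)
  qed
  ultimately show "cfn X 1 (\<lambda>xs. diagonal (xs ! 0))" by (simp add: min_absorb2)
qed


section \<open>Computable functions and decidable predicates of one coded argument\<close>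

definition pfst :: "nat \<Rightarrow> nat" where "pfst n = fst (prod_decode n)"
definition psnd :: "nat \<Rightarrow> nat" where "psnd n = snd (prod_decode n)"

lemma pfst_encode [simp]: "pfst (prod_encode (a, b)) = a"
  and psnd_encode [simp]: "psnd (prod_encode (a, b)) = b"
  by (simp_all add: pfst_def psnd_def)

lemma encode_pfst_psnd [simp]: "prod_encode (pfst n, psnd n) = n"
  by (simp add: pfst_def psnd_def)

lemma pfst_le: "pfst n \<le> n"
  by (metis encode_pfst_psnd le_prod_encode_1)

text \<open>Further arguments are packed by pairing, so the introduction rules carry no arity and
  can be applied blindly.\<close>

definition comp_fun :: "nat set \<Rightarrow> (nat \<Rightarrow> nat) \<Rightarrow> bool" where
  "comp_fun X g \<longleftrightarrow> cfn X 1 (\<lambda>xs. g (xs ! 0))"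

lemma comp_const: "comp_fun X (\<lambda>n. c)"
  and comp_id: "comp_fun X (\<lambda>n. n)"
  and comp_Suc: "comp_fun X g \<Longrightarrow> comp_fun X (\<lambda>n. Suc (g n))"
  and comp_add: "comp_fun X g \<Longrightarrow> comp_fun X h \<Longrightarrow> comp_fun X (\<lambda>n. g n + h n)"
  and comp_diff: "comp_fun X g \<Longrightarrow> comp_fun X h \<Longrightarrow> comp_fun X (\<lambda>n. g n - h n)"
  and comp_pair: "comp_fun X g \<Longrightarrow> comp_fun X h \<Longrightarrow> comp_fun X (\<lambda>n. prod_encode (g n, h n))"
  by (simp_all add: comp_fun_def cfn_const cfn_nth cfn_Suc cfn_add cfn_diff cfn_prod_encode)

lemma comp_apply: "comp_fun X f \<Longrightarrow> comp_fun X g \<Longrightarrow> comp_fun X (\<lambda>n. f (g n))"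
  unfolding comp_fun_def by (rule cfn_comp1)

lemma comp_pfst: "comp_fun X g \<Longrightarrow> comp_fun X (\<lambda>n. pfst (g n))"
proof -
  have "pfst n = n - triangle (diagonal n)" for n
  proof -
    obtain a b where n: "n = prod_encode (a, b)" by (metis surj_pair prod_decode_inverse)
    show ?thesis by (simp add: n diagonal_def) (simp add: prod_encode_def)
  qed
  then show "comp_fun X g \<Longrightarrow> comp_fun X (\<lambda>n. pfst (g n))"
    by (simp add: comp_fun_def cfn_diff cfn_triangle cfn_diagonal)
qed

lemma comp_psnd: "comp_fun X g \<Longrightarrow> comp_fun X (\<lambda>n. psnd (g n))"
proof -
  have "psnd n = diagonal n - pfst n" for n by (simp add: psnd_def pfst_def diagonal_def)
  then show "comp_fun X g \<Longrightarrow> comp_fun X (\<lambda>n. psnd (g n))"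
    using comp_pfst[of X g] by (simp add: comp_fun_def cfn_diff cfn_diagonal)
qed

lemma comp_apply2:
  assumes "comp_fun X (\<lambda>v. F (pfst v) (psnd v))" "comp_fun X g" "comp_fun X h"
  shows "comp_fun X (\<lambda>n. F (g n) (h n))"
  using comp_apply[OF assms(1) comp_pair[OF assms(2,3)]] by simp

lemma comp_rec:
  assumes "comp_fun X z" "comp_fun X k"
    and "comp_fun X (\<lambda>v. s (pfst v) (pfst (psnd v)) (psnd (psnd v)))"
  shows "comp_fun X (\<lambda>n. rec_nat (z n) (\<lambda>i r. s n i r) (k n))"
proof -
  have "cfn X 2 (\<lambda>xs. rec_nat (z (xs ! 1)) (\<lambda>i r. s (xs ! 1) i r) (xs ! 0))"
  proof (rule cfn_rec2[of X z "\<lambda>i r n. s n i r"])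
    show "cfn X 1 (\<lambda>xs. z (xs ! 0))" using assms(1) by (simp add: comp_fun_def)
    \<comment> \<open>\<open>PrimRec\<close> supplies counter, previous value, parameter;
      \<open>s\<close> expects the parameter first.\<close>
    have "cfn X 3 (\<lambda>xs. prod_encode (xs ! 2, prod_encode (xs ! 0, xs ! 1)))"
      by (intro cfn_prod_encode cfn_nth) simp_all
    from cfn_comp1[OF assms(3)[unfolded comp_fun_def] this]
    show "cfn X 3 (\<lambda>xs. s (xs ! 2) (xs ! 0) (xs ! 1))" by simp
  qed
  from cfn_comp2[OF this, of 1 "\<lambda>xs. k (xs ! 0)" "\<lambda>xs. xs ! 0"] show ?thesis
    using assms(2) by (simp add: comp_fun_def cfn_nth)
qed

definition dec :: "nat set \<Rightarrow> (nat \<Rightarrow> bool) \<Rightarrow> bool" where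
  "dec X P \<longleftrightarrow> comp_fun X (\<lambda>n. if P n then 1 else 0)"

text \<open>The characteristic value is the number of recursion steps: none leaves
  \<open>g n\<close>, one overwrites it by \<open>f n\<close>.\<close>

lemma comp_if: "dec X P \<Longrightarrow> comp_fun X f \<Longrightarrow> comp_fun X g \<Longrightarrow> comp_fun X (\<lambda>n. if P n then f n else g n)"
proof -
  assume a: "dec X P" "comp_fun X f" "comp_fun X g"
  have "comp_fun X (\<lambda>n. rec_nat (g n) (\<lambda>i r. f n) (if P n then 1 else 0))"
    by (rule comp_rec[where s = "\<lambda>n i r. f n"])
      (use a in \<open>simp_all add: dec_def comp_apply comp_pfst comp_id\<close>)
  moreover have "rec_nat (g n) (\<lambda>i r. f n) (if P n then 1 else 0) = (if P n then f n else g n)" for n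
    by simp
  ultimately show ?thesis by simp
qed

lemma dec_const: "dec X (\<lambda>n. Q)"
  by (simp add: dec_def comp_const)

lemma dec_if:
  assumes "dec X P" "dec X Q" "dec X R"
  shows "dec X (\<lambda>n. if P n then Q n else R n)"
proof -
  have "(if (if P n then Q n else R n) then 1 else 0) =
      (if P n then if Q n then 1 else 0 else if R n then 1 else (0::nat))" for n by simp
  then show ?thesis using comp_if[OF assms[unfolded dec_def[of X Q] dec_def[of X R]]]
    unfolding dec_def by presburger
qed

lemma dec_not: "dec X P \<Longrightarrow> dec X (\<lambda>n. \<not> P n)"
  using dec_if[of X P "\<lambda>n. False" "\<lambda>n. True"] dec_const by (simp add: if_bool_eq_disj)

lemma dec_conj: "dec X P \<Longrightarrow> dec X Q \<Longrightarrow> dec X (\<lambda>n. P n \<and> Q n)"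
  using dec_if[of X P Q "\<lambda>n. False"] dec_const[of X False]
  by (simp add: if_bool_eq_disj)

lemma dec_disj: "dec X P \<Longrightarrow> dec X Q \<Longrightarrow> dec X (\<lambda>n. P n \<or> Q n)"
  using dec_if[of X P "\<lambda>n. True" Q] dec_const by (simp add: if_bool_eq_disj disj_conj_distribL)

lemma dec_imp: "dec X P \<Longrightarrow> dec X Q \<Longrightarrow> dec X (\<lambda>n. P n \<longrightarrow> Q n)"
  using dec_disj[of X "\<lambda>n. \<not> P n" Q] dec_not[of X P] by simp

lemma dec_iff: "dec X P \<Longrightarrow> dec X Q \<Longrightarrow> dec X (\<lambda>n. P n \<longleftrightarrow> Q n)"
  using dec_conj[of X "\<lambda>n. P n \<longrightarrow> Q n" "\<lambda>n. Q n \<longrightarrow> P n"] dec_imp[of X P Q] dec_imp[of X Q P]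
  by (simp add: iff_conv_conj_imp)

lemma dec_nonzero: "comp_fun X g \<Longrightarrow> dec X (\<lambda>n. g n \<noteq> 0)"
proof -
  assume "comp_fun X g"
  then have "comp_fun X (\<lambda>n. 1 - (1 - g n))" by (intro comp_diff comp_const)
  moreover have "1 - (1 - g n) = (if g n \<noteq> 0 then 1 else 0)" for n by auto
  ultimately show ?thesis by (simp add: dec_def)
qed

lemma dec_less: "comp_fun X g \<Longrightarrow> comp_fun X h \<Longrightarrow> dec X (\<lambda>n. g n < h n)"
  using dec_nonzero[OF comp_diff[of X h g]] by (simp flip: not_le)

lemma dec_le: "comp_fun X g \<Longrightarrow> comp_fun X h \<Longrightarrow> dec X (\<lambda>n. g n \<le> h n)"
  using dec_not[OF dec_less[of X h g]] by (simp add: not_less)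

lemma dec_eq: "comp_fun X g \<Longrightarrow> comp_fun X h \<Longrightarrow> dec X (\<lambda>n. g n = h n)"
  using dec_conj[OF dec_le[of X g h] dec_le[of X h g]] by (simp add: order_eq_iff)

lemma dec_apply: "dec X P \<Longrightarrow> comp_fun X g \<Longrightarrow> dec X (\<lambda>n. P (g n))"
  unfolding dec_def by (rule comp_apply)

lemma dec_apply2:
  assumes "dec X (\<lambda>v. P (pfst v) (psnd v))" "comp_fun X g" "comp_fun X h"
  shows "dec X (\<lambda>n. P (g n) (h n))"
  using dec_apply[OF assms(1) comp_pair[OF assms(2,3)]] by simp

lemma dec_all_less:
  assumes "dec X (\<lambda>v. P (pfst v) (psnd v))" "comp_fun X k"
  shows "dec X (\<lambda>n. \<forall>i<k n. P n i)"
proof -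
  have "comp_fun X (\<lambda>n. rec_nat 1 (\<lambda>i r. if P n i then r else 0) (k n))"
    by (rule comp_rec[where s = "\<lambda>n i r. if P n i then r else 0"])
      (rule assms comp_if dec_apply2[OF assms(1)] comp_const | intro comp_pfst comp_psnd comp_id)+
  moreover have "rec_nat 1 (\<lambda>i r. if P n i then r else 0) m = (if \<forall>i<m. P n i then 1 else (0::nat))" for n m
    by (induction m) (auto simp: less_Suc_eq)
  ultimately show ?thesis by (simp only: dec_def)
qed

lemma dec_ex_less:
  assumes "dec X (\<lambda>v. P (pfst v) (psnd v))" "comp_fun X k"
  shows "dec X (\<lambda>n. \<exists>i<k n. P n i)"
  using dec_not[OF dec_all_less[OF dec_not[OF assms(1)] assms(2)]] by simp

lemma dec_computable_in: "dec X (\<lambda>n. n \<in> A) \<longleftrightarrow> computable_in X A"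
proof -
  have "(\<forall>xs. length xs = 1 \<longrightarrow> peval X f xs (g (xs ! 0))) \<longleftrightarrow> (\<forall>n. peval X f [n] (g n))" for f g
    by (auto simp: length_Suc_conv)
  from this[of _ "\<lambda>n. if n \<in> A then 1 else 0"] show ?thesis
    unfolding dec_def comp_fun_def cfn_def computable_in_def by simp
qed

lemma computable_in_oracle: "computable_in X X"
  unfolding computable_in_def using peval.intros(4) by blast

subsection \<open>Coded lists\<close>

definition ccons :: "nat \<Rightarrow> nat \<Rightarrow> nat" where "ccons a n = Suc (prod_encode (a, n))"
text \<open>\<open>chd\<close> and \<open>ctl\<close> are total and send 0, the code of the empty
  list, to 0. Thus dropping past the end stays at 0, on which the computation of \<open>clen\<close>
  relies.\<close>

definition chd :: "nat \<Rightarrow> nat" where "chd n = pfst (n - 1)"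
definition ctl :: "nat \<Rightarrow> nat" where "ctl n = psnd (n - 1)"
definition cdrop :: "nat \<Rightarrow> nat \<Rightarrow> nat" where "cdrop i n = rec_nat n (\<lambda>i r. ctl r) i"
definition cnth :: "nat \<Rightarrow> nat \<Rightarrow> nat" where "cnth n i = chd (cdrop i n)"
definition clen :: "nat \<Rightarrow> nat" where "clen n = length (list_decode n)"

lemma list_encode_Cons_ccons [simp]: "list_encode (x # xs) = ccons x (list_encode xs)"
  by (simp add: ccons_def)

declare list_encode.simps(2) [simp del]

lemma ccons_neq_0 [simp]: "ccons a n \<noteq> 0" by (simp add: ccons_def)
lemma chd_ccons [simp]: "chd (ccons a n) = a" by (simp add: chd_def ccons_def)
lemma ctl_ccons [simp]: "ctl (ccons a n) = n" by (simp add: ctl_def ccons_def)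

lemma ccons_cases: obtains "n = 0" | a m where "n = ccons a m"
  by (cases n) (use encode_pfst_psnd[of "n - 1"] in \<open>metis ccons_def diff_Suc_1\<close>)+

lemma list_decode_ccons [simp]: "list_decode (ccons a n) = a # list_decode n"
  by (metis list_decode_inverse list_encode_Cons_ccons list_encode_inverse)

lemma less_ccons: "a < ccons a n" "n < ccons a n"
  using le_prod_encode_1[of a n] le_prod_encode_2[of n a] by (auto simp: ccons_def)

lemma ctl_less: "h \<noteq> 0 \<Longrightarrow> ctl h < h"
  by (cases h rule: ccons_cases) (simp_all add: less_ccons)

lemma coded_list_induct: "P 0 \<Longrightarrow> (\<And>e h. P h \<Longrightarrow> P (ccons e h)) \<Longrightarrow> P h"
proof (induction h rule: less_induct)
  case (less h)
  then show ?case by (cases h rule: ccons_cases) (auto simp: less_ccons)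
qed

lemma clen_simps [simp]: "clen 0 = 0" "clen (ccons a n) = Suc (clen n)"
  by (simp_all add: clen_def)

lemma clen_list_encode [simp]: "clen (list_encode xs) = length xs"
  by (simp add: clen_def)

lemma cdrop_list_encode: "i \<le> length xs \<Longrightarrow> cdrop i (list_encode xs) = list_encode (drop i xs)"
proof (induction i)
  case (Suc i)
  then have "drop i xs = xs ! i # drop (Suc i) xs" by (simp add: Cons_nth_drop_Suc)
  then show ?case using Suc by (simp add: cdrop_def)
qed (simp add: cdrop_def)

lemma cnth_list_encode: "i < length xs \<Longrightarrow> cnth (list_encode xs) i = xs ! i"
  by (simp add: cnth_def cdrop_list_encode Cons_nth_drop_Suc[symmetric])

lemma cnth_ccons [simp]: "cnth (ccons e h) 0 = e" "cnth (ccons e h) (Suc i) = cnth h i"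
proof -
  have "cdrop (Suc i) n = cdrop i (ctl n)" for i n
    by (induction i) (simp_all add: cdrop_def)
  then show "cnth (ccons e h) (Suc i) = cnth h i" by (simp add: cnth_def)
qed (simp add: cnth_def cdrop_def)

lemma cnth_less: "i < clen n \<Longrightarrow> cnth n i < n"
proof (induction n arbitrary: i rule: less_induct)
  case (less n)
  obtain xs where n: "n = list_encode xs" by (metis list_decode_inverse)
  with less.prems have i: "i < length xs" by (simp add: clen_def)
  have "x \<in> set xs \<Longrightarrow> x < list_encode xs" for x xs
    by (induction xs) (auto simp: less_ccons intro: less_trans)
  then show ?case using i by (simp add: n cnth_list_encode)
qed

lemma clen_le: "clen n \<le> n"
proof -
  have "length xs \<le> list_encode xs" for xs
    by (induction xs) (use less_ccons in \<open>auto simp: Suc_le_eq intro: le_less_trans\<close>)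
  from this[of "list_decode n"] show ?thesis by (simp add: clen_def)
qed

lemma comp_ccons: "comp_fun X g \<Longrightarrow> comp_fun X h \<Longrightarrow> comp_fun X (\<lambda>n. ccons (g n) (h n))"
  and comp_chd: "comp_fun X g \<Longrightarrow> comp_fun X (\<lambda>n. chd (g n))"
  and comp_ctl: "comp_fun X g \<Longrightarrow> comp_fun X (\<lambda>n. ctl (g n))"
  unfolding ccons_def chd_def ctl_def
  by (intro comp_Suc comp_pair comp_pfst comp_psnd comp_diff comp_const; assumption)+

lemma comp_cdrop: "comp_fun X g \<Longrightarrow> comp_fun X h \<Longrightarrow> comp_fun X (\<lambda>n. cdrop (g n) (h n))"
  unfolding cdrop_def
  by (rule comp_rec[where s = "\<lambda>n i r. ctl r"]) (assumption | intro comp_ctl comp_psnd comp_id)+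

lemma comp_cnth: "comp_fun X g \<Longrightarrow> comp_fun X h \<Longrightarrow> comp_fun X (\<lambda>n. cnth (g n) (h n))"
  unfolding cnth_def by (intro comp_chd comp_cdrop)

lemma comp_clen: "comp_fun X g \<Longrightarrow> comp_fun X (\<lambda>n. clen (g n))"
proof (rule comp_apply[of X clen])
  \<comment> \<open>The length is the number of i for which dropping i entries leaves something; by
    \<open>clen_le\<close> the code itself bounds the search.\<close>
  have "comp_fun X (\<lambda>n. rec_nat 0 (\<lambda>i r. if cdrop i n \<noteq> 0 then Suc r else r) n)"
    by (rule comp_rec[where s = "\<lambda>n i r. if cdrop i n \<noteq> 0 then Suc r else r"])
      (intro comp_if dec_nonzero comp_cdrop comp_Suc comp_pfst comp_psnd comp_id comp_const)+
  moreover have "rec_nat 0 (\<lambda>i r. if cdrop i n \<noteq> 0 then Suc r else r) m = min m (clen n)" for n m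
  proof (induction m)
    case (Suc m)
    obtain xs where n: "n = list_encode xs" by (metis list_decode_inverse)
    show ?case
    proof (cases "m < clen n")
      case True
      then have "cdrop m n \<noteq> 0"
        by (simp add: n clen_def cdrop_list_encode Cons_nth_drop_Suc[symmetric])
      then show ?thesis using Suc True by simp
    next
      case False
      have "cdrop j n = 0" if "j \<ge> length xs" for j using that
      proof (induction j rule: dec_induct)
        case base
        then show ?case by (simp add: n cdrop_list_encode)
      next
        case (step j)
        then show ?case by (simp add: cdrop_def ctl_def psnd_def prod_decode_def prod_decode_aux.simps)
      qed
      then show ?thesis using Suc False by (simp add: n clen_def)
    qed
  qed simp
  ultimately show "comp_fun X clen" using clen_le by (simp add: min_absorb2)
qed

text \<open>Primitive recursion on the coded list of all earlier values. The newest value is at the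
  head, so the value at i < n has index n - 1 - i. Beyond n the lookup is meaningless, and
  \<open>local\<close> says that \<open>H\<close> does not depend on it. The argument
  \<open>w\<close> is a parameter.\<close>

lemma comp_course_of_values:
  assumes rec: "\<And>w n. F w n = H w n (F w)"
    and local: "\<And>w n g g'. (\<And>i. i < n \<Longrightarrow> g i = g' i) \<Longrightarrow> H w n g = H w n g'"
    and comp: "comp_fun X (\<lambda>v. H (pfst v) (pfst (psnd v))
                 (\<lambda>i. cnth (psnd (psnd v)) (pfst (psnd v) - 1 - i)))"
  shows "comp_fun X (\<lambda>v. F (pfst v) (psnd v))"
proof -
  define table where
    "table w = rec_nat 0 (\<lambda>n t. ccons (H w n (\<lambda>i. cnth t (n - 1 - i))) t)" for w
  have table: "table w n = list_encode (map (F w) (rev [0..<n]))" for w n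
  proof (induction n)
    case (Suc n)
    have "cnth (table w n) (n - 1 - i) = F w i" if "i < n" for i
      using that by (simp add: Suc cnth_list_encode rev_nth)
    then have "H w n (\<lambda>i. cnth (table w n) (n - 1 - i)) = F w n"
      unfolding rec[of w n] by (intro local)
    moreover have "table w (Suc n) = ccons (H w n (\<lambda>i. cnth (table w n) (n - 1 - i))) (table w n)"
      by (simp add: table_def)
    ultimately show ?case by (simp add: Suc)
  qed (simp add: table_def)
  have "comp_fun X (\<lambda>v. chd (table (pfst v) (Suc (psnd v))))"
    unfolding table_def
    apply (rule comp_chd)
    apply (rule comp_rec[where s = "\<lambda>v n t. ccons (H (pfst v) n (\<lambda>i. cnth t (n - 1 - i))) t"])
      apply (intro comp_const comp_Suc comp_psnd comp_id)+
    apply (rule comp_ccons)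
     apply (rule comp_apply[OF comp, of "\<lambda>v. prod_encode (pfst (pfst v), psnd v)",
          unfolded pfst_encode psnd_encode])
     apply (intro comp_pair comp_pfst comp_psnd comp_id)
    apply (intro comp_psnd comp_id)
    done
  then show ?thesis by (simp add: table)
qed

lemmas comp_basic = comp_id comp_const comp_Suc comp_add comp_diff comp_pair comp_pfst comp_psnd
  comp_ccons comp_chd comp_ctl comp_cdrop comp_cnth comp_clen comp_if
  dec_const dec_not dec_conj dec_disj dec_imp dec_iff dec_less dec_le dec_eq

section \<open>Computable well-orderings\<close>

text \<open>A program determines the set it decides; hence it accounts for at most one order type
  below.\<close>

lemma peval_deterministic: "peval X f xs v \<Longrightarrow> peval X f xs w \<Longrightarrow> v = w"
proof (induction arbitrary: w rule: peval.induct)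
  case (5 ys gs xs f v)
  from 5(6) obtain zs where zs: "length zs = length gs"
    "\<And>i. i < length gs \<Longrightarrow> peval X (gs ! i) xs (zs ! i)" "peval X f zs w"
    by cases auto
  then have "zs = ys" using 5(1,4) by (intro nth_equalityI) (auto, metis)
  then show ?case using zs 5 by simp
next
  case (8 f n xs)
  from 8(4) have w: "peval X f (w # xs) 0" "\<And>m. m < w \<Longrightarrow> \<exists>v. peval X f (m # xs) (Suc v)"
    by (cases; auto)+
  have "\<not> n < w" using w(2)[of n] 8(2) by fastforce
  moreover have "\<not> w < n" using w(1) 8(3)[of w] by fastforce
  ultimately show ?case by simp
next
  case 6 from 6(3) show ?case by cases (use 6 in auto)
next
  case 7 from 7(5) show ?case by cases (use 7 in auto)
qed (auto elim: peval.cases)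

instance precf :: countable by countable_datatype

section \<open>Countable ordinals as types of X-computable well-orderings\<close>

lemma Field_ord_segment: "Field (ord_segment \<alpha>) = {\<beta>. \<beta> < \<alpha>}"
  by (auto simp: ord_segment_def Field_def)

lemma Well_order_ord_segment: "Well_order (ord_segment \<alpha>)"
proof -
  have "ord_segment \<alpha> - Id \<subseteq> {(\<beta>, \<gamma>). \<beta> < \<gamma>}" by (auto simp: ord_segment_def)
  then have "wf (ord_segment \<alpha> - Id)" using wf_subset wf by blast
  then show ?thesis unfolding Field_ord_segment
    by (auto simp: well_order_on_def linear_order_on_def partial_order_on_def preorder_on_def
        refl_on_def trans_def antisym_def total_on_def ord_segment_def)
qed

lemma ord_segment_Restr_under:
  "\<beta> < \<alpha> \<Longrightarrow> Restr (ord_segment \<alpha>) (underS (ord_segment \<alpha>) \<beta>) = ord_segment \<beta>"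
  by (auto simp: ord_segment_def underS_def)

lemma ord_segment_ordLess: "\<beta> < \<alpha> \<Longrightarrow> (ord_segment \<beta>, ord_segment \<alpha>) \<in> ordLess"
  using ordLess_iff_ordIso_Restr[OF Well_order_ord_segment Well_order_ord_segment, of \<beta> \<alpha>]
    ord_segment_Restr_under[of \<beta> \<alpha>] Field_ord_segment ordIso_reflexive[OF Well_order_ord_segment]
  by (metis mem_Collect_eq)

lemma ord_segment_ordIso_inject: "(ord_segment \<alpha>, ord_segment \<beta>) \<in> ordIso \<Longrightarrow> \<alpha> = \<beta>"
  by (metis linorder_neqE not_ordLess_ordIso ord_segment_ordLess ordIso_symmetric)

text \<open>The \<open>LEAST\<close> in \<open>omega1_CK\<close> is attained: there are countably
  many programs, each yields at most one order type, and \<open>omega1\<close> is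
  uncountable.\<close>

lemma omega1_CK_not_computable:
  assumes "Well_order (R :: nat rel)" "computable_in X (prod_encode ` R)"
  shows "(R, ord_segment (omega1_CK X)) \<notin> ordIso"
proof -
  define code where "code \<alpha> f \<longleftrightarrow> (\<exists>R :: nat rel. Well_order R \<and> (R, ord_segment \<alpha>) \<in> ordIso \<and>
    (\<forall>n. peval X f [n] (if n \<in> prod_encode ` R then 1 else 0)))" for \<alpha> f
  have "\<alpha> = \<beta>" if "code \<alpha> f" "code \<beta> f" for \<alpha> \<beta> f
  proof -
    obtain R R' :: "nat rel" where R: "(R, ord_segment \<alpha>) \<in> ordIso"
      "\<And>n. peval X f [n] (if n \<in> prod_encode ` R then 1 else 0)"
      and R': "(R', ord_segment \<beta>) \<in> ordIso"
      "\<And>n. peval X f [n] (if n \<in> prod_encode ` R' then 1 else 0)"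
      using \<open>code \<alpha> f\<close> \<open>code \<beta> f\<close> unfolding code_def by blast
    have "n \<in> prod_encode ` R \<longleftrightarrow> n \<in> prod_encode ` R'" for n
      using peval_deterministic[OF R(2) R'(2), of n] by (auto split: if_splits)
    then have "R = R'" by (metis inj_image_eq_iff inj_prod_encode set_eqI)
    then show ?thesis
      using R R' ord_segment_ordIso_inject ordIso_symmetric ordIso_transitive by blast
  qed
  moreover have "\<exists>f. code \<alpha> f"
    if "\<exists>R :: nat rel. Well_order R \<and> computable_in X (prod_encode ` R) \<and> (R, ord_segment \<alpha>) \<in> ordIso" for \<alpha>
    using that unfolding code_def computable_in_def by blast
  ultimately have "countable {\<alpha>. \<exists>R :: nat rel. Well_order R \<and> computable_in X (prod_encode ` R) \<and>
      (R, ord_segment \<alpha>) \<in> ordIso}"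
    by (intro countableI'[where f = "\<lambda>\<alpha>. to_nat (SOME f. code \<alpha> f)"] inj_onI)
      (smt (verit) mem_Collect_eq someI_ex to_nat_split)
  then have "\<exists>\<alpha>. \<not> (\<exists>R :: nat rel. Well_order R \<and> computable_in X (prod_encode ` R) \<and>
      (R, ord_segment \<alpha>) \<in> ordIso)"
    by (metis (no_types, lifting) uncountable_omega1 UNIV_eq_I mem_Collect_eq)
  from LeastI_ex[OF this] show ?thesis
    using assms unfolding omega1_CK_def by blast
qed

text \<open>The definition excludes only \<open>omega1_CK X\<close> itself as a computable type, so
  longer orders need an argument: such an R would have a proper initial segment of that type, and
  the predecessors of a point are decidable from R.\<close>

lemma computable_well_order_rank:
  assumes R: "Well_order (R :: nat rel)" "computable_in X (prod_encode ` R)"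
  obtains \<alpha> rk where "\<alpha> < omega1_CK X" "\<And>x. x \<in> Field R \<Longrightarrow> rk x < \<alpha>"
    "\<And>x y. (x, y) \<in> R \<Longrightarrow> x \<noteq> y \<Longrightarrow> rk x < (rk y :: omega1)"
proof -
  let ?W = "ord_segment (omega1_CK X)"
  have "\<not> (?W, R) \<in> ordLeq"
  proof
    assume "(?W, R) \<in> ordLeq"
    then consider "(?W, R) \<in> ordIso" | "(?W, R) \<in> ordLess"
      using ordLeq_iff_ordLess_or_ordIso by blast
    then show False
    proof cases
      case 1
      then show ?thesis using omega1_CK_not_computable[OF R] ordIso_symmetric by blast
    next
      case 2
      then obtain a where a: "(?W, Restr R (underS R a)) \<in> ordIso"
        using ordLess_iff_ordIso_Restr[OF R(1) Well_order_ord_segment] by blast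
      have R': "dec X (\<lambda>n. n \<in> prod_encode ` R)" using R(2) by (simp add: dec_computable_in)
      have under: "dec X (\<lambda>x. x \<in> underS R a)"
      proof -
        have "dec X (\<lambda>x. x \<noteq> a \<and> prod_encode (x, a) \<in> prod_encode ` R)"
          by (intro dec_conj dec_not dec_eq dec_apply[OF R'] comp_pair comp_id comp_const)
        moreover have "x \<noteq> a \<and> prod_encode (x, a) \<in> prod_encode ` R \<longleftrightarrow> x \<in> underS R a" for x
          by (auto simp: underS_def)
        ultimately show ?thesis by simp
      qed
      have "dec X (\<lambda>n. n \<in> prod_encode ` R \<and> pfst n \<in> underS R a \<and> psnd n \<in> underS R a)"
        by (intro dec_conj R' dec_apply[OF under] comp_pfst comp_psnd comp_id)
      moreover have "n \<in> prod_encode ` R \<and> pfst n \<in> underS R a \<and> psnd n \<in> underS R a \<longleftrightarrow>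
          n \<in> prod_encode ` Restr R (underS R a)" for n
      proof -
        have "n \<in> prod_encode ` Q \<longleftrightarrow> (pfst n, psnd n) \<in> Q" for Q
          by (metis encode_pfst_psnd image_iff pfst_encode psnd_encode surj_pair)
        then show ?thesis by simp
      qed
      ultimately have "computable_in X (prod_encode ` Restr R (underS R a))"
        by (simp add: dec_computable_in)
      then show ?thesis
        using omega1_CK_not_computable Well_order_Restr[OF R(1)] a ordIso_symmetric by blast
    qed
  qed
  then have "(R, ?W) \<in> ordLess"
    using ordLess_or_ordLeq[OF R(1) Well_order_ord_segment] by blast
  then obtain \<alpha> where \<alpha>: "\<alpha> < omega1_CK X" "(R, ord_segment \<alpha>) \<in> ordIso"
    using ordLess_iff_ordIso_Restr[OF Well_order_ord_segment R(1), of "omega1_CK X"]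
      ord_segment_Restr_under Field_ord_segment by (metis mem_Collect_eq)
  then obtain rk where rk: "iso R (ord_segment \<alpha>) rk" unfolding ordIso_def by blast
  show ?thesis
  proof (rule that[OF \<alpha>(1), of rk])
    have bij: "bij_betw rk (Field R) {\<beta>. \<beta> < \<alpha>}"
      and le: "\<And>x y. x \<in> Field R \<Longrightarrow> y \<in> Field R \<Longrightarrow> (x, y) \<in> R \<longleftrightarrow> (rk x, rk y) \<in> ord_segment \<alpha>"
      using iso_iff2[of R "ord_segment \<alpha>" rk] rk Field_ord_segment[of \<alpha>] by auto
    show "x \<in> Field R \<Longrightarrow> rk x < \<alpha>" for x using bij by (auto simp: bij_betw_def)
    fix x y assume "(x, y) \<in> R" "x \<noteq> y"
    moreover from this have "x \<in> Field R" "y \<in> Field R" by (auto simp: Field_def)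
    ultimately show "rk x < rk y"
      using le bij unfolding ord_segment_def bij_betw_def inj_on_def by (auto simp: order.order_iff_strict)
  qed
qed


section \<open>Bounding the length of games\<close>

text \<open>The duplicator survives \<open>\<alpha>\<close> rounds; spoiler moves and duplicator replies are arbitrary
  natural numbers, and \<open>good\<close> is a closed condition on positions.\<close>

function win :: "(nat \<Rightarrow> nat \<Rightarrow> nat \<Rightarrow> nat) \<Rightarrow> (nat \<Rightarrow> nat \<Rightarrow> bool) \<Rightarrow> omega1 \<Rightarrow> nat \<Rightarrow> bool" where
  "win step good \<alpha> p \<longleftrightarrow>
    (\<forall>m. good p m) \<and> (\<forall>\<beta>. \<beta> < \<alpha> \<longrightarrow> (\<forall>a. \<exists>b. win step good \<beta> (step p a b)))"
  by auto
termination
  by (relation "inv_image {(x, y). x < y} (\<lambda>x. fst (snd (snd x)))") (auto intro: wf)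

declare win.simps [simp del]

text \<open>The Kleene--Brouwer order on codes of finite sequences.\<close>

definition ckey :: "nat \<Rightarrow> nat \<Rightarrow> enat" where
  "ckey x i = (if i < clen x then enat (cnth x i) else \<infinity>)"

text \<open>Padding with infinity puts a proper extension below the sequence it extends, so one
  lexicographic comparison covers both clauses of the order.\<close>

definition kb :: "nat \<Rightarrow> nat \<Rightarrow> bool" where
  "kb x y \<longleftrightarrow> (\<exists>i. ckey x i < ckey y i \<and> (\<forall>j<i. ckey x j = ckey y j))"

lemma kb_irrefl: "\<not> kb x x"
  by (simp add: kb_def)

lemma kb_trans:
  assumes "kb x y" "kb y z"
  shows "kb x z"
proof -
  obtain i j where i: "ckey x i < ckey y i" "\<And>k. k < i \<Longrightarrow> ckey x k = ckey y k"
    and j: "ckey y j < ckey z j" "\<And>k. k < j \<Longrightarrow> ckey y k = ckey z k"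
    using assms unfolding kb_def by blast
  have "ckey x (min i j) < ckey z (min i j)"
    by (rule linorder_cases[of i j]) (use i j in \<open>auto simp: min_def intro: less_trans\<close>)
  moreover have "\<forall>k<min i j. ckey x k = ckey z k" using i(2) j(2) by simp
  ultimately show ?thesis unfolding kb_def by blast
qed

lemma ckey_inject:
  assumes "\<And>i. ckey x i = ckey y i"
  shows "x = y"
proof -
  obtain xs ys where x: "x = list_encode xs" "y = list_encode ys" by (metis list_decode_inverse)
  have len: "length xs = length ys"
    using assms[of "length xs"] assms[of "length ys"] unfolding x ckey_def clen_def
    by (auto split: if_splits)
  have "xs ! i = ys ! i" if "i < length xs" for i
    using assms[of i] that len unfolding x ckey_def clen_def by (simp add: cnth_list_encode)
  then show ?thesis using len x nth_equalityI by metis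
qed

lemma kb_total:
  assumes "x \<noteq> y"
  shows "kb x y \<or> kb y x"
proof -
  have ex: "\<exists>i. ckey x i \<noteq> ckey y i" using assms ckey_inject by blast
  define i where "i = (LEAST i. ckey x i \<noteq> ckey y i)"
  have "ckey x i \<noteq> ckey y i" "\<forall>j<i. ckey x j = ckey y j"
    using LeastI_ex[OF ex] not_less_Least unfolding i_def by auto
  then show ?thesis unfolding kb_def by (metis linorder_neqE)
qed

text \<open>At the first difference the smaller key is finite, so that place lies below
  \<open>clen x\<close>; this bounds the search and makes the order decidable.\<close>

lemma kb_bounded:
  "kb x y \<longleftrightarrow> (\<exists>i<clen x. (\<forall>j<i. j < clen y \<and> cnth x j = cnth y j) \<and> (clen y \<le> i \<or> cnth x i < cnth y i))"
  (is "_ = ?r")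
proof
  assume "kb x y"
  then obtain i where i: "ckey x i < ckey y i" "\<And>j. j < i \<Longrightarrow> ckey x j = ckey y j"
    unfolding kb_def by blast
  then have "i < clen x" "clen y \<le> i \<or> cnth x i < cnth y i"
    by (auto simp: ckey_def split: if_splits)
  moreover have "j < clen y \<and> cnth x j = cnth y j" if "j < i" for j
    using i(2)[OF that] that \<open>i < clen x\<close> by (auto simp: ckey_def split: if_splits)
  ultimately show ?r by blast
next
  assume ?r
  then obtain i where "i < clen x" "\<And>j. j < i \<Longrightarrow> j < clen y \<and> cnth x j = cnth y j"
    "clen y \<le> i \<or> cnth x i < cnth y i" by blast
  then have "ckey x i < ckey y i \<and> (\<forall>j<i. ckey x j = ckey y j)"
    by (auto simp: ckey_def)
  then show "kb x y" unfolding kb_def by blast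
qed

lemma dec_kb: "dec X (\<lambda>v. kb (pfst v) (psnd v))"
  unfolding kb_bounded by (intro dec_ex_less dec_all_less comp_basic)

text \<open>On a tree without infinite path the Kleene-Brouwer order is a well-order. Among the
  sequences extending \<open>us\<close>, keep those whose next entry is least and continue one level
  higher; \<open>us\<close> itself can be minimal only if it has no proper extension in Q.\<close>

lemma kb_minimal:
  assumes closed: "\<And>xs k. xs \<in> U \<Longrightarrow> take k xs \<in> U"
    and nopath: "\<And>f. \<exists>n. map f [0..<n] \<notin> U"
    and Q: "Q \<subseteq> list_encode ` U" "Q \<noteq> {}"
  shows "\<exists>m\<in>Q. \<forall>q\<in>Q. q \<noteq> m \<longrightarrow> kb m q"
proof -
  \<comment> \<open>Extensions count as smaller, so an infinite descent is an infinite path.\<close>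
  define E where "E = {(xs @ [a], xs) | xs a. xs @ [a] \<in> U}"
  have "wf E"
    unfolding wf_iff_no_infinite_down_chain
  proof
    assume "\<exists>s. \<forall>i. (s (Suc i), s i) \<in> E"
    then obtain s where s: "\<And>i. (s (Suc i), s i) \<in> E" by blast
    have step: "\<exists>a. s (Suc i) = s i @ [a]" "s (Suc i) \<in> U" for i
      using s[of i] unfolding E_def by auto
    have len: "length (s i) = length (s 0) + i" for i
    proof (induction i)
      case (Suc i)
      obtain a where "s (Suc i) = s i @ [a]" using step(1) by blast
      then show ?case using Suc by simp
    qed simp
    have pre: "take (length (s i)) (s (i + k)) = s i" for i k
    proof (induction k)
      case (Suc k)
      obtain a where "s (Suc (i + k)) = s (i + k) @ [a]" using step(1) by blast
      then show ?case using Suc len[of i] len[of "i + k"] by simp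
    qed simp
    define f where "f n = s (Suc n) ! n" for n
    have "map f [0..<n] = take n (s (Suc n))" for n
    proof (rule nth_equalityI)
      show "length (map f [0..<n]) = length (take n (s (Suc n)))" using len[of "Suc n"] by simp
      fix i assume "i < length (map f [0..<n])"
      then have i: "i < n" by simp
      then have "s (Suc n) ! i = take (length (s (Suc i))) (s (Suc i + (n - i))) ! i"
        using len[of "Suc i"] by simp
      also have "\<dots> = f i" unfolding pre f_def ..
      finally show "map f [0..<n] ! i = take n (s (Suc n)) ! i" using i by simp
    qed
    then have "map f [0..<n] \<in> U" for n using closed step(2) by simp
    then show False using nopath by blast
  qed
  have "\<exists>m\<in>Q. \<forall>q\<in>Q. q \<noteq> m \<longrightarrow> kb m q"
    if "Q \<subseteq> list_encode ` {xs \<in> U. take (length us) xs = us}" "Q \<noteq> {}" for Q us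
    using \<open>wf E\<close> that
  proof (induction us arbitrary: Q rule: wf_induct_rule)
    case (less us)
    define Q' where "Q' = {xs \<in> U. list_encode xs \<in> Q \<and> length us < length xs}"
    show ?case
    proof (cases "Q' = {}")
      case True
      have "q = list_encode us" if q: "q \<in> Q" for q
      proof -
        obtain xs where "q = list_encode xs" "xs \<in> U" "take (length us) xs = us"
          using less(2) q by blast
        with q True show ?thesis unfolding Q'_def by (cases "length us < length xs") auto
      qed
      then show ?thesis using less(3) by (metis ex_in_conv)
    next
      case False
      define a where "a = (LEAST a. \<exists>xs\<in>Q'. xs ! length us = a)"
      have ex: "\<exists>a. \<exists>xs\<in>Q'. xs ! length us = a" using False by blast
      obtain ys where ys: "ys \<in> Q'" "ys ! length us = a" using LeastI_ex[OF ex] unfolding a_def by blast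
      have min: "a \<le> xs ! length us" if "xs \<in> Q'" for xs
        unfolding a_def using that by (intro Least_le) blast
      have pre: "take (length us) xs = us" if "list_encode xs \<in> Q" for xs
        using less(2) that by (auto simp: inj_list_encode inj_eq dest!: subsetD)
      have ext: "take (length (us @ [b])) xs = us @ [b] \<longleftrightarrow> xs ! length us = b" if "xs \<in> Q'" for xs b
        using that pre[of xs] unfolding Q'_def by (simp add: take_Suc_conv_app_nth)
      define Q'' where "Q'' = list_encode ` {xs \<in> Q'. xs ! length us = a}"
      have "us @ [a] = take (Suc (length us)) ys" using ext[OF ys(1), of a] ys(2) by simp
      moreover have "ys \<in> U" using ys(1) unfolding Q'_def by simp
      ultimately have "us @ [a] \<in> U" using closed by metis
      then have "(us @ [a], us) \<in> E" unfolding E_def by blast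
      moreover have "Q'' \<subseteq> list_encode ` {xs \<in> U. take (length (us @ [a])) xs = us @ [a]}"
        unfolding Q''_def using ext by (intro image_mono) (auto simp: Q'_def)
      moreover have "Q'' \<noteq> {}" unfolding Q''_def using ys by blast
      ultimately obtain m where m: "m \<in> Q''" "\<forall>q\<in>Q''. q \<noteq> m \<longrightarrow> kb m q"
        using less(1)[of "us @ [a]" Q''] by blast
      obtain ms where ms: "m = list_encode ms" "ms \<in> Q'" "ms ! length us = a"
        using m(1) unfolding Q''_def by blast
      have "kb m q" if q: "q \<in> Q" "q \<noteq> m" for q
      proof -
        obtain xs where xs: "q = list_encode xs" "xs \<in> U" using less(2) q(1) by blast
        show ?thesis
        proof (cases "xs \<in> Q' \<and> xs ! length us = a")
          case True
          then show ?thesis using m(2) q(2) xs unfolding Q''_def by blast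
        next
          case False
          have "take (length us) ms = take (length us) xs"
            using pre[of xs] pre[of ms] xs q ms unfolding Q'_def by simp
          then have "ckey m j = ckey q j" if "j < length us" for j
            using that pre[of xs] pre[of ms] xs q ms unfolding Q'_def ckey_def clen_def
            by (smt (verit, best) cnth_list_encode length_take list_encode_inverse min_less_iff_conj
                nth_take mem_Collect_eq)
          moreover have "ckey m (length us) < ckey q (length us)"
          proof (cases "length us < length xs")
            case True
            then have "xs \<in> Q'" using xs q unfolding Q'_def by simp
            then have "a < xs ! length us" using False min[of xs] by auto
            then show ?thesis using True xs ms unfolding Q'_def ckey_def clen_def
              by (simp add: cnth_list_encode)
          next
            case False
            then show ?thesis using xs ms unfolding Q'_def ckey_def clen_def by simp
          qed
          ultimately show ?thesis unfolding kb_def by blast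
        qed
      qed
      moreover have "m \<in> Q" using ms unfolding Q'_def by simp
      ultimately show ?thesis by blast
    qed
  qed
  from this[of Q "[]"] Q show ?thesis by simp
qed


section \<open>The self-referential tree of strategies and the bounding theorem\<close>

locale closed_game =
  fixes X :: "nat set" and step :: "nat \<Rightarrow> nat \<Rightarrow> nat \<Rightarrow> nat" and good :: "nat \<Rightarrow> nat \<Rightarrow> bool"
    and start :: nat
  assumes comp_step: "comp_fun X (\<lambda>v. step (pfst v) (pfst (psnd v)) (psnd (psnd v)))"
    and dec_good: "dec X (\<lambda>v. good (pfst v) (psnd v))"
begin

text \<open>A history is a code of a list of pairs of a node and a spoiler move, the latest pair first.
  A function \<open>g\<close> from histories to replies is a strategy, which leads to the position \<open>pos g h\<close>.\<close>

function pos :: "(nat \<Rightarrow> nat) \<Rightarrow> nat \<Rightarrow> nat" where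
  "pos g h = (if h = 0 then start else step (pos g (ctl h)) (psnd (chd h)) (g h))"
  by auto
termination
  by (relation "measure snd") (simp_all add: ctl_less)

declare pos.simps [simp del]

lemma pos_0 [simp]: "pos g 0 = start"
  and pos_ccons [simp]: "pos g (ccons e h) = step (pos g h) (psnd e) (g (ccons e h))"
  by (simp_all add: pos.simps)

text \<open>A strategy is consulted only at h and at its tails, whose codes are at most h. Therefore
  an initial segment longer than h already fixes \<open>pos f h\<close>.\<close>

lemma pos_cong: "(\<And>i. i \<le> h \<Longrightarrow> g i = g' i) \<Longrightarrow> pos g h = pos g' h"
proof (induction h rule: coded_list_induct)
  case (2 e h)
  then have "pos g h = pos g' h" using less_ccons(2)[of h e] by (metis le_trans less_imp_le)
  then show ?case using 2(2) by simp
qed simp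

definition descending :: "nat \<Rightarrow> bool" where
  "descending h \<longleftrightarrow> (\<forall>i<clen h - 1. kb (pfst (cnth h i)) (pfst (cnth h (Suc i))))"

text \<open>The tree of attempts at a strategy against a spoiler who, along with each move, descends in
  the Kleene--Brouwer order of this very tree. The recursion is legitimate since nodes mentioned in
  a history below the length of \<open>x\<close> have smaller codes than \<open>x\<close>.\<close>

function node :: "nat \<Rightarrow> bool" where
  "node x \<longleftrightarrow> (\<forall>h<clen x. descending h \<longrightarrow> (\<forall>i<clen h. node (pfst (cnth h i))) \<longrightarrow>
      (\<forall>m<clen x. good (pos (cnth x) h) m))"
  by auto
termination
proof (relation "measure id")
  fix x h i assume "h < clen x" "i < clen h"
  then show "(pfst (cnth h i), x) \<in> measure id"
    using pfst_le[of "cnth h i"] cnth_less[of i h] clen_le[of x] by simp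
qed simp

declare node.simps [simp del]

definition legal :: "nat \<Rightarrow> bool" where
  "legal h \<longleftrightarrow> descending h \<and> (\<forall>i<clen h. node (pfst (cnth h i)))"

lemma node_iff: "node x \<longleftrightarrow> (\<forall>h<clen x. legal h \<longrightarrow> (\<forall>m<clen x. good (pos (cnth x) h) m))"
  by (subst node.simps) (auto simp: legal_def)

lemma legal_0 [simp]: "legal 0"
  by (simp add: legal_def descending_def)

lemma legal_ccons [simp]:
  "legal (ccons e h) \<longleftrightarrow> node (pfst e) \<and> legal h \<and> (h \<noteq> 0 \<longrightarrow> kb (pfst e) (pfst (chd h)))"
  by (cases h rule: ccons_cases) (auto simp: legal_def descending_def All_less_Suc2)

text \<open>Two course-of-values recursions: one over histories for the position, with the code of
  the partial strategy as parameter, then one over codes for membership in the tree.\<close>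

lemma dec_node: "dec X node"
proof -
  have "comp_fun X (\<lambda>v. pos (cnth (pfst v)) (psnd v))"
  proof (rule comp_course_of_values[where
        H = "\<lambda>w n g. if n = 0 then start else step (g (ctl n)) (psnd (chd n)) (cnth w n)"])
    show "pos (cnth w) n = (if n = 0 then start else step (pos (cnth w) (ctl n)) (psnd (chd n)) (cnth w n))"
      for w n by (rule pos.simps)
    fix w n and g g' :: "nat \<Rightarrow> nat" assume "\<And>i. i < n \<Longrightarrow> g i = g' i"
    then show "(if n = 0 then start else step (g (ctl n)) (psnd (chd n)) (cnth w n)) =
        (if n = 0 then start else step (g' (ctl n)) (psnd (chd n)) (cnth w n))"
      by (cases n rule: ccons_cases) (auto simp: less_ccons)
  next
    have *: "comp_fun X (\<lambda>n. step (f n) (g n) (h n))"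
      if "comp_fun X f" "comp_fun X g" "comp_fun X h" for f g h
      using comp_apply[OF comp_step comp_pair[OF that(1) comp_pair[OF that(2,3)]]] by simp
    show "comp_fun X (\<lambda>v. if pfst (psnd v) = 0 then start
        else step (cnth (psnd (psnd v)) (pfst (psnd v) - 1 - ctl (pfst (psnd v))))
               (psnd (chd (pfst (psnd v)))) (cnth (pfst v) (pfst (psnd v))))"
      by (intro comp_basic *)
  qed
  note comp_pos = comp_apply2[OF this]
  have dec_desc: "dec X descending"
    unfolding descending_def by (intro dec_all_less dec_apply2[OF dec_kb] comp_basic)
  \<comment> \<open>The body of \<open>node\<close>, with the recursive calls read off from a
    function with values 0 and 1.\<close>
  define H where "H w n g \<longleftrightarrow> (\<forall>h<clen n. descending h \<longrightarrow> (\<forall>i<clen h. g (pfst (cnth h i)) = 1) \<longrightarrow>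
      (\<forall>m<clen n. good (pos (cnth n) h) m))" for w n :: nat and g :: "nat \<Rightarrow> nat"
  have "comp_fun X (\<lambda>v. if node (psnd v) then 1 else 0)"
  proof (rule comp_course_of_values[where F = "\<lambda>w n. if node n then 1 else 0" and
        H = "\<lambda>w n g. if H w n g then 1 else 0"])
    show "(if node n then 1 else 0) = (if H w n (\<lambda>n. if node n then 1 else 0) then 1 else (0::nat))" for w n
    proof -
      have "((if node m then 1 else 0) = (1 :: nat)) = node m" for m by simp
      then show ?thesis by (simp only: H_def node.simps[of n, symmetric])
    qed
    fix w n and g g' :: "nat \<Rightarrow> nat" assume eq: "\<And>i. i < n \<Longrightarrow> g i = g' i"
    have "g (pfst (cnth h i)) = g' (pfst (cnth h i))" if "h < clen n" "i < clen h" for h i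
      using that pfst_le[of "cnth h i"] cnth_less[of i h] clen_le[of n] by (intro eq) simp
    then show "(if H w n g then 1 else 0) = (if H w n g' then 1 else (0::nat))"
      unfolding H_def by (simp cong: conj_cong)
  next
    show "comp_fun X (\<lambda>v. if H (pfst v) (pfst (psnd v)) (\<lambda>i. cnth (psnd (psnd v)) (pfst (psnd v) - 1 - i))
        then 1 else 0)"
      unfolding H_def
      by (intro comp_basic dec_all_less dec_apply[OF dec_desc] dec_apply2[OF dec_good] comp_pos)
  qed
  from comp_apply2[OF this comp_const comp_id] show ?thesis by (simp add: dec_def)
qed

definition initial :: "(nat \<Rightarrow> nat) \<Rightarrow> nat \<Rightarrow> nat" where
  "initial f n = list_encode (map f [0..<n])"

lemma cnth_initial: "i < n \<Longrightarrow> cnth (initial f n) i = f i"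
  by (simp add: initial_def cnth_list_encode)

lemma clen_initial [simp]: "clen (initial f n) = n"
  by (simp add: initial_def clen_def)

lemma node_initial:
  "node (initial f n) \<longleftrightarrow> (\<forall>h<n. legal h \<longrightarrow> (\<forall>m<n. good (pos f h) m))"
proof -
  have "pos (cnth (initial f n)) h = pos f h" if "h < n" for h
    using that by (intro pos_cong) (simp add: cnth_initial)
  then show ?thesis by (subst node_iff) simp
qed

lemma kb_initial: "kb (initial f (Suc n)) (initial f n)"
proof -
  have "ckey (initial f (Suc n)) n < ckey (initial f n) n"
    "\<forall>j<n. ckey (initial f (Suc n)) j = ckey (initial f n) j"
    by (simp_all add: ckey_def cnth_initial)
  then show ?thesis unfolding kb_def by blast
qed

text \<open>The initial segments of a path are nodes descending forever, so the spoiler's clock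
  never runs out and the replies given by f last for every number of rounds.\<close>

lemma path_wins:
  assumes path: "\<And>n. node (initial f n)"
  shows "\<exists>b. \<forall>\<alpha>. win step good \<alpha> (step start a b)"
proof -
  \<comment> \<open>An initial segment is tested only for h and m below its length, whence the
    maximum.\<close>
  have good: "good (pos f h) m" if "legal h" for h m
    using path[of "Suc (max h m)"] that by (auto simp: node_initial less_Suc_eq_le)
  have "win step good \<alpha> (pos f h)" if "legal h" "h \<noteq> 0" "pfst (chd h) = initial f n" for \<alpha> h n
    using that
  proof (induction \<alpha> arbitrary: h n rule: less_induct)
    case (less \<alpha>)
    have "\<exists>b. win step good \<beta> (step (pos f h) a b)" if "\<beta> < \<alpha>" for \<beta> a
    proof -
      \<comment> \<open>The real move a is accompanied by the next longer initial segment, which is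
        lower in the order.\<close>
      let ?h = "ccons (prod_encode (initial f (Suc n), a)) h"
      have "legal ?h" using less(2-4) path kb_initial by simp
      from less(1)[OF that this, of "Suc n"] show ?thesis by auto
    qed
    then show ?case using good[OF less(2)] by (subst win.simps) blast
  qed
  from this[of "ccons (prod_encode (initial f 0, a)) 0" 0] show ?thesis using path by auto
qed

lemma node_take: "node (list_encode xs) \<Longrightarrow> node (list_encode (take k xs))"
proof -
  assume "node (list_encode xs)"
  moreover have "xs = map (\<lambda>i. xs ! i) [0..<length xs]" by (simp add: map_nth)
  moreover have "take k xs = map (\<lambda>i. xs ! i) [0..<min k (length xs)]"
    by (rule nth_equalityI) auto
  ultimately have "node (initial (\<lambda>i. xs ! i) (length xs))"
    "list_encode (take k xs) = initial (\<lambda>i. xs ! i) (min k (length xs))"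
    by (simp_all add: initial_def)
  then show ?thesis by (simp add: node_initial)
qed

text \<open>Ranks turn descent in the tree into descent of ordinals below \<alpha>, so a win of
  length \<alpha> answers every legal history; the chosen answers form the path.\<close>

lemma win_path:
  assumes win: "win step good \<alpha> start"
    and rk: "\<And>x. node x \<Longrightarrow> rk x < \<alpha>" "\<And>x y. node x \<Longrightarrow> node y \<Longrightarrow> kb x y \<Longrightarrow> rk x < rk y"
  shows "\<exists>f. \<forall>n. node (initial f n)"
proof -
  define reply where "reply p e = (SOME b. win step good (rk (pfst e)) (step p (psnd e) b))" for p e
  \<comment> \<open>\<open>foldr\<close> treats the oldest pair first, because histories list the
    latest pair at the head. \<open>Q h\<close> is the position under the chosen replies; defining
    it beforehand avoids a circular definition of f.\<close>
  define Q where "Q h = foldr (\<lambda>e p. step p (psnd e) (reply p e)) (list_decode h) start" for h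
  define f where "f h = reply (Q (ctl h)) (chd h)" for h
  have Q: "pos f h = Q h" for h
    by (induction h rule: coded_list_induct) (simp_all add: Q_def f_def)
  \<comment> \<open>The rank of the latest node measures the rounds still guaranteed.\<close>
  have "win step good (if h = 0 then \<alpha> else rk (pfst (chd h))) (Q h)" if "legal h" for h
    using that
  proof (induction h rule: coded_list_induct)
    case 1
    then show ?case using win by (simp add: Q_def)
  next
    case (2 e h)
    have "rk (pfst e) < (if h = 0 then \<alpha> else rk (pfst (chd h)))"
      using 2(2) rk by (cases h rule: ccons_cases) auto
    moreover have "win step good (if h = 0 then \<alpha> else rk (pfst (chd h))) (Q h)" using 2 by simp
    ultimately have "\<exists>b. win step good (rk (pfst e)) (step (Q h) (psnd e) b)"
      by (subst (asm) win.simps) blast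
    then have "win step good (rk (pfst e)) (step (Q h) (psnd e) (reply (Q h) e))"
      unfolding reply_def by (rule someI_ex)
    then show ?case by (simp add: Q_def)
  qed
  then have "good (pos f h) m" if "legal h" for h m
    using that by (subst (asm) win.simps) (simp add: Q)
  then show ?thesis using node_initial by blast
qed

text \<open>The reply b does not depend on the length. Hence the hypothesis holds again after the
  move, and the theorem can be applied at every further move.\<close>

theorem bounding:
  assumes win: "\<And>\<alpha>. \<alpha> < omega1_CK X \<Longrightarrow> win step good \<alpha> start"
  shows "\<exists>b. \<forall>\<alpha>. win step good \<alpha> (step start a b)"
proof (rule ccontr)
  assume "\<nexists>b. \<forall>\<alpha>. win step good \<alpha> (step start a b)"
  then have nopath: "\<exists>n. \<not> node (initial f n)" for f using path_wins by blast
  \<comment> \<open>\<open>Well_order\<close> expects a reflexive relation, so equality is added on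
    the nodes.\<close>
  define R where "R = {(x, y). node x \<and> node y \<and> (x = y \<or> kb x y)}"
  have field: "Field R = Collect node" unfolding R_def Field_def by auto
  have minimal: "\<exists>m\<in>Q. \<forall>q\<in>Q. q \<noteq> m \<longrightarrow> kb m q" if "Q \<subseteq> Collect node" "Q \<noteq> {}" for Q
  proof (rule kb_minimal[where U = "{xs. node (list_encode xs)}"])
    show "\<exists>n. map f [0..<n] \<notin> {xs. node (list_encode xs)}" for f
      using nopath[of f] by (simp add: initial_def)
    show "Q \<subseteq> list_encode ` {xs. node (list_encode xs)}"
    proof
      fix q assume "q \<in> Q"
      then show "q \<in> list_encode ` {xs. node (list_encode xs)}"
        using that(1) by (intro image_eqI[of _ _ "list_decode q"]) auto
    qed
  qed (use that node_take in auto)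
  have "wf (R - Id)"
  proof (rule wfI_min)
    fix x :: nat and Q assume x: "x \<in> Q"
    show "\<exists>z\<in>Q. \<forall>y. (y, z) \<in> R - Id \<longrightarrow> y \<notin> Q"
    proof (cases "Q \<inter> Collect node = {}")
      \<comment> \<open>A point outside the tree has no predecessors under R.\<close>
      case True
      then show ?thesis using x unfolding R_def by blast
    next
      case False
      then obtain m where m: "m \<in> Q" "\<And>q. q \<in> Q \<Longrightarrow> node q \<Longrightarrow> q \<noteq> m \<Longrightarrow> kb m q"
        using minimal[of "Q \<inter> Collect node"] by blast
      have "y \<notin> Q" if "(y, m) \<in> R - Id" for y
      proof
        assume "y \<in> Q"
        then have "kb m y" "kb y m" using that m(2)[of y] unfolding R_def by auto
        then show False using kb_trans kb_irrefl by blast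
      qed
      then show ?thesis using m(1) by blast
    qed
  qed
  then have "Well_order R"
    unfolding field using kb_total kb_trans kb_irrefl
    by (auto simp: well_order_on_def linear_order_on_def partial_order_on_def preorder_on_def
        refl_on_def trans_def antisym_def total_on_def R_def) blast+
  moreover have "computable_in X (prod_encode ` R)"
  proof -
    have "dec X (\<lambda>n. node (pfst n) \<and> node (psnd n) \<and> (pfst n = psnd n \<or> kb (pfst n) (psnd n)))"
      by (intro comp_basic dec_apply[OF dec_node] dec_kb)
    moreover have "node (pfst n) \<and> node (psnd n) \<and> (pfst n = psnd n \<or> kb (pfst n) (psnd n)) \<longleftrightarrow>
        n \<in> prod_encode ` R" for n
    proof -
      have "n \<in> prod_encode ` R \<longleftrightarrow> (pfst n, psnd n) \<in> R"
        by (metis encode_pfst_psnd image_iff pfst_encode psnd_encode surj_pair)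
      then show ?thesis by (simp add: R_def)
    qed
    ultimately show ?thesis by (simp add: dec_computable_in)
  qed
  ultimately obtain \<alpha> rk where \<alpha>: "\<alpha> < omega1_CK X" "\<And>x. x \<in> Field R \<Longrightarrow> rk x < \<alpha>"
    "\<And>x y. (x, y) \<in> R \<Longrightarrow> x \<noteq> y \<Longrightarrow> rk x < rk y"
    using computable_well_order_rank by metis
  have "\<exists>f. \<forall>n. node (initial f n)"
  proof (rule win_path)
    show "win step good \<alpha> start" using win \<alpha>(1) .
    show "node x \<Longrightarrow> rk x < \<alpha>" for x using \<alpha>(2) field by simp
    show "rk x < rk y" if "node x" "node y" "kb x y" for x y
      using \<alpha>(3)[of x y] that kb_irrefl unfolding R_def by blast
  qed
  then show False using nopath by blast
qed

end

section \<open>Semantics and isomorphism\<close>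

lemma rcset_cimage [simp]: "rcset (cimage f A) = f ` rcset A"
  by (rule cimage.rep_eq)

lemma sat_Disj [simp]: "sat M (Disj \<Phi>) e \<longleftrightarrow> (\<exists>f\<in>rcset \<Phi>. sat M f e)"
  and wf_Disj [simp]: "wf_fm \<tau> (Disj \<Phi>) n \<longleftrightarrow> (\<forall>f\<in>rcset \<Phi>. wf_fm \<tau> f n)"
  by simp_all

declare sat.simps(4) [simp del] wf_fm.simps(4) [simp del]

lemma holds_Conj: "countable p \<Longrightarrow> holds M (Conj (acset p)) xs \<longleftrightarrow> (\<forall>f\<in>p. holds M f xs)"
  by (simp add: Conj_def holds_def)

lemma wf_Conj: "countable p \<Longrightarrow> wf_fm \<tau> (Conj (acset p)) n \<longleftrightarrow> (\<forall>f\<in>p. wf_fm \<tau> f n)"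
  by (simp add: Conj_def)

lemma holds_Neg [simp]: "holds M (Neg f) xs \<longleftrightarrow> \<not> holds M f xs"
  by (simp add: holds_def)

lemma nth_Cons_case_nat: "(!) (a # xs) = case_nat a ((!) xs)"
  by (auto simp: fun_eq_iff split: nat.split)

lemma holds_ExF: "holds M (ExF f) xs \<longleftrightarrow> (\<exists>a\<in>carrier M. holds M f (a # xs))"
  by (simp add: holds_def nth_Cons_case_nat)

lemma eval_subst_tm: "eval_tm M e (subst_tm \<sigma> t) = eval_tm M (\<lambda>i. eval_tm M e (\<sigma> i)) t"
  by (induction t) (simp_all add: comp_def cong: map_cong)

lemma eval_up: "eval_tm M (case_nat a e) (up \<sigma> i) = case_nat a (\<lambda>i. eval_tm M e (\<sigma> i)) i"
  by (cases i) (simp_all add: up_def eval_subst_tm comp_def)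

lemma sat_subst: "sat M (subst f \<sigma>) e \<longleftrightarrow> sat M f (\<lambda>i. eval_tm M e (\<sigma> i))"
proof (induction f arbitrary: \<sigma> e)
  case (ExF f)
  have "(\<lambda>i. eval_tm M (case_nat a e) (up \<sigma> i)) = case_nat a (\<lambda>i. eval_tm M e (\<sigma> i))" for a
    by (rule ext) (rule eval_up)
  then show ?case by (simp add: ExF)
qed (simp_all add: eval_subst_tm comp_def)

lemma sat_lift [simp]: "sat M (lift f) (case_nat a e) = sat M f e"
  by (simp add: lift_def sat_subst)

lemma sat_inst: "sat M (inst f t) e = sat M f (case_nat (eval_tm M e t) e)"
proof -
  have "(\<lambda>i. eval_tm M e (case_nat t Var i)) = case_nat (eval_tm M e t) e"
    by (auto split: nat.split)
  then show ?thesis by (simp add: inst_def sat_subst)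
qed

lemma wf_tm_mono: "wf_tm \<tau> n t \<Longrightarrow> n \<le> m \<Longrightarrow> wf_tm \<tau> m t"
  by (induction t) (auto simp: list_all_iff)

lemma wf_fm_mono: "wf_fm \<tau> f n \<Longrightarrow> n \<le> m \<Longrightarrow> wf_fm \<tau> f m"
  by (induction f arbitrary: n m) (auto simp: list_all_iff intro: wf_tm_mono)

lemma wf_subst_tm: "wf_tm \<tau> n t \<Longrightarrow> (\<And>i. i < n \<Longrightarrow> wf_tm \<tau> m (\<sigma> i)) \<Longrightarrow> wf_tm \<tau> m (subst_tm \<sigma> t)"
  by (induction t) (auto simp: list_all_iff)

lemma wf_subst:
  "wf_fm \<tau> f n \<Longrightarrow> (\<And>i. i < n \<Longrightarrow> wf_tm \<tau> m (\<sigma> i)) \<Longrightarrow> wf_fm \<tau> (subst f \<sigma>) m"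
proof (induction f arbitrary: n m \<sigma>)
  case (ExF f)
  have "wf_tm \<tau> (Suc m) (up \<sigma> i)" if "i < Suc n" for i
    using that ExF(3) by (cases i) (auto simp: up_def intro!: wf_subst_tm)
  then show ?case using ExF(1,2) by auto
qed (auto simp: list_all_iff intro: wf_subst_tm)

lemma wf_lift: "wf_fm \<tau> f n \<Longrightarrow> wf_fm \<tau> (lift f) (Suc n)"
  unfolding lift_def by (rule wf_subst) simp_all

lemma eval_tm_iso:
  assumes h: "iso_map \<tau> M N h" and M: "is_struct \<tau> M"
    and e: "\<And>i. i < n \<Longrightarrow> e i \<in> carrier M \<and> e' i = h (e i)"
  shows "wf_tm \<tau> n t \<Longrightarrow> eval_tm M e t \<in> carrier M \<and> eval_tm N e' t = h (eval_tm M e t)"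
proof (induction t)
  case (Fn k ts)
  let ?xs = "map (eval_tm M e) ts"
  have ar: "fun_ar \<tau> k = Some (length ts)" and xs: "?xs \<in> tuples M (length ts)"
    and eq: "map (eval_tm N e') ts = map h ?xs"
    using Fn by (auto simp: tuples_def list_all_iff)
  have "h (funI M k ?xs) = funI N k (map h ?xs)" "funI M k ?xs \<in> carrier M"
    using h M ar xs unfolding iso_map_def is_struct_def by blast+
  then show ?case by (simp only: eval_tm.simps eq)
qed (use e in simp)

text \<open>The assignments need to correspond only below n: \<open>holds\<close> also reads
  \<open>xs ! i\<close> beyond the end of \<open>xs\<close>, where nothing is known about the
  value.\<close>

lemma sat_iso:
  assumes h: "iso_map \<tau> M N h" and M: "is_struct \<tau> M"
  shows "wf_fm \<tau> f n \<Longrightarrow> (\<And>i. i < n \<Longrightarrow> e i \<in> carrier M \<and> e' i = h (e i)) \<Longrightarrow>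
    sat M f e \<longleftrightarrow> sat N f e'"
proof (induction f arbitrary: n e e')
  case (Eq s t)
  have "inj_on h (carrier M)" using h by (simp add: iso_map_def bij_betw_def)
  then show ?case using Eq eval_tm_iso[OF h M Eq(2)] by (auto dest: inj_onD)
next
  case (Rel k ts)
  let ?xs = "map (eval_tm M e) ts"
  have "rel_ar \<tau> k = Some (length ts)" "?xs \<in> tuples M (length ts)"
    and eq: "map (eval_tm N e') ts = map h ?xs"
    using Rel eval_tm_iso[OF h M Rel(2)] by (auto simp: tuples_def list_all_iff)
  then have "relI M k ?xs \<longleftrightarrow> relI N k (map h ?xs)" using h unfolding iso_map_def by blast
  then show ?case by (simp only: sat.simps eq)
next
  case (Neg f)
  then show ?case using Neg(1)[of n e e'] by simp
next
  case (Disj \<Phi>)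
  have "sat M f e \<longleftrightarrow> sat N f e'" if "f \<in> rcset \<Phi>" for f
    using Disj(1)[OF that] Disj(2,3) that by auto
  then show ?case by auto
next
  case (ExF f)
  have img: "carrier N = h ` carrier M" using h by (simp add: iso_map_def bij_betw_def)
  have "sat M f (case_nat a e) \<longleftrightarrow> sat N f (case_nat (h a) e')" if "a \<in> carrier M" for a
  proof (rule ExF(1))
    show "wf_fm \<tau> f (Suc n)" using ExF(2) by simp
    show "case_nat a e i \<in> carrier M \<and> case_nat (h a) e' i = h (case_nat a e i)" if "i < Suc n" for i
      using that ExF(3) \<open>a \<in> carrier M\<close> by (cases i) auto
  qed
  then show ?case by (simp add: img)
qed

lemma iso_map_id: "iso_map \<tau> M M id"
  by (simp add: iso_map_def bij_betw_def)

lemma holds_iso: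
  assumes "iso_map \<tau> M N h" "is_struct \<tau> M" "wf_fm \<tau> f (length xs)" "set xs \<subseteq> carrier M"
  shows "holds N f (map h xs) \<longleftrightarrow> holds M f xs"
  unfolding holds_def
  by (subst sat_iso[OF assms(1-3), of "(!) xs"]) (use assms(4) in auto)

text \<open>The case of the identity map and n = 0, where nothing is demanded of the
  assignments.\<close>

lemma holds_sentence:
  assumes "is_struct \<tau> M" "sentence \<tau> f"
  shows "holds M f xs \<longleftrightarrow> holds M f []"
  unfolding holds_def by (rule sat_iso[OF iso_map_id assms]) simp

lemma tp_iso:
  assumes "iso_map \<tau> M N h" "is_struct \<tau> M" "set xs \<subseteq> carrier M"
  shows "tp \<tau> L N (map h xs) = tp \<tau> L M xs"
  unfolding tp_def using holds_iso[OF assms(1,2) _ assms(3)] by auto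

subsection \<open>Soundness\<close>

text \<open>Terms in a deduction may contain symbols outside the vocabulary, whose interpretation
  need not preserve the carrier.\<close>

definition totalize :: "'a struct \<Rightarrow> 'a struct" where
  "totalize M = M\<lparr>funI := \<lambda>k xs. if funI M k xs \<in> carrier M then funI M k xs
                                  else (SOME a. a \<in> carrier M)\<rparr>"

lemma carrier_totalize [simp]: "carrier (totalize M) = carrier M"
  by (simp add: totalize_def)

lemma eval_tm_totalize:
  assumes "carrier M \<noteq> {}" "\<And>i. e i \<in> carrier M"
  shows "eval_tm (totalize M) e t \<in> carrier M"
  using assms by (cases t) (auto simp: totalize_def intro: someI_ex)

lemma iso_map_totalize: "is_struct \<tau> M \<Longrightarrow> iso_map \<tau> M (totalize M) id"
  unfolding iso_map_def is_struct_def by (auto simp: totalize_def bij_betw_def)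

text \<open>\<open>ExI\<close> makes the value of an arbitrary term a witness, so it must lie in the
  carrier; this is the reason for \<open>totalize\<close>. In \<open>ExE\<close> the fresh variable
  is index 0, which matches lifting the hypotheses and putting the witness in front of e.\<close>

lemma derives_sound:
  assumes "derives \<Gamma> f" "carrier M \<noteq> {}" "\<And>i. e i \<in> carrier M" "\<And>g. g \<in> \<Gamma> \<Longrightarrow> sat (totalize M) g e"
  shows "sat (totalize M) f e"
  using assms
proof (induction arbitrary: e rule: derives.induct)
  case (ExI \<Gamma> f t)
  then show ?case using eval_tm_totalize[of M e t] by (auto simp: sat_inst)
next
  case (ExE \<Gamma> f g)
  from ExE(3)[OF ExE(5-7)] obtain a where a: "a \<in> carrier M" "sat (totalize M) f (case_nat a e)"
    by auto
  have "sat (totalize M) (lift g) (case_nat a e)"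
  proof (rule ExE(4)[OF ExE(5)])
    show "case_nat a e i \<in> carrier M" for i using a ExE(6) by (cases i) auto
    show "sat (totalize M) k (case_nat a e)" if "k \<in> insert f (lift ` \<Gamma>)" for k
      using that a ExE(7) by auto
  qed
  then show ?case by simp
next
  case (DisjE \<Phi> \<Gamma> g)
  from DisjE(4)[OF DisjE(6-8)] obtain f where "f \<in> rcset \<Phi>" "sat (totalize M) f e" by auto
  then show ?case using DisjE(5)[of f e] DisjE(6-8) by auto
next
  case (NegI f \<Gamma> g)
  then show ?case by (metis insertE sat.simps(3))
next
  case (NegE f \<Gamma> g)
  then show ?case by (metis insertE sat.simps(3))
qed (auto simp: sat_inst)

lemma holds_totalize:
  assumes "is_struct \<tau> M" "set xs \<subseteq> carrier M"
  obtains e where "\<And>i. e i \<in> carrier M"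
    "\<And>f. wf_fm \<tau> f (length xs) \<Longrightarrow> sat (totalize M) f e \<longleftrightarrow> holds M f xs"
proof -
  obtain a where a: "a \<in> carrier M" using assms(1) by (auto simp: is_struct_def)
  \<comment> \<open>The total assignment required by soundness; a fills the places that the formulas
    do not mention.\<close>
  define e where "e i = (if i < length xs then xs ! i else a)" for i
  show ?thesis
  proof (rule that)
    show "e i \<in> carrier M" for i using assms(2) a by (auto simp: e_def)
    show "sat (totalize M) f e \<longleftrightarrow> holds M f xs" if "wf_fm \<tau> f (length xs)" for f
      unfolding holds_def
      by (rule sat_iso[OF iso_map_totalize assms(1) that, symmetric])
        (use assms in \<open>auto simp: e_def\<close>)
  qed
qed

lemma derives_holds:
  assumes "is_struct \<tau> M" "set xs \<subseteq> carrier M" "derives \<Gamma> f"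
    "\<And>g. g \<in> \<Gamma> \<Longrightarrow> wf_fm \<tau> g (length xs) \<and> holds M g xs" "wf_fm \<tau> f (length xs)"
  shows "holds M f xs"
proof -
  obtain e where e: "\<And>i. e i \<in> carrier M"
    "\<And>f. wf_fm \<tau> f (length xs) \<Longrightarrow> sat (totalize M) f e \<longleftrightarrow> holds M f xs"
    using holds_totalize[OF assms(1,2)] by blast
  have "carrier M \<noteq> {}" using assms(1) by (simp add: is_struct_def)
  from derives_sound[OF assms(3) this, of e] show ?thesis using e assms(4,5) by auto
qed

lemma fin_consistent_holds:
  assumes "is_struct \<tau> M" "set xs \<subseteq> carrier M" "\<And>g. g \<in> \<Gamma> \<Longrightarrow> wf_fm \<tau> g (length xs) \<and> holds M g xs"
  shows "fin_consistent \<Gamma>"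
proof -
  obtain e where e: "\<And>i. e i \<in> carrier M"
    "\<And>f. wf_fm \<tau> f (length xs) \<Longrightarrow> sat (totalize M) f e \<longleftrightarrow> holds M f xs"
    using holds_totalize[OF assms(1,2)] by blast
  have "carrier M \<noteq> {}" using assms(1) by (simp add: is_struct_def)
  have "sat (totalize M) f e" if "derives \<Gamma> f" for f
    by (rule derives_sound[OF that \<open>carrier M \<noteq> {}\<close> e(1)]) (use e(2) assms(3) in blast)
  then show ?thesis unfolding fin_consistent_def by (metis sat.simps(3))
qed

subsection \<open>Back-and-forth systems\<close>

text \<open>Only unnested atomic formulas: these correspond to the entries of
  \<open>diagram\<close>, and a complete back-and-forth brings the values of functions into the
  tuples anyway.\<close>

definition atomic_match :: "vocabulary \<Rightarrow> 'a struct \<Rightarrow> 'a list \<Rightarrow> 'b struct \<Rightarrow> 'b list \<Rightarrow> bool" where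
  "atomic_match \<tau> M xs N ys \<longleftrightarrow> length xs = length ys \<and> set xs \<subseteq> carrier M \<and> set ys \<subseteq> carrier N \<and>
     (\<forall>i<length xs. \<forall>j<length xs. xs ! i = xs ! j \<longleftrightarrow> ys ! i = ys ! j) \<and>
     (\<forall>k idx. rel_ar \<tau> k = Some (length idx) \<and> set idx \<subseteq> {..<length xs} \<longrightarrow>
        (relI M k (map ((!) xs) idx) \<longleftrightarrow> relI N k (map ((!) ys) idx))) \<and>
     (\<forall>k idx. \<forall>i<length xs. fun_ar \<tau> k = Some (length idx) \<and> set idx \<subseteq> {..<length xs} \<longrightarrow>
        (funI M k (map ((!) xs) idx) = xs ! i \<longleftrightarrow> funI N k (map ((!) ys) idx) = ys ! i))"

lemma atomic_matchD:
  assumes "atomic_match \<tau> M xs N ys"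
  shows "i < length xs \<Longrightarrow> j < length xs \<Longrightarrow> xs ! i = xs ! j \<longleftrightarrow> ys ! i = ys ! j"
    and "rel_ar \<tau> k = Some (length idx) \<Longrightarrow> set idx \<subseteq> {..<length xs} \<Longrightarrow>
      relI M k (map ((!) xs) idx) \<longleftrightarrow> relI N k (map ((!) ys) idx)"
    and "fun_ar \<tau> k = Some (length idx) \<Longrightarrow> set idx \<subseteq> {..<length xs} \<Longrightarrow> i < length xs \<Longrightarrow>
      funI M k (map ((!) xs) idx) = xs ! i \<longleftrightarrow> funI N k (map ((!) ys) idx) = ys ! i"
  using assms unfolding atomic_match_def by blast+

text \<open>New pairs are prepended, so places shift from stage to stage; what increases is the set
  \<open>G n\<close> of pairs. Each stage handles the n-th element of both carriers, and a finite
  carrier is enumerated with repetitions.\<close>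

lemma back_and_forth:
  assumes M: "is_struct \<tau> M" and N: "is_struct \<tau> N"
    and match: "\<And>xs ys. I xs ys \<Longrightarrow> atomic_match \<tau> M xs N ys"
    and forth: "\<And>xs ys a. I xs ys \<Longrightarrow> a \<in> carrier M \<Longrightarrow> \<exists>b. I (a # xs) (b # ys)"
    and backward: "\<And>xs ys b. I xs ys \<Longrightarrow> b \<in> carrier N \<Longrightarrow> \<exists>a. I (a # xs) (b # ys)"
    and start: "I c d"
  shows "isomorphic_tuples \<tau> M c N d"
proof -
  let ?m = "from_nat_into (carrier M)" and ?n = "from_nat_into (carrier N)"
  have enum: "?m i \<in> carrier M" "?n i \<in> carrier N" for i
    using M N by (simp_all add: is_struct_def from_nat_into)
  have "\<exists>f. \<forall>n. (I (fst (f n)) (snd (f n)) \<and> (n = 0 \<longrightarrow> f n = (c, d))) \<and>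
      (set (zip (fst (f n)) (snd (f n))) \<subseteq> set (zip (fst (f (Suc n))) (snd (f (Suc n)))) \<and>
       ?m n \<in> set (fst (f (Suc n))) \<and> ?n n \<in> set (snd (f (Suc n))))"
  proof (rule dependent_nat_choice)
    show "\<exists>x. I (fst x) (snd x) \<and> (0 = (0::nat) \<longrightarrow> x = (c, d))" using start by auto
    fix x :: "'a list \<times> 'b list" and n :: nat
    assume x: "I (fst x) (snd x) \<and> (n = 0 \<longrightarrow> x = (c, d))"
    from x forth enum(1) obtain b where "I (?m n # fst x) (b # snd x)" by blast
    with backward enum(2) obtain a where "I (a # ?m n # fst x) (?n n # b # snd x)" by blast
    then show "\<exists>y. (I (fst y) (snd y) \<and> (Suc n = 0 \<longrightarrow> y = (c, d))) \<and>
        (set (zip (fst x) (snd x)) \<subseteq> set (zip (fst y) (snd y)) \<and>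
         ?m n \<in> set (fst y) \<and> ?n n \<in> set (snd y))"
      by (intro exI[of _ "(a # ?m n # fst x, ?n n # b # snd x)"]) auto
  qed
  then obtain f where f: "\<And>n. I (fst (f n)) (snd (f n))" "f 0 = (c, d)"
    "\<And>n. set (zip (fst (f n)) (snd (f n))) \<subseteq> set (zip (fst (f (Suc n))) (snd (f (Suc n))))"
    "\<And>n. ?m n \<in> set (fst (f (Suc n)))" "\<And>n. ?n n \<in> set (snd (f (Suc n)))"
    by blast
  define G where "G n = set (zip (fst (f n)) (snd (f n)))" for n
  have G_mono: "G i \<subseteq> G j" if "i \<le> j" for i j
    by (rule lift_Suc_mono_le[OF _ that]) (use f(3) in \<open>simp add: G_def\<close>)
  have len: "length (fst (f n)) = length (snd (f n))" for n
    using match[OF f(1)[of n]] by (simp add: atomic_match_def)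
  have G_eq: "a = a' \<longleftrightarrow> b = b'" if "(a, b) \<in> G i" "(a', b') \<in> G j" for a a' b b' i j
  proof -
    have "(a, b) \<in> G (max i j)" "(a', b') \<in> G (max i j)"
      using that G_mono[of i "max i j"] G_mono[of j "max i j"] by auto
    then obtain k l where "k < length (fst (f (max i j)))" "l < length (fst (f (max i j)))"
      "fst (f (max i j)) ! k = a" "snd (f (max i j)) ! k = b"
      "fst (f (max i j)) ! l = a'" "snd (f (max i j)) ! l = b'"
      unfolding G_def in_set_zip by auto
    then show ?thesis using atomic_matchD(1)[OF match[OF f(1)[of "max i j"]], of k l] by simp
  qed
  have G_total: "\<exists>n b. (a, b) \<in> G n" if a: "a \<in> carrier M" for a
  proof -
    obtain n where "a = ?m n" using from_nat_into_surj[OF _ a] M unfolding is_struct_def by metis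
    then obtain b where "(a, b) \<in> G (Suc n)"
      using in_set_impl_in_set_zip1[OF len[of "Suc n"], of a] f(4)[of n] unfolding G_def by blast
    then show ?thesis by blast
  qed
  have G_surj: "\<exists>n a. (a, b) \<in> G n" if b: "b \<in> carrier N" for b
  proof -
    obtain n where "b = ?n n" using from_nat_into_surj[OF _ b] N unfolding is_struct_def by metis
    then obtain a where "(a, b) \<in> G (Suc n)"
      using in_set_impl_in_set_zip2[OF len[of "Suc n"], of b] f(5)[of n] unfolding G_def by blast
    then show ?thesis by blast
  qed
  have G_carrier: "a \<in> carrier M \<and> b \<in> carrier N" if "(a, b) \<in> G n" for a b n
    using that match[OF f(1)[of n]] unfolding G_def atomic_match_def
    by (meson set_zip_leftD set_zip_rightD subsetD)
  define h where "h a = (SOME b. \<exists>n. (a, b) \<in> G n)" for a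
  have h: "\<exists>n. (a, h a) \<in> G n" if "a \<in> carrier M" for a
    unfolding h_def using G_total[OF that] by (rule_tac someI_ex) blast
  have hG: "h a = b" if "(a, b) \<in> G n" for a b n
    using h[of a] G_carrier[OF that] G_eq[OF that] by blast
  have bij: "bij_betw h (carrier M) (carrier N)"
    unfolding bij_betw_def
  proof (intro conjI inj_onI set_eqI iffI)
    show "a = a'" if "a \<in> carrier M" "a' \<in> carrier M" "h a = h a'" for a a'
      using h[OF that(1)] h[OF that(2)] that(3) G_eq by metis
    show "b \<in> carrier N" if "b \<in> h ` carrier M" for b using that h G_carrier by blast
    show "b \<in> h ` carrier M" if "b \<in> carrier N" for b
      using G_surj[OF that] hG G_carrier by (metis imageI)
  qed
  \<comment> \<open>Finitely many elements and their images occur together at one stage, at common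
    places \<open>idx\<close>; this is the form that \<open>atomic_match\<close> speaks
    about.\<close>
  have idx: "\<exists>n idx. length idx = length zs \<and> set idx \<subseteq> {..<length (fst (f n))} \<and>
      zs = map ((!) (fst (f n))) idx \<and> map h zs = map ((!) (snd (f n))) idx"
    if "set zs \<subseteq> carrier M" for zs
  proof -
    have "\<exists>n. \<forall>z\<in>set zs. (z, h z) \<in> G n" using that
    proof (induction zs)
      case (Cons z zs)
      then obtain n m where "\<forall>z\<in>set zs. (z, h z) \<in> G n" "(z, h z) \<in> G m" using h[of z] by auto
      then have "\<forall>y\<in>set (z # zs). (y, h y) \<in> G (max n m)"
        using G_mono[of n "max n m"] G_mono[of m "max n m"] by auto
      then show ?case by blast
    qed simp
    then obtain n where "\<forall>z\<in>set zs. (z, h z) \<in> G n" by blast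
    then have "\<forall>z\<in>set zs. \<exists>i. i < length (fst (f n)) \<and> fst (f n) ! i = z \<and> snd (f n) ! i = h z"
      unfolding G_def in_set_zip by auto
    then obtain i where i: "\<forall>z\<in>set zs. i z < length (fst (f n)) \<and> fst (f n) ! i z = z \<and>
        snd (f n) ! i z = h z" by metis
    have "length (map i zs) = length zs \<and> set (map i zs) \<subseteq> {..<length (fst (f n))} \<and>
        zs = map ((!) (fst (f n))) (map i zs) \<and> map h zs = map ((!) (snd (f n))) (map i zs)"
      using i by (auto simp: map_idI comp_def)
    then show ?thesis by blast
  qed
  have "iso_map \<tau> M N h"
    unfolding iso_map_def
  proof (intro conjI allI impI ballI bij)
    fix k n zs assume ar: "rel_ar \<tau> k = Some n" and zs: "zs \<in> tuples M n"
    from zs have "set zs \<subseteq> carrier M" and n: "length zs = n" by (simp_all add: tuples_def)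
    from idx[OF this(1)] obtain s idx where "length idx = length zs" "set idx \<subseteq> {..<length (fst (f s))}"
      and eq: "zs = map ((!) (fst (f s))) idx" "map h zs = map ((!) (snd (f s))) idx" by blast
    then show "relI M k zs \<longleftrightarrow> relI N k (map h zs)"
      using atomic_matchD(2)[OF match[OF f(1)[of s]], of k idx] ar n by metis
  next
    fix k n zs assume ar: "fun_ar \<tau> k = Some n" and zs: "zs \<in> tuples M n"
    let ?z = "funI M k zs"
    have z: "?z \<in> carrier M" using M ar zs by (auto simp: is_struct_def)
    \<comment> \<open>The value is put in front of its arguments, so that one stage contains
      both.\<close>
    with zs have "set (?z # zs) \<subseteq> carrier M" and n: "length zs = n" by (simp_all add: tuples_def)
    from idx[OF this(1)] obtain s idx where s: "length idx = length (?z # zs)"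
      "set idx \<subseteq> {..<length (fst (f s))}"
      "?z # zs = map ((!) (fst (f s))) idx" "map h (?z # zs) = map ((!) (snd (f s))) idx"
      by (elim exE conjE) (rule that)
    then obtain i idx' where i: "idx = i # idx'" by (cases idx) auto
    have eq: "?z = fst (f s) ! i" "zs = map ((!) (fst (f s))) idx'"
      using s(3) unfolding i list.map list.inject by (rule conjunct1, rule conjunct2)
    have eq': "h ?z = snd (f s) ! i" "map h zs = map ((!) (snd (f s))) idx'"
      using s(4) unfolding i list.map list.inject by (rule conjunct1, rule conjunct2)
    have "i < length (fst (f s))" "fun_ar \<tau> k = Some (length idx')" "set idx' \<subseteq> {..<length (fst (f s))}"
      using s(1,2) i ar n by auto
    then have "funI M k (map ((!) (fst (f s))) idx') = fst (f s) ! i \<longleftrightarrow>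
        funI N k (map ((!) (snd (f s))) idx') = snd (f s) ! i"
      using atomic_matchD(3)[OF match[OF f(1)[of s]]] by blast
    then show "h ?z = funI N k (map h zs)" using eq eq' by metis
  qed
  moreover have "map h c = d"
  proof (rule nth_equalityI)
    show "length (map h c) = length d" using len[of 0] f(2) by simp
    fix i assume "i < length (map h c)"
    then have "(c ! i, d ! i) \<in> G 0"
      using f(2) len[of 0] unfolding G_def by (auto simp: in_set_zip)
    then show "map h c ! i = d ! i" using hG \<open>i < length (map h c)\<close> by simp
  qed
  ultimately show ?thesis unfolding isomorphic_tuples_def by blast
qed

section \<open>Types over nodes\<close>

text \<open>The properties of nodes on which the work with types rests; they pass to unions at limit
  levels directly.\<close>

definition theory_in :: "vocabulary \<Rightarrow> node \<Rightarrow> bool" where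
  "theory_in \<tau> P \<longleftrightarrow> fragment \<tau> (fst P) \<and> snd P \<subseteq> {f \<in> fst P. sentence \<tau> f} \<and>
     (\<forall>f\<in>fst P. sentence \<tau> f \<longrightarrow> f \<in> snd P \<or> Neg f \<in> snd P)"

lemma completion_theory_in: "completion \<tau> S P \<Longrightarrow> theory_in \<tau> P"
  by (auto simp: completion_def omega_complete_def theory_in_def)

lemma fragmentD:
  assumes "fragment \<tau> L"
  shows "countable L" "f \<in> L \<Longrightarrow> Neg f \<in> L" "f \<in> L \<Longrightarrow> ExF f \<in> L" "f \<in> L \<Longrightarrow> lift f \<in> L"
    "wf_fm \<tau> (Eq s t) n \<Longrightarrow> Eq s t \<in> L" "wf_fm \<tau> (Rel k ts) n \<Longrightarrow> Rel k ts \<in> L"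
proof -
  have F: "countable L" "\<forall>f\<in>L. Neg f \<in> L" "\<forall>f\<in>L. ExF f \<in> L"
    "\<forall>s t n. wf_fm \<tau> (Eq s t) n \<longrightarrow> Eq s t \<in> L" "\<forall>k ts n. wf_fm \<tau> (Rel k ts) n \<longrightarrow> Rel k ts \<in> L"
    "\<forall>f\<in>L. \<forall>\<sigma>. (\<forall>i. \<exists>n. wf_tm \<tau> n (\<sigma> i)) \<longrightarrow> subst f \<sigma> \<in> L"
    using assms unfolding fragment_def by - (elim conjE, assumption)+
  have "wf_tm \<tau> (Suc (Suc i)) ((Var \<circ> Suc) i)" for i by simp
  then have "\<forall>i. \<exists>n. wf_tm \<tau> n ((Var \<circ> Suc) i)" by blast
  then show "f \<in> L \<Longrightarrow> lift f \<in> L" using F(6) unfolding lift_def by simp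
  show "countable L" "f \<in> L \<Longrightarrow> Neg f \<in> L" "f \<in> L \<Longrightarrow> ExF f \<in> L"
    using F(1-3) by simp_all
  show "wf_fm \<tau> (Eq s t) n \<Longrightarrow> Eq s t \<in> L" "wf_fm \<tau> (Rel k ts) n \<Longrightarrow> Rel k ts \<in> L"
    using F(4,5) by blast+
qed

text \<open>Finite disjunctions are the critical closure condition: their members come from finitely
  many levels, hence from one. The other conditions concern a single formula at a time.\<close>

lemma fragment_Union:
  assumes lim: "is_limit \<delta>" and frag: "\<And>\<gamma>. \<gamma> < \<delta> \<Longrightarrow> fragment \<tau> (L \<gamma>)"
    and mono: "\<And>\<beta> \<gamma>. \<beta> < \<gamma> \<Longrightarrow> \<gamma> < \<delta> \<Longrightarrow> L \<beta> \<subseteq> L \<gamma>"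
  shows "fragment \<tau> (\<Union>\<gamma>\<in>{\<gamma>. \<gamma> < \<delta>}. L \<gamma>)"
proof -
  have pos: "0 < \<delta>" using lim by (simp add: is_limit_def)
  have fin: "Disj \<Phi> \<in> (\<Union>\<gamma>\<in>{\<gamma>. \<gamma> < \<delta>}. L \<gamma>)"
    if \<Phi>: "finite (rcset \<Phi>)" "rcset \<Phi> \<subseteq> (\<Union>\<gamma>\<in>{\<gamma>. \<gamma> < \<delta>}. L \<gamma>)" for \<Phi>
  proof -
    have "\<forall>f\<in>rcset \<Phi>. \<exists>\<gamma>. \<gamma> < \<delta> \<and> f \<in> L \<gamma>" using \<Phi>(2) by blast
    then obtain g where g: "\<forall>f\<in>rcset \<Phi>. g f < \<delta> \<and> f \<in> L (g f)" by metis
    \<comment> \<open>The 0 provides a level for the empty disjunction.\<close>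
    define \<gamma> where "\<gamma> = Max (insert 0 (g ` rcset \<Phi>))"
    have "\<gamma> < \<delta>" unfolding \<gamma>_def using \<Phi>(1) g pos by simp
    moreover have "rcset \<Phi> \<subseteq> L \<gamma>"
    proof
      fix f assume f: "f \<in> rcset \<Phi>"
      then have "g f \<le> \<gamma>" unfolding \<gamma>_def using \<Phi>(1) by simp
      then show "f \<in> L \<gamma>" using g f mono[of "g f" \<gamma>] \<open>\<gamma> < \<delta>\<close> by (auto simp: order.order_iff_strict)
    qed
    ultimately show ?thesis using frag[of \<gamma>] \<Phi>(1) unfolding fragment_def by blast
  qed
  have cnt: "countable (\<Union>\<gamma>\<in>{\<gamma>. \<gamma> < \<delta>}. L \<gamma>)"
    using frag fragmentD(1) countable_below_omega1 by (intro countable_UN) auto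
  have F: "\<And>\<gamma>. \<gamma> < \<delta> \<Longrightarrow> \<forall>f\<in>L \<gamma>. \<exists>n. wf_fm \<tau> f n"
    "\<And>\<gamma>. \<gamma> < \<delta> \<Longrightarrow> \<forall>s t n. wf_fm \<tau> (Eq s t) n \<longrightarrow> Eq s t \<in> L \<gamma>"
    "\<And>\<gamma>. \<gamma> < \<delta> \<Longrightarrow> \<forall>k ts n. wf_fm \<tau> (Rel k ts) n \<longrightarrow> Rel k ts \<in> L \<gamma>"
    "\<And>\<gamma>. \<gamma> < \<delta> \<Longrightarrow> \<forall>f. Neg f \<in> L \<gamma> \<longrightarrow> f \<in> L \<gamma>"
    "\<And>\<gamma>. \<gamma> < \<delta> \<Longrightarrow> \<forall>\<Phi>. Disj \<Phi> \<in> L \<gamma> \<longrightarrow> rcset \<Phi> \<subseteq> L \<gamma>"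
    "\<And>\<gamma>. \<gamma> < \<delta> \<Longrightarrow> \<forall>f. ExF f \<in> L \<gamma> \<longrightarrow> f \<in> L \<gamma>"
    "\<And>\<gamma>. \<gamma> < \<delta> \<Longrightarrow> \<forall>f\<in>L \<gamma>. \<forall>\<sigma>. (\<forall>i. \<exists>n. wf_tm \<tau> n (\<sigma> i)) \<longrightarrow> subst f \<sigma> \<in> L \<gamma>"
    "\<And>\<gamma>. \<gamma> < \<delta> \<Longrightarrow> \<forall>f\<in>L \<gamma>. Neg f \<in> L \<gamma>"
    "\<And>\<gamma>. \<gamma> < \<delta> \<Longrightarrow> \<forall>f\<in>L \<gamma>. ExF f \<in> L \<gamma>"
    using frag unfolding fragment_def by - (drule_tac x = \<gamma> in meta_spec, drule meta_mp, assumption, elim conjE, assumption)+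
  show ?thesis
    unfolding fragment_def[of \<tau> "\<Union>\<gamma>\<in>{\<gamma>. \<gamma> < \<delta>}. L \<gamma>"]
  proof (intro conjI)
    show "\<forall>\<Phi>. finite (rcset \<Phi>) \<and> rcset \<Phi> \<subseteq> (\<Union>\<gamma>\<in>{\<gamma>. \<gamma> < \<delta>}. L \<gamma>) \<longrightarrow>
        Disj \<Phi> \<in> (\<Union>\<gamma>\<in>{\<gamma>. \<gamma> < \<delta>}. L \<gamma>)" using fin by blast
    show "\<forall>f\<in>(\<Union>\<gamma>\<in>{\<gamma>. \<gamma> < \<delta>}. L \<gamma>). \<exists>n. wf_fm \<tau> f n" using F(1) by blast
    show "\<forall>s t n. wf_fm \<tau> (Eq s t) n \<longrightarrow> Eq s t \<in> (\<Union>\<gamma>\<in>{\<gamma>. \<gamma> < \<delta>}. L \<gamma>)" using F(2) pos by blast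
    show "\<forall>k ts n. wf_fm \<tau> (Rel k ts) n \<longrightarrow> Rel k ts \<in> (\<Union>\<gamma>\<in>{\<gamma>. \<gamma> < \<delta>}. L \<gamma>)" using F(3) pos by blast
  qed (use cnt in blast, use F(4) in blast, use F(5) in blast, use F(6) in blast, use F(7) in blast, use F(8) in blast,
      use F(9) in blast)
qed

lemma node_theory_in: "node_on_level \<tau> \<phi> \<delta> P \<Longrightarrow> theory_in \<tau> P"
proof (induction rule: node_on_level.induct)
  case (level_limit \<delta> P)
  have "fragment \<tau> (\<Union>\<gamma>\<in>{\<gamma>. \<gamma> < \<delta>}. fst (P \<gamma>))"
    using level_limit by (intro fragment_Union) (auto simp: theory_in_def)
  then show ?case using level_limit.IH unfolding theory_in_def by (simp, blast)
qed (auto simp: child_def intro: completion_theory_in)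

lemma next_language:
  "fst P \<subseteq> next_language \<tau> P"
  "is_type \<tau> (fst P) (snd P) n p \<Longrightarrow> \<not> principal (snd P) p \<Longrightarrow> Conj (acset p) \<in> next_language \<tau> P"
  unfolding next_language_def least_fragment_def by blast+

lemma countable_tp: "fragment \<tau> L \<Longrightarrow> countable (tp \<tau> L M xs)"
  by (rule countable_subset[of _ L]) (auto simp: tp_def dest: fragmentD(1))

section \<open>Complete types: comparison, transfer and realization\<close>

lemma tp_length:
  assumes "fragment \<tau> L" "tp \<tau> L M xs = tp \<tau> L N ys"
  shows "length xs = length ys"
proof -
  have "Eq (Var i) (Var i) \<in> L" for i
    using fragmentD(5)[OF assms(1), of "Var i" "Var i" "Suc i"] by simp
  then have "Eq (Var i) (Var i) \<in> tp \<tau> L M xs \<longleftrightarrow> i < length xs"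
    "Eq (Var i) (Var i) \<in> tp \<tau> L N ys \<longleftrightarrow> i < length ys" for i
    by (simp_all add: tp_def holds_def)
  then have "i < length xs \<longleftrightarrow> i < length ys" for i using assms(2) by simp
  then show ?thesis by (metis linorder_neqE_nat less_irrefl)
qed

text \<open>One inclusion is enough, because the fragment contains negations.\<close>

lemma tp_eqI:
  assumes L: "fragment \<tau> L" and len: "length xs = length ys"
    and holds: "\<And>f. f \<in> tp \<tau> L M xs \<Longrightarrow> holds N f ys"
  shows "tp \<tau> L M xs = tp \<tau> L N ys"
proof -
  have "holds M f xs \<longleftrightarrow> holds N f ys" if "f \<in> L" "wf_fm \<tau> f (length xs)" for f
    using holds[of f] holds[of "Neg f"] fragmentD(2)[OF L] that unfolding tp_def by auto
  then show ?thesis unfolding tp_def using len by auto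
qed

lemma tp_antimono:
  assumes "L \<subseteq> L'" "fragment \<tau> L'" "tp \<tau> L' M xs = tp \<tau> L' N ys"
  shows "tp \<tau> L M xs = tp \<tau> L N ys"
proof -
  have "tp \<tau> L A zs = tp \<tau> L' A zs \<inter> L" for A :: "'c struct" and zs
    using assms(1) by (auto simp: tp_def)
  moreover have "tp \<tau> L A zs = tp \<tau> L' A zs \<inter> L" for A :: "'d struct" and zs
    using assms(1) by (auto simp: tp_def)
  ultimately show ?thesis using assms(3) by metis
qed

lemma tp_tail:
  assumes L: "fragment \<tau> L" and eq: "tp \<tau> L M (a # xs) = tp \<tau> L N (b # ys)"
  shows "tp \<tau> L M xs = tp \<tau> L N ys"
proof (rule tp_eqI[OF L])
  show "length xs = length ys" using tp_length[OF L eq] by simp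
  fix f assume "f \<in> tp \<tau> L M xs"
  then have "lift f \<in> tp \<tau> L M (a # xs)"
    using fragmentD(4)[OF L] by (auto simp: tp_def wf_lift holds_def nth_Cons_case_nat)
  then show "holds N f ys" unfolding eq by (simp add: tp_def holds_def nth_Cons_case_nat)
qed

lemma tp_atomic_match:
  assumes L: "fragment \<tau> L" and eq: "tp \<tau> L M xs = tp \<tau> L N ys"
    and xs: "set xs \<subseteq> carrier M" and ys: "set ys \<subseteq> carrier N"
  shows "atomic_match \<tau> M xs N ys"
proof -
  have len: "length xs = length ys" using tp_length[OF L eq] .
  have iff: "holds M f xs \<longleftrightarrow> holds N f ys" if "f \<in> L" "wf_fm \<tau> f (length xs)" for f
    using eq that len unfolding tp_def by (auto simp: set_eq_iff)
  have "xs ! i = xs ! j \<longleftrightarrow> ys ! i = ys ! j" if "i < length xs" "j < length xs" for i j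
  proof -
    have wf: "wf_fm \<tau> (Eq (Var i) (Var j)) (length xs)" using that by simp
    from iff[OF fragmentD(5)[OF L wf] wf] show ?thesis by (simp add: holds_def)
  qed
  moreover have "relI M k (map ((!) xs) idx) \<longleftrightarrow> relI N k (map ((!) ys) idx)"
    if "rel_ar \<tau> k = Some (length idx)" "set idx \<subseteq> {..<length xs}" for k idx
  proof -
    have wf: "wf_fm \<tau> (Rel k (map Var idx)) (length xs)" using that by (auto simp: list_all_iff)
    from iff[OF fragmentD(6)[OF L wf] wf] show ?thesis by (simp add: holds_def comp_def)
  qed
  moreover have "funI M k (map ((!) xs) idx) = xs ! i \<longleftrightarrow> funI N k (map ((!) ys) idx) = ys ! i"
    if "fun_ar \<tau> k = Some (length idx)" "set idx \<subseteq> {..<length xs}" "i < length xs" for k idx i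
  proof -
    have wf: "wf_fm \<tau> (Eq (Fn k (map Var idx)) (Var i)) (length xs)"
      using that by (auto simp: list_all_iff)
    from iff[OF fragmentD(5)[OF L wf] wf] show ?thesis by (simp add: holds_def comp_def)
  qed
  ultimately show ?thesis unfolding atomic_match_def using len xs ys by blast
qed

lemma tp_is_type:
  assumes P: "theory_in \<tau> P" and M: "models \<tau> M (snd P)" and xs: "set xs \<subseteq> carrier M"
  shows "is_type \<tau> (fst P) (snd P) (length xs) (tp \<tau> (fst P) M xs)"
proof -
  let ?p = "tp \<tau> (fst P) M xs"
  have str: "is_struct \<tau> M" using M by (simp add: models_def)
  have "wf_fm \<tau> g (length xs) \<and> holds M g xs" if "g \<in> snd P \<union> ?p" for g
  proof (cases "g \<in> snd P")
    case True
    then have "sentence \<tau> g" "holds M g []" using P M by (auto simp: theory_in_def models_def)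
    then show ?thesis using holds_sentence[OF str] wf_fm_mono by blast
  qed (use that in \<open>simp add: tp_def\<close>)
  then have "fin_consistent (snd P \<union> ?p)" by (rule fin_consistent_holds[OF str xs])
  moreover have "q = ?p" if q: "?p \<subseteq> q" "q \<subseteq> {f \<in> fst P. wf_fm \<tau> f (length xs)}"
    "fin_consistent (snd P \<union> q)" for q
  proof -
    have "f \<in> ?p" if "f \<in> q" for f
    proof (rule ccontr)
      assume "f \<notin> ?p"
      then have "Neg f \<in> ?p" using that q(2) P fragmentD(2) by (auto simp: tp_def theory_in_def)
      then have "derives (snd P \<union> q) f" "derives (snd P \<union> q) (Neg f)"
        using that q(1) by (auto intro: derives.Hyp)
      then show False using q(3) by (auto simp: fin_consistent_def)
    qed
    then show ?thesis using q(1) by blast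
  qed
  ultimately show ?thesis unfolding is_type_def by (auto simp: tp_def)
qed

text \<open>Soundness carries the whole type along with its generator, even to a tuple of another
  model.\<close>

lemma principal_tp_eq:
  assumes P: "theory_in \<tau> P" and N: "models \<tau> N (snd P)" and ys: "set ys \<subseteq> carrier N"
    and len: "length xs = length ys"
    and g: "g \<in> tp \<tau> (fst P) M xs" "\<And>f. f \<in> tp \<tau> (fst P) M xs \<Longrightarrow> derives (insert g (snd P)) f"
    and "holds N g ys"
  shows "tp \<tau> (fst P) M xs = tp \<tau> (fst P) N ys"
proof (rule tp_eqI[OF _ len])
  show "fragment \<tau> (fst P)" using P by (simp add: theory_in_def)
  have str: "is_struct \<tau> N" using N by (simp add: models_def)
  fix f assume f: "f \<in> tp \<tau> (fst P) M xs"
  show "holds N f ys"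
  proof (rule derives_holds[OF str ys g(2)[OF f]])
    show "wf_fm \<tau> f (length ys)" using f len by (simp add: tp_def)
    fix k assume k: "k \<in> insert g (snd P)"
    show "wf_fm \<tau> k (length ys) \<and> holds N k ys"
    proof (cases "k \<in> snd P")
      case True
      then have "sentence \<tau> k" "holds N k []" using P N by (auto simp: theory_in_def models_def)
      then show ?thesis using holds_sentence[OF str] wf_fm_mono by blast
    qed (use k assms(6) \<open>holds N g ys\<close> g len in \<open>auto simp: tp_def\<close>)
  qed
qed

text \<open>The next language expresses that the type of \<open>a # xs\<close> is realized over \<open>xs\<close>: by its conjunction
  if the type is non-principal, by a generator otherwise.\<close>

lemma tp_forth:
  assumes P: "theory_in \<tau> P" and L': "fragment \<tau> L'" "next_language \<tau> P \<subseteq> L'"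
    and M: "models \<tau> M (snd P)" and N: "models \<tau> N (snd P)"
    and xs: "set xs \<subseteq> carrier M" and ys: "set ys \<subseteq> carrier N"
    and eq: "tp \<tau> L' M xs = tp \<tau> L' N ys" and a: "a \<in> carrier M"
  shows "\<exists>b\<in>carrier N. tp \<tau> (fst P) M (a # xs) = tp \<tau> (fst P) N (b # ys)"
proof -
  let ?p = "tp \<tau> (fst P) M (a # xs)"
  have L: "fragment \<tau> (fst P)" using P by (simp add: theory_in_def)
  have len: "length xs = length ys" using tp_length[OF L'(1) eq] .
  have transfer: "\<exists>b\<in>carrier N. holds N g (b # ys)"
    if "g \<in> L'" "wf_fm \<tau> g (Suc (length xs))" "holds M g (a # xs)" for g
  proof -
    have "ExF g \<in> tp \<tau> L' M xs"
      using that a fragmentD(3)[OF L'(1)] by (auto simp: tp_def holds_ExF)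
    then show ?thesis unfolding eq by (simp add: tp_def holds_ExF)
  qed
  show ?thesis
  proof (cases "principal (snd P) ?p")
    case True
    then obtain g where g: "g \<in> ?p" "\<And>f. f \<in> ?p \<Longrightarrow> derives (insert g (snd P)) f"
      unfolding principal_def by blast
    then obtain b where b: "b \<in> carrier N" "holds N g (b # ys)"
      using transfer[of g] next_language(1)[of P \<tau>] L'(2) by (auto simp: tp_def)
    have "?p = tp \<tau> (fst P) N (b # ys)"
      by (rule principal_tp_eq[OF P N _ _ g b(2)]) (use b ys len in auto)
    then show ?thesis using b(1) by blast
  next
    case False
    have "is_type \<tau> (fst P) (snd P) (Suc (length xs)) ?p"
      using tp_is_type[OF P M, of "a # xs"] xs a by simp
    then have "Conj (acset ?p) \<in> L'" using next_language(2) False L'(2) by blast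
    moreover have "countable ?p" using countable_tp[OF L] .
    then have "wf_fm \<tau> (Conj (acset ?p)) (Suc (length xs))" "holds M (Conj (acset ?p)) (a # xs)"
      by (simp_all add: wf_Conj holds_Conj tp_def)
    ultimately obtain b where b: "b \<in> carrier N" "holds N (Conj (acset ?p)) (b # ys)"
      using transfer by blast
    have "?p = tp \<tau> (fst P) N (b # ys)"
      by (rule tp_eqI[OF L]) (use b len \<open>countable ?p\<close> in \<open>auto simp: holds_Conj\<close>)
    then show ?thesis using b(1) by blast
  qed
qed

lemma holds_ExF_iterate:
  "holds M ((ExF ^^ n) g) ys \<longleftrightarrow> (\<exists>xs\<in>tuples M n. holds M g (xs @ ys))"
proof (induction n arbitrary: ys)
  case (Suc n)
  have "holds M ((ExF ^^ Suc n) g) ys \<longleftrightarrow>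
      (\<exists>a\<in>carrier M. \<exists>xs\<in>tuples M n. holds M g ((xs @ [a]) @ ys))"
    by (simp add: holds_ExF Suc)
  also have "\<dots> \<longleftrightarrow> (\<exists>xs\<in>tuples M (Suc n). holds M g (xs @ ys))"
  proof (intro iffI; elim bexE)
    fix a xs assume "a \<in> carrier M" "xs \<in> tuples M n" "holds M g ((xs @ [a]) @ ys)"
    then show "\<exists>xs\<in>tuples M (Suc n). holds M g (xs @ ys)"
      by (intro bexI[of _ "xs @ [a]"]) (auto simp: tuples_def)
  next
    fix xs assume xs: "xs \<in> tuples M (Suc n)" "holds M g (xs @ ys)"
    then have "xs = butlast xs @ [last xs]" "last xs \<in> carrier M" "butlast xs \<in> tuples M n"
      by (cases xs rule: rev_cases; auto simp: tuples_def)+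
    then show "\<exists>a\<in>carrier M. \<exists>xs\<in>tuples M n. holds M g ((xs @ [a]) @ ys)" using xs(2) by metis
  qed
  finally show ?case .
qed (simp add: tuples_def)

lemma wf_ExF_iterate: "wf_fm \<tau> ((ExF ^^ n) g) m \<longleftrightarrow> wf_fm \<tau> g (n + m)"
  by (induction n arbitrary: m) simp_all

text \<open>If g generates the type, the sentence stating that g is realized holds in M; the theory
  decides it, so N satisfies it. Otherwise the trace decides, and \<open>xs \<noteq> []\<close>
  matches the arity bound in \<open>nonprincipal_types\<close>.\<close>

lemma tp_realized:
  assumes P: "theory_in \<tau> P" and M: "models \<tau> M (snd P)" and N: "models \<tau> N (snd P)"
    and trace: "trace \<tau> P M \<subseteq> trace \<tau> P N"
    and xs: "set xs \<subseteq> carrier M" "xs \<noteq> []"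
  shows "\<exists>zs. set zs \<subseteq> carrier N \<and> tp \<tau> (fst P) M xs = tp \<tau> (fst P) N zs"
proof -
  let ?p = "tp \<tau> (fst P) M xs" and ?n = "length xs"
  have L: "fragment \<tau> (fst P)" using P by (simp add: theory_in_def)
  show ?thesis
  proof (cases "principal (snd P) ?p")
    case True
    then obtain g where g: "g \<in> ?p" "\<And>f. f \<in> ?p \<Longrightarrow> derives (insert g (snd P)) f"
      unfolding principal_def by blast
    let ?f = "(ExF ^^ ?n) g"
    have "?f \<in> fst P"
    proof -
      have "g \<in> fst P" using g(1) by (simp add: tp_def)
      then have "(ExF ^^ n) g \<in> fst P" for n by (induction n) (auto intro: fragmentD(3)[OF L])
      then show ?thesis .
    qed
    moreover have "sentence \<tau> ?f" using g(1) by (simp add: wf_ExF_iterate tp_def)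
    moreover have "holds M ?f []"
      using g(1) xs(1) by (auto simp: holds_ExF_iterate tp_def tuples_def)
    then have "Neg ?f \<notin> snd P" using M by (auto simp: models_def)
    ultimately have "?f \<in> snd P" using P by (simp add: theory_in_def) blast
    then have "holds N ?f []" using N by (simp add: models_def)
    then obtain zs where zs: "zs \<in> tuples N ?n" "holds N g zs" by (auto simp: holds_ExF_iterate)
    then have "?p = tp \<tau> (fst P) N zs"
      by (intro principal_tp_eq[OF P N _ _ g zs(2)]) (auto simp: tuples_def)
    then show ?thesis using zs(1) by (auto simp: tuples_def)
  next
    case False
    have "(?n, ?p) \<in> trace \<tau> P M"
      unfolding trace_def nonprincipal_types_def
      using tp_is_type[OF P M xs(1)] False xs by (auto simp: tuples_def tp_def Suc_le_eq)
    then obtain zs where "zs \<in> tuples N ?n" "\<forall>f\<in>?p. holds N f zs"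
      using trace unfolding trace_def by blast
    then show ?thesis using tp_eqI[OF L, of xs zs M N] by (auto simp: tuples_def)
  qed
qed

section \<open>The back-and-forth game on a computable copy\<close>

definition position :: "nat list \<Rightarrow> nat list \<Rightarrow> nat" where
  "position us vs = list_encode (map prod_encode (zip us vs))"

text \<open>A spoiler move is a pair of a side and an element; playing outside the structure is void.\<close>

definition bf_step :: "nat set \<Rightarrow> nat \<Rightarrow> nat \<Rightarrow> nat \<Rightarrow> nat" where
  "bf_step D p a b =
    (if prod_encode (0, psnd a) \<in> D
     then ccons (if pfst a = 0 then prod_encode (psnd a, b) else prod_encode (b, psnd a)) p
     else p)"

definition cmap :: "(nat \<Rightarrow> nat) \<Rightarrow> nat \<Rightarrow> nat" where
  "cmap f c = list_encode (map f (list_decode c))"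

text \<open>The number \<open>m\<close> codes an atomic fact in the format of \<open>diagram\<close>, with indices into the position
  in place of elements.\<close>

definition bf_good :: "nat set \<Rightarrow> nat \<Rightarrow> nat \<Rightarrow> bool" where
  "bf_good D p m \<longleftrightarrow>
    (\<forall>i<clen p. prod_encode (0, pfst (cnth p i)) \<in> D \<and> prod_encode (0, psnd (cnth p i)) \<in> D \<and>
       (\<forall>j<clen p. pfst (cnth p i) = pfst (cnth p j) \<longleftrightarrow> psnd (cnth p i) = psnd (cnth p j))) \<and>
    (pfst m \<noteq> 0 \<and> (\<forall>i<clen (psnd (psnd m)). cnth (psnd (psnd m)) i < clen p) \<longrightarrow>
      (prod_encode (pfst m, prod_encode (pfst (psnd m), cmap (\<lambda>i. pfst (cnth p i)) (psnd (psnd m)))) \<in> D \<longleftrightarrow>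
       prod_encode (pfst m, prod_encode (pfst (psnd m), cmap (\<lambda>i. psnd (cnth p i)) (psnd (psnd m)))) \<in> D))"

lemma cmap_simps: "cmap f c = (if c = 0 then 0 else ccons (f (chd c)) (cmap f (ctl c)))"
  by (cases c rule: ccons_cases) (simp_all add: cmap_def)

lemma comp_cmap:
  assumes f: "comp_fun X (\<lambda>v. f (pfst v) (psnd v))"
  shows "comp_fun X (\<lambda>v. cmap (f (pfst v)) (psnd v))"
proof (rule comp_course_of_values[where H = "\<lambda>w n g. if n = 0 then 0 else ccons (f w (chd n)) (g (ctl n))"])
  show "cmap (f w) n = (if n = 0 then 0 else ccons (f w (chd n)) (cmap (f w) (ctl n)))" for w n
    by (rule cmap_simps)
  fix w n and g g' :: "nat \<Rightarrow> nat" assume "\<And>i. i < n \<Longrightarrow> g i = g' i"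
  then show "(if n = 0 then 0 else ccons (f w (chd n)) (g (ctl n))) =
      (if n = 0 then 0 else ccons (f w (chd n)) (g' (ctl n)))"
    by (simp add: ctl_less)
next
  show "comp_fun X (\<lambda>v. if pfst (psnd v) = 0 then 0 else ccons (f (pfst v) (chd (pfst (psnd v))))
      (cnth (psnd (psnd v)) (pfst (psnd v) - 1 - ctl (pfst (psnd v)))))"
    by (intro comp_basic comp_apply2[OF f])
qed

lemma closed_game_bf:
  assumes "computable_in X D"
  shows "closed_game X (bf_step D) (bf_good D)"
proof
  have D: "dec X (\<lambda>n. n \<in> D)" using assms by (simp add: dec_computable_in)
  show "comp_fun X (\<lambda>v. bf_step D (pfst v) (pfst (psnd v)) (psnd (psnd v)))"
    unfolding bf_step_def by (intro comp_basic dec_apply[OF D])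
  have "comp_fun X (\<lambda>v. cmap (\<lambda>i. pfst (cnth (pfst v) i)) (psnd v))"
    "comp_fun X (\<lambda>v. cmap (\<lambda>i. psnd (cnth (pfst v) i)) (psnd v))"
    by (rule comp_cmap, intro comp_basic)+
  note comp_cmap' = this[THEN comp_apply2]
  show "dec X (\<lambda>v. bf_good D (pfst v) (psnd v))"
    unfolding bf_good_def by (intro comp_basic dec_apply[OF D] dec_all_less comp_cmap')
qed

lemma diagram_iff:
  "prod_encode (0, a) \<in> diagram \<tau> B \<longleftrightarrow> a \<in> carrier B" (is ?a0)
  "prod_encode (1, prod_encode (k, list_encode xs)) \<in> diagram \<tau> B \<longleftrightarrow>
     rel_ar \<tau> k = Some (length xs) \<and> set xs \<subseteq> carrier B \<and> relI B k xs" (is ?a1)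
  "prod_encode (2, prod_encode (k, list_encode (z # xs))) \<in> diagram \<tau> B \<longleftrightarrow>
     fun_ar \<tau> k = Some (length xs) \<and> set xs \<subseteq> carrier B \<and> funI B k xs = z" (is ?a2)
  "prod_encode (2, prod_encode (k, 0)) \<notin> diagram \<tau> B" (is ?a3)
  "prod_encode (Suc (Suc (Suc t)), n) \<notin> diagram \<tau> B" (is ?a4)
proof -
  have "list_encode ys = 0 \<longleftrightarrow> ys = []" for ys by (cases ys) simp_all
  note list_encode_eq_0 = this this[THEN eq_commute[THEN trans]]
  show ?a0 ?a1 ?a2 ?a3 ?a4
    by (auto simp: diagram_def tuples_def list_encode_eq list_encode_eq_0
        simp del: list_encode_Cons_ccons)
qed

lemma clen_position: "length us = length vs \<Longrightarrow> clen (position us vs) = length us"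
  by (simp add: position_def clen_def)

lemma cnth_position:
  "length us = length vs \<Longrightarrow> i < length us \<Longrightarrow> cnth (position us vs) i = prod_encode (us ! i, vs ! i)"
  by (simp add: position_def cnth_list_encode)

lemma cmap_position:
  assumes "length us = length vs" "set idx \<subseteq> {..<length us}"
  shows "cmap (\<lambda>i. pfst (cnth (position us vs) i)) (list_encode idx) = list_encode (map ((!) us) idx)"
    and "cmap (\<lambda>i. psnd (cnth (position us vs) i)) (list_encode idx) = list_encode (map ((!) vs) idx)"
  using assms by (auto simp: cmap_def cnth_position intro!: arg_cong[where f = list_encode] map_cong)

text \<open>\<open>bf_step\<close> accepts any reply; one outside the carrier is detected by the
  first clause of \<open>bf_good\<close>. As m varies, the second clause runs through all symbols
  and index lists.\<close>

lemma bf_good_iff: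
  assumes B: "is_struct \<tau> B" and len: "length us = length vs"
  shows "(\<forall>m. bf_good (diagram \<tau> B) (position us vs) m) \<longleftrightarrow> atomic_match \<tau> B us B vs"
proof
  let ?D = "diagram \<tau> B" and ?p = "position us vs"
  assume good: "\<forall>m. bf_good ?D ?p m"
  have elem: "us ! i \<in> carrier B" "vs ! i \<in> carrier B" "j < length us \<Longrightarrow> us ! i = us ! j \<longleftrightarrow> vs ! i = vs ! j"
    if "i < length us" for i j
    using good that len unfolding bf_good_def by (simp_all add: clen_position cnth_position diagram_iff)
  have fact: "prod_encode (t, prod_encode (k, list_encode (map ((!) us) idx))) \<in> ?D \<longleftrightarrow>
      prod_encode (t, prod_encode (k, list_encode (map ((!) vs) idx))) \<in> ?D"
    if "t \<noteq> 0" "set idx \<subseteq> {..<length us}" for t k idx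
  proof -
    have "bf_good ?D ?p (prod_encode (t, prod_encode (k, list_encode idx)))" using good by blast
    moreover have "\<forall>i<clen (list_encode idx). cnth (list_encode idx) i < clen ?p"
      using that(2) len by (auto simp: clen_position cnth_list_encode dest: nth_mem)
    ultimately show ?thesis
      unfolding bf_good_def using that(1) cmap_position[OF len that(2)] by simp
  qed
  have us: "set us \<subseteq> carrier B" and vs: "set vs \<subseteq> carrier B"
    using elem(1,2) len by (auto simp: in_set_conv_nth)
  have sub: "set (map ((!) us) idx) \<subseteq> carrier B" "set (map ((!) vs) idx) \<subseteq> carrier B"
    if "set idx \<subseteq> {..<length us}" for idx
    using that elem(1,2) by auto
  have "relI B k (map ((!) us) idx) \<longleftrightarrow> relI B k (map ((!) vs) idx)"
    if "rel_ar \<tau> k = Some (length idx)" "set idx \<subseteq> {..<length us}" for k idx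
    using fact[of 1 idx k] that sub[OF that(2)] unfolding diagram_iff by simp
  moreover have "funI B k (map ((!) us) idx) = us ! i \<longleftrightarrow> funI B k (map ((!) vs) idx) = vs ! i"
    if "fun_ar \<tau> k = Some (length idx)" "set idx \<subseteq> {..<length us}" "i < length us" for k idx i
    using fact[of 2 "i # idx" k] that sub[OF that(2)] unfolding list.map diagram_iff by simp
  ultimately show "atomic_match \<tau> B us B vs"
    unfolding atomic_match_def using len us vs elem(3) by blast
next
  let ?D = "diagram \<tau> B" and ?p = "position us vs"
  assume match: "atomic_match \<tau> B us B vs"
  then have us: "set us \<subseteq> carrier B" and vs: "set vs \<subseteq> carrier B" by (simp_all add: atomic_match_def)
  have elem: "us ! i \<in> carrier B" "vs ! i \<in> carrier B" if "i < length us" for i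
    using us vs that len by auto
  have fact: "prod_encode (t, prod_encode (k, list_encode (map ((!) us) idx))) \<in> ?D \<longleftrightarrow>
      prod_encode (t, prod_encode (k, list_encode (map ((!) vs) idx))) \<in> ?D"
    if t: "t \<noteq> 0" and idx: "set idx \<subseteq> {..<length us}" for t k idx
  proof -
    have sub: "set (map ((!) us) js) \<subseteq> carrier B" "set (map ((!) vs) js) \<subseteq> carrier B"
      if "set js \<subseteq> {..<length us}" for js using that elem by auto
    \<comment> \<open>Tag 1 marks relations and tag 2 graphs of functions, with the value at the
      head of the list; larger tags never occur in a diagram.\<close>
    consider "t = 1" | "t = 2" | s where "t = Suc (Suc (Suc s))"
      using t by (metis One_nat_def Suc_1 old.nat.exhaust)
    then show ?thesis
    proof cases
      case 1
      have "relI B k (map ((!) us) idx) \<longleftrightarrow> relI B k (map ((!) vs) idx)"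
        if "rel_ar \<tau> k = Some (length idx)"
        using atomic_matchD(2)[OF match that idx] .
      then show ?thesis unfolding 1 diagram_iff using sub[OF idx] by auto
    next
      case 2
      show ?thesis
      proof (cases idx)
        case Nil
        then show ?thesis by simp
      next
        case (Cons i js)
        have js: "set js \<subseteq> {..<length us}" "i < length us" using idx Cons by auto
        have "funI B k (map ((!) us) js) = us ! i \<longleftrightarrow> funI B k (map ((!) vs) js) = vs ! i"
          if "fun_ar \<tau> k = Some (length js)"
          using atomic_matchD(3)[OF match that js] .
        then show ?thesis unfolding 2 Cons list.map diagram_iff using sub[OF js(1)] by auto
      qed
    next
      case 3
      then show ?thesis by (simp add: diagram_iff)
    qed
  qed
  show "\<forall>m. bf_good ?D ?p m"
  proof
    fix m
    obtain t k idx where m: "m = prod_encode (t, prod_encode (k, list_encode idx))"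
      by (metis encode_pfst_psnd list_decode_inverse)
    have "set idx \<subseteq> {..<length us}" if "\<forall>i<clen (list_encode idx). cnth (list_encode idx) i < clen ?p"
      using that len by (auto simp: clen_position cnth_list_encode in_set_conv_nth)
    then have "t \<noteq> 0 \<and> (\<forall>i<clen (list_encode idx). cnth (list_encode idx) i < clen ?p) \<longrightarrow>
      (prod_encode (t, prod_encode (k, cmap (\<lambda>i. pfst (cnth ?p i)) (list_encode idx))) \<in> ?D \<longleftrightarrow>
       prod_encode (t, prod_encode (k, cmap (\<lambda>i. psnd (cnth ?p i)) (list_encode idx))) \<in> ?D)"
      using fact cmap_position[OF len] by metis
    then show "bf_good ?D ?p m"
      unfolding bf_good_def m pfst_encode psnd_encode
      using elem atomic_matchD(1)[OF match] len
      by (auto simp: clen_position cnth_position diagram_iff)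
  qed
qed

lemma bf_step_position:
  "a \<in> carrier B \<Longrightarrow> bf_step (diagram \<tau> B) (position us vs) (prod_encode (0, a)) b = position (a # us) (b # vs)"
  "a \<in> carrier B \<Longrightarrow> bf_step (diagram \<tau> B) (position us vs) (prod_encode (1, a)) b = position (b # us) (a # vs)"
  by (simp_all add: bf_step_def diagram_iff position_def)

text \<open>Winning all lengths below \<open>omega1_CK X\<close> is itself a back-and-forth system,
  since \<open>bounding\<close> gives a reply after which it holds again.\<close>

lemma bf_automorphism:
  assumes B: "is_struct \<tau> B" and X: "computable_in X (diagram \<tau> B)" and len: "length us = length vs"
    and win: "\<And>\<alpha>. \<alpha> < omega1_CK X \<Longrightarrow> win (bf_step (diagram \<tau> B)) (bf_good (diagram \<tau> B)) \<alpha> (position us vs)"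
    and pos: "0 < omega1_CK X"
  shows "isomorphic_tuples \<tau> B us B vs"
proof -
  let ?win = "win (bf_step (diagram \<tau> B)) (bf_good (diagram \<tau> B))"
  define I where "I us vs \<longleftrightarrow> length us = length vs \<and> (\<forall>\<alpha><omega1_CK X. ?win \<alpha> (position us vs))" for us vs
  have extend: "\<exists>b. \<forall>\<alpha>. ?win \<alpha> (bf_step (diagram \<tau> B) (position us vs) a b)" if "I us vs" for us vs a
    by (rule closed_game.bounding[OF closed_game_bf[OF X]]) (use that in \<open>simp add: I_def\<close>)
  show ?thesis
  proof (rule back_and_forth[where I = I])
    show "atomic_match \<tau> B us B vs" if "I us vs" for us vs
    proof -
      \<comment> \<open>A win of length 0 already says that the present position is good, hence
        \<open>pos\<close>.\<close>
      have "?win 0 (position us vs)" using that pos by (simp add: I_def)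
      then have "\<forall>m. bf_good (diagram \<tau> B) (position us vs) m" by (subst (asm) win.simps) blast
      then show ?thesis using bf_good_iff[OF B] that by (simp add: I_def)
    qed
    show "\<exists>b. I (a # us) (b # vs)" if "I us vs" "a \<in> carrier B" for us vs a
      using extend[OF that(1), of "prod_encode (0, a)"] that
      by (auto simp: bf_step_position I_def)
    show "\<exists>a. I (a # us) (b # vs)" if "I us vs" "b \<in> carrier B" for us vs b
      using extend[OF that(1), of "prod_encode (1, b)"] bf_step_position(2)[OF that(2)] that
      by (auto simp: I_def)
    show "I us vs" using len win by (simp add: I_def)
  qed (rule B)+
qed

text \<open>Ensures that the minimum in \<open>omega1_of\<close> is attained. The carrier is moved
  into the natural numbers, and the diagram of the copy serves as its own oracle.\<close>

lemma computes_copy_exists: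
  assumes N: "is_struct \<tau> N"
  shows "\<exists>X. computes_copy \<tau> X N"
proof -
  let ?h = "to_nat_on (carrier N)"
  have inj: "inj_on ?h (carrier N)" using N inj_on_to_nat_on by (auto simp: is_struct_def)
  define g where "g = inv_into (carrier N) ?h"
  have g: "g (?h a) = a" if "a \<in> carrier N" for a using inj that by (simp add: g_def)
  have map_g: "map g (map ?h xs) = xs" if "set xs \<subseteq> carrier N" for xs
    using that g by (auto simp: map_idI subset_iff)
  define B where "B = \<lparr>carrier = ?h ` carrier N, relI = \<lambda>k ys. relI N k (map g ys),
    funI = \<lambda>k ys. ?h (funI N k (map g ys))\<rparr>"
  have iso: "iso_map \<tau> N B ?h"
    unfolding iso_map_def
  proof (intro conjI allI impI ballI)
    show "bij_betw ?h (carrier N) (carrier B)" using inj by (simp add: B_def bij_betw_def)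
  qed (use map_g in \<open>auto simp: B_def tuples_def\<close>)
  have "is_struct \<tau> B"
    unfolding is_struct_def
  proof (intro conjI allI impI ballI)
    fix k n ys assume k: "fun_ar \<tau> k = Some n" and "ys \<in> tuples B n"
    then have "map g ys \<in> tuples N n" using g by (auto simp: tuples_def B_def)
    then show "funI B k ys \<in> carrier B" using N k by (auto simp: is_struct_def B_def)
  qed (use N in \<open>auto simp: B_def is_struct_def\<close>)
  then show ?thesis
    unfolding computes_copy_def isomorphic_def using iso computable_in_oracle by blast
qed

section \<open>Homogeneity of fiber models\<close>

lemma branch_models:
  assumes "sacks_branch \<tau> \<phi> T" "models \<tau> M (snd (T \<delta>))" "\<gamma> \<le> \<delta>"
  shows "models \<tau> M (snd (T \<gamma>))"
  using assms unfolding sacks_branch_def models_def by (metis order.order_iff_strict subsetD)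

lemma branch_mono:
  assumes "sacks_branch \<tau> \<phi> T" "\<gamma> \<le> \<delta>"
  shows "fst (T \<gamma>) \<subseteq> fst (T \<delta>)"
  using assms unfolding sacks_branch_def by (metis order.order_iff_strict order.refl)

lemma branch_theory_in: "sacks_branch \<tau> \<phi> T \<Longrightarrow> theory_in \<tau> (T \<gamma>)"
  unfolding sacks_branch_def using node_theory_in by blast

lemma branch_tp_forth:
  assumes T: "sacks_branch \<tau> \<phi> T" and N: "models \<tau> N (snd (T \<delta>))" and le: "\<beta> < \<alpha>" "\<alpha> \<le> \<delta>"
    and xs: "set xs \<subseteq> carrier N" and ys: "set ys \<subseteq> carrier N"
    and eq: "tp \<tau> (fst (T \<alpha>)) N xs = tp \<tau> (fst (T \<alpha>)) N ys" and a: "a \<in> carrier N"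
  shows "\<exists>b\<in>carrier N. tp \<tau> (fst (T \<beta>)) N (a # xs) = tp \<tau> (fst (T \<beta>)) N (b # ys)"
proof (rule tp_forth[OF branch_theory_in[OF T], of "fst (T \<alpha>)"])
  show "fragment \<tau> (fst (T \<alpha>))" using branch_theory_in[OF T] by (simp add: theory_in_def)
  have "fst (T (osuc \<beta>)) = next_language \<tau> (T \<beta>)" using T by (simp add: sacks_branch_def child_def)
  then show "next_language \<tau> (T \<beta>) \<subseteq> fst (T \<alpha>)" using branch_mono[OF T osuc_le[OF le(1)]] by simp
qed (use branch_models[OF T N] le xs ys eq a in auto)

text \<open>The game lives on the copy B, the types on N; h translates. Agreement over
  \<open>T \<alpha>\<close> is spent on one reply that leaves agreement over
  \<open>T \<beta>\<close>, uniformly for zero, successors and limits.\<close>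

lemma tp_win:
  assumes T: "sacks_branch \<tau> \<phi> T" and N: "models \<tau> N (snd (T \<delta>))"
    and h: "iso_map \<tau> N B h" and B: "is_struct \<tau> B"
  shows "\<alpha> \<le> \<delta> \<Longrightarrow> set xs \<subseteq> carrier N \<Longrightarrow> set ys \<subseteq> carrier N \<Longrightarrow>
    tp \<tau> (fst (T \<alpha>)) N xs = tp \<tau> (fst (T \<alpha>)) N ys \<Longrightarrow>
    win (bf_step (diagram \<tau> B)) (bf_good (diagram \<tau> B)) \<alpha> (position (map h xs) (map h ys))"
proof (induction \<alpha> arbitrary: xs ys rule: less_induct)
  case (less \<alpha>)
  let ?win = "win (bf_step (diagram \<tau> B)) (bf_good (diagram \<tau> B))"
  have frag: "fragment \<tau> (fst (T \<gamma>))" for \<gamma> using branch_theory_in[OF T] by (simp add: theory_in_def)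
  have str: "is_struct \<tau> N" using N by (simp add: models_def)
  have bij: "carrier B = h ` carrier N" using h by (simp add: iso_map_def bij_betw_def)
  have len: "length xs = length ys" using tp_length[OF frag less(5)] .
  have "tp \<tau> (fst (T \<alpha>)) B (map h xs) = tp \<tau> (fst (T \<alpha>)) B (map h ys)"
    using tp_iso[OF h str] less(3-5) by simp
  then have "atomic_match \<tau> B (map h xs) B (map h ys)"
    by (rule tp_atomic_match[OF frag]) (use less(3,4) bij in auto)
  then have "\<forall>m. bf_good (diagram \<tau> B) (position (map h xs) (map h ys)) m"
    using bf_good_iff[OF B] len by simp
  moreover have "\<exists>b. ?win \<beta> (bf_step (diagram \<tau> B) (position (map h xs) (map h ys)) m b)"
    if \<beta>: "\<beta> < \<alpha>" for \<beta> m
  proof -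
    have le: "\<beta> \<le> \<delta>" using \<beta> less(2) by simp
    obtain s e where m: "m = prod_encode (s, e)" by (metis encode_pfst_psnd)
    show ?thesis
    proof (cases "e \<in> carrier B")
      case False
      \<comment> \<open>A void move leaves the position unchanged, so restricting the types to the
        smaller fragment suffices.\<close>
      have "tp \<tau> (fst (T \<beta>)) N xs = tp \<tau> (fst (T \<beta>)) N ys"
        by (rule tp_antimono[OF branch_mono[OF T] frag less(5)]) (use \<beta> in simp)
      then have "?win \<beta> (position (map h xs) (map h ys))"
        using less(1)[OF \<beta> le] less(3,4) by blast
      then show ?thesis using False by (simp add: bf_step_def m diagram_iff)
    next
      case True
      then obtain a where a: "a \<in> carrier N" "e = h a" using bij by blast
      show ?thesis
      proof (cases "s = 0")
        case True
        obtain b where "b \<in> carrier N" "tp \<tau> (fst (T \<beta>)) N (a # xs) = tp \<tau> (fst (T \<beta>)) N (b # ys)"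
          using branch_tp_forth[OF T N \<beta> less(2-5) a(1)] by blast
        then have "?win \<beta> (position (map h (a # xs)) (map h (b # ys)))"
          using less(1)[OF \<beta> le, of "a # xs" "b # ys"] less(3,4) a by simp
        then show ?thesis using True \<open>e \<in> carrier B\<close> a(2)
          by (intro exI[of _ "h b"]) (simp add: m bf_step_position)
      next
        case False
        \<comment> \<open>The spoiler plays on the second side, so the two tuples exchange
          roles.\<close>
        obtain b where "b \<in> carrier N" "tp \<tau> (fst (T \<beta>)) N (a # ys) = tp \<tau> (fst (T \<beta>)) N (b # xs)"
          using branch_tp_forth[OF T N \<beta> less(2,4,3) less(5)[symmetric] a(1)] by blast
        then have "?win \<beta> (position (map h (b # xs)) (map h (a # ys)))"
          using less(1)[OF \<beta> le, of "b # xs" "a # ys"] less(3,4) a by simp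
        then show ?thesis using False \<open>e \<in> carrier B\<close> a(2)
          by (intro exI[of _ "h b"]) (simp add: m bf_step_def position_def diagram_iff)
      qed
    qed
  qed
  ultimately show ?case by (subst win.simps) blast
qed

text \<open>An oracle X attaining \<open>omega1_of\<close> makes \<delta> equal to
  \<open>omega1_CK X\<close>, so the levels below \<delta> supply exactly the wins required for an
  automorphism of the copy.\<close>

lemma fiber_model_homogeneous:
  assumes T: "sacks_branch \<tau> \<phi> T" and N: "fiber_model \<tau> T \<delta> N" and pos: "0 < \<delta>"
    and xs: "set xs \<subseteq> carrier N" and ys: "set ys \<subseteq> carrier N"
    and eq: "tp \<tau> (fst (T \<delta>)) N xs = tp \<tau> (fst (T \<delta>)) N ys" and a: "a \<in> carrier N"
  shows "\<exists>b\<in>carrier N. tp \<tau> (fst (T \<delta>)) N (a # xs) = tp \<tau> (fst (T \<delta>)) N (b # ys)"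
proof -
  have mod: "models \<tau> N (snd (T \<delta>))" and str: "is_struct \<tau> N" and rank: "omega1_of \<tau> N = \<delta>"
    using N by (simp_all add: fiber_model_def models_def)
  have frag: "fragment \<tau> (fst (T \<gamma>))" for \<gamma> using branch_theory_in[OF T] by (simp add: theory_in_def)
  have "\<exists>X. computes_copy \<tau> X N \<and> \<delta> = omega1_CK X"
    using computes_copy_exists[OF str]
      LeastI_ex[of "\<lambda>\<alpha>. \<exists>X. computes_copy \<tau> X N \<and> \<alpha> = omega1_CK X"] rank
    unfolding omega1_of_def by blast
  then obtain X B h where \<delta>: "\<delta> = omega1_CK X" and B: "is_struct \<tau> B"
    and X: "computable_in X (diagram \<tau> B)" and h: "iso_map \<tau> N B h"
    unfolding computes_copy_def isomorphic_def by blast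
  have bij: "bij_betw h (carrier N) (carrier B)" using h by (simp add: iso_map_def)
  have "isomorphic_tuples \<tau> B (map h xs) B (map h ys)"
  proof (rule bf_automorphism[OF B X])
    show "length (map h xs) = length (map h ys)" using tp_length[OF frag eq] by simp
    show "0 < omega1_CK X" using pos \<delta> by simp
    fix \<alpha> assume "\<alpha> < omega1_CK X"
    then have le: "\<alpha> \<le> \<delta>" using \<delta> by simp
    show "win (bf_step (diagram \<tau> B)) (bf_good (diagram \<tau> B)) \<alpha> (position (map h xs) (map h ys))"
      by (rule tp_win[OF T mod h B le xs ys tp_antimono[OF branch_mono[OF T le] frag eq]])
  qed
  then obtain g where g: "iso_map \<tau> B B g" "map g (map h xs) = map h ys"
    unfolding isomorphic_tuples_def by blast
  have "h a \<in> carrier B" using bij a by (auto simp: bij_betw_def)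
  then have "g (h a) \<in> carrier B" using g(1) by (auto simp: iso_map_def bij_betw_def)
  \<comment> \<open>The image of a under the automorphism g, pulled back along h.\<close>
  then obtain b where b: "b \<in> carrier N" "h b = g (h a)" using bij unfolding bij_betw_def by (metis imageE)
  have sub: "set (map h (a # xs)) \<subseteq> carrier B" using bij a xs by (auto simp: bij_betw_def)
  have "tp \<tau> (fst (T \<delta>)) N (a # xs) = tp \<tau> (fst (T \<delta>)) B (map h (a # xs))"
    using tp_iso[OF h str, of "a # xs"] a xs by simp
  also have "\<dots> = tp \<tau> (fst (T \<delta>)) B (map g (map h (a # xs)))"
    using tp_iso[OF g(1) B sub] by simp
  also have "map g (map h (a # xs)) = map h (b # ys)" using g(2) b(2) by simp
  also have "tp \<tau> (fst (T \<delta>)) B (map h (b # ys)) = tp \<tau> (fst (T \<delta>)) N (b # ys)"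
    using tp_iso[OF h str, of "b # ys"] b(1) ys by simp
  finally show ?thesis using b(1) by blast
qed

text \<open>First realize the type of \<open>a # xs\<close> anywhere in N, by
  \<open>b' # ys'\<close> say. The tail \<open>ys'\<close> then has the type of \<open>ys\<close>,
  and homogeneity of N moves the extension from \<open>ys'\<close> to \<open>ys\<close>.\<close>

lemma fiber_models_forth:
  assumes T: "sacks_branch \<tau> \<phi> T" and M: "fiber_model \<tau> T \<delta> M" and N: "fiber_model \<tau> T \<delta> N"
    and pos: "0 < \<delta>" and trace: "trace \<tau> (T \<delta>) M = trace \<tau> (T \<delta>) N"
    and xs: "set xs \<subseteq> carrier M" and ys: "set ys \<subseteq> carrier N"
    and eq: "tp \<tau> (fst (T \<delta>)) M xs = tp \<tau> (fst (T \<delta>)) N ys" and a: "a \<in> carrier M"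
  shows "\<exists>b\<in>carrier N. tp \<tau> (fst (T \<delta>)) M (a # xs) = tp \<tau> (fst (T \<delta>)) N (b # ys)"
proof -
  have frag: "fragment \<tau> (fst (T \<delta>))" using branch_theory_in[OF T] by (simp add: theory_in_def)
  have "\<exists>zs. set zs \<subseteq> carrier N \<and> tp \<tau> (fst (T \<delta>)) M (a # xs) = tp \<tau> (fst (T \<delta>)) N zs"
    using M N trace xs a by (intro tp_realized[OF branch_theory_in[OF T]]) (auto simp: fiber_model_def)
  then obtain zs where zs: "set zs \<subseteq> carrier N" "tp \<tau> (fst (T \<delta>)) M (a # xs) = tp \<tau> (fst (T \<delta>)) N zs"
    by blast
  obtain b' ys' where c: "zs = b' # ys'" using tp_length[OF frag zs(2)] by (cases zs) auto
  have "tp \<tau> (fst (T \<delta>)) N ys' = tp \<tau> (fst (T \<delta>)) N ys"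
    using tp_tail[OF frag] zs(2) eq unfolding c by metis
  then obtain b where "b \<in> carrier N" "tp \<tau> (fst (T \<delta>)) N (b' # ys') = tp \<tau> (fst (T \<delta>)) N (b # ys)"
    using fiber_model_homogeneous[OF T N pos, of ys' ys b'] ys zs(1) unfolding c by auto
  then show ?thesis using zs(2) unfolding c by auto
qed

theorem mainTheorem7:
  fixes \<tau> :: vocabulary and \<phi> :: fm
    and T :: "omega1 \<Rightarrow> node" and C :: "omega1 set" and \<delta> :: omega1
    and M :: "'a struct" and M' :: "'b struct" and c :: "'a list" and d :: "'b list"
  assumes "minimal_counterexample \<tau> \<phi>"
    and "sacks_branch \<tau> \<phi> T"
    and "sacks_club \<tau> \<phi> T C"
    and "\<delta> \<in> S_circ \<tau> \<phi> C"
    and "fiber_model \<tau> T \<delta> M"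
    and "fiber_model \<tau> T \<delta> M'"
    and "trace \<tau> (T \<delta>) M = trace \<tau> (T \<delta>) M'"
    and "set c \<subseteq> carrier M"
    and "set d \<subseteq> carrier M'"
    and "tp \<tau> (fst (T \<delta>)) M c = tp \<tau> (fst (T \<delta>)) M' d"
  shows "isomorphic_tuples \<tau> M c M' d"
proof -
  note T = assms(2) and M = assms(5) and M' = assms(6)
  \<comment> \<open>Members of the club exceed \<open>omega\<close>, which gives the positive length
    that the game needs.\<close>
  have "omega < \<delta>" using assms(3,4) by (auto simp: S_circ_def sacks_club_def)
  then have pos: "0 < \<delta>" using zero_le_omega1[of omega] by simp
  have frag: "fragment \<tau> (fst (T \<delta>))" using branch_theory_in[OF T] by (simp add: theory_in_def)
  define I where "I xs ys \<longleftrightarrow> set xs \<subseteq> carrier M \<and> set ys \<subseteq> carrier M' \<and>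
    tp \<tau> (fst (T \<delta>)) M xs = tp \<tau> (fst (T \<delta>)) M' ys" for xs ys
  show ?thesis
  proof (rule back_and_forth[where I = I])
    show "is_struct \<tau> M" "is_struct \<tau> M'" using M M' by (simp_all add: fiber_model_def models_def)
    show "atomic_match \<tau> M xs M' ys" if "I xs ys" for xs ys
      using that by (auto simp: I_def intro: tp_atomic_match[OF frag])
    show "\<exists>b. I (a # xs) (b # ys)" if "I xs ys" "a \<in> carrier M" for xs ys a
      using fiber_models_forth[OF T M M' pos assms(7), of xs ys a] that by (auto simp: I_def)
    \<comment> \<open>The hypotheses are symmetric in the two models, so the same lemma serves with
      them exchanged.\<close>
    show "\<exists>a. I (a # xs) (b # ys)" if "I xs ys" "b \<in> carrier M'" for xs ys b
      using fiber_models_forth[OF T M' M pos assms(7)[symmetric], of ys xs b] that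
      by (auto simp: I_def)
    show "I c d" using assms(8-10) by (simp add: I_def)
  qed
qed

end
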